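(* Let $(H_1^0,H_2^0)$ and $(H_1,H_2)$ be two commuting pairs of bounded self-adjoint operators in a separable Hilbert space $\mathcal{H}$ such that $V_j:=H_j-H_j^0\in \mathcal{B}_2(\mathcal{H})$ for $j=1,2$, and let $[a,b]$ be a real interval with $\bigcup_{j=1}^2\{\sigma(H_j) \cup \sigma(H_j^0)\} \subseteq [a,b]$. Then there exists a unique complex Borel measure $\mu$ on $[a,b]^2$ such that, for all polynomials $p_1(x,y)=\sum_{0\leq i+j\leq n} c(i,j) x^iy^j$ and $p_2(x,y)=\sum_{0\leq r+s\leq m} d(r,s) x^ry^s$ with complex coefficients, $$\mathrm{Tr}\Big\{\int_{H_1^0}^{H_1} p_1(x,H_2^0)\, dx + \int_{H_2^0}^{H_2} p_2(H_1,y)\,dy + \int_{H_1}^{H_1^0} p_1(x,H_2)\,dx+ \int_{H_2}^{H_2^0} p_2(H_1^0,y)\,dy\Big\}$$ $$= \mathrm{Tr}\Big\{\int_{H_1^0}^{H_1} \left[p_1(x,H_2^0) - p_1(x,H_2)\right]dx+ \int_{H_2^0}^{H_2} \left[p_2(H_1,y) - p_2(H_1^0,y)\right]dy\Big\}$$ $$= \int_{[a,b]^2} \left[\frac{\partial p_2}{\partial x}(x,y) - \frac{\partial p_1}{\partial y}(x,y)\right] \mu(dx\times dy).$$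
   Context: $\mathcal{B}_2(\mathcal{H})$ is the set of Hilbert-Schmidt operators, $\sigma(\cdot)$ the spectrum, $\mathrm{Tr}$ the trace of a trace class operator. For a bounded self-adjoint operator $A$, $E_A(\cdot)$ denotes its spectral measure. For self-adjoint operators $A,B$ with spectra in $[a,b]$ and an operator-valued function $x\mapsto F(x)\in\mathcal{B}(\mathcal{H})$ on $[a,b]$ (here $F(x)$ is $p_1(x,C)$ or $p_2(C,x)$ with $C$ self-adjoint with spectrum in $[a,b]$, or a difference of such functions), the symbol $\int_A^B F(x)\,dx$ is defined by $$\int_A^B F(x)\,dx := \int_a^b \left(\int_a^{\alpha} F(x)\, dx \right) [E_B(d\alpha) - E_A(d\alpha)],$$ where the spectral measure stands to the right of the operator-valued integrand, and $\int_a^b T(\alpha)E_A(d\alpha)$ is the operator-norm limit of the Riemann-Stieltjes sums $\sum_i T(\xi_i)E_A(\Delta_i)$ over partitions $\{\Delta_i\}$ of $[a,b]$ into intervals, with $\xi_i\in\Delta_i$, as the mesh tends to $0$. *)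

theory Defs
  imports "HOL-Analysis.Analysis"
begin

section \<open>Complex Hilbert spaces\<close>

text \<open>
  A complex Hilbert space is a real Hilbert space with a compatible complex scalar multiplication
  and a complex inner product whose real part is the real one.  The complex inner product is
  conjugate linear in the first and linear in the second argument.
\<close>

class chilbert_space = banach + real_inner +
  fixes scaleC :: "complex \<Rightarrow> 'a \<Rightarrow> 'a"  (infixr "*\<^sub>C" 75)
    and cinner :: "'a \<Rightarrow> 'a \<Rightarrow> complex"
  assumes scaleC_add_right: "z *\<^sub>C (x + y) = z *\<^sub>C x + z *\<^sub>C y"
    and scaleC_add_left: "(z + w) *\<^sub>C x = z *\<^sub>C x + w *\<^sub>C x"
    and scaleC_scaleC: "z *\<^sub>C w *\<^sub>C x = (z * w) *\<^sub>C x"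
    and scaleC_of_real: "complex_of_real r *\<^sub>C x = r *\<^sub>R x"
    and cinner_commute: "cinner x y = cnj (cinner y x)"
    and cinner_add_right: "cinner x (y + y') = cinner x y + cinner x y'"
    and cinner_scaleC_right: "cinner x (z *\<^sub>C y) = z * cinner x y"
    and Re_cinner: "Re (cinner x y) = inner x y"
begin

definition is_onb :: "'a set \<Rightarrow> bool" where
  "is_onb B \<longleftrightarrow>
     (\<forall>e\<in>B. \<forall>f\<in>B. cinner e f = (if e = f then 1 else 0)) \<and>
     (\<forall>x. (\<forall>e\<in>B. cinner e x = 0) \<longrightarrow> x = 0)"

end

lemma norm_scaleC: "norm (z *\<^sub>C x) = cmod z * norm (x :: 'a :: chilbert_space)"
proof -
  have im: "Im (cinner x x) = 0"
    using arg_cong[OF cinner_commute[of x x], of Im] by simp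
  have xx: "cinner x x = complex_of_real ((norm x)\<^sup>2)"
    by (rule complex_eqI) (simp_all add: Re_cinner dot_square_norm im)
  have "cinner (z *\<^sub>C x) (z *\<^sub>C x) = z * cnj (cinner x (z *\<^sub>C x))"
    by (subst cinner_scaleC_right, subst cinner_commute) simp
  also have "\<dots> = (z * cnj z) * cnj (cinner x x)"
    by (simp add: cinner_scaleC_right)
  also have "\<dots> = complex_of_real ((cmod z * norm x)\<^sup>2)"
    by (simp only: complex_norm_square[symmetric] xx complex_cnj_complex_of_real)
       (simp add: power_mult_distrib)
  finally have "Re (cinner (z *\<^sub>C x) (z *\<^sub>C x)) = (cmod z * norm x)\<^sup>2"
    by (simp only: Re_complex_of_real)
  then have "(norm (z *\<^sub>C x))\<^sup>2 = (cmod z * norm x)\<^sup>2"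
    by (simp only: Re_cinner dot_square_norm)
  then show ?thesis
    by (rule power2_eq_imp_eq) simp_all
qed

lemma bounded_linear_scaleC: "bounded_linear (\<lambda>x :: 'a :: chilbert_space. z *\<^sub>C x)"
proof (rule bounded_linear_intro[where K = "cmod z"])
  show "z *\<^sub>C (x + y) = z *\<^sub>C x + z *\<^sub>C y" for x y :: 'a
    by (rule scaleC_add_right)
  show "z *\<^sub>C (r *\<^sub>R x) = r *\<^sub>R (z *\<^sub>C x)" for r and x :: 'a
    by (simp only: scaleC_of_real[symmetric] scaleC_scaleC mult.commute)
  show "norm (z *\<^sub>C x) \<le> norm x * cmod z" for x :: 'a
    by (simp add: norm_scaleC mult.commute)
qed

section \<open>Bounded operators\<close>

text \<open>
  The type \<open>'a \<Rightarrow>\<^sub>L 'a\<close> consists of the bounded real linear maps, with the operator norm.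
  The bounded operators of the complex space are those satisfying \<open>clinear_op\<close>.
\<close>

type_synonym 'a bop = "'a \<Rightarrow>\<^sub>L 'a"

definition clinear_op :: "'a::chilbert_space bop \<Rightarrow> bool" where
  "clinear_op A \<longleftrightarrow> (\<forall>z x. A (z *\<^sub>C x) = z *\<^sub>C A x)"

lift_definition scalar_op :: "complex \<Rightarrow> 'a::chilbert_space bop" is "\<lambda>z x. z *\<^sub>C x"
  by (rule bounded_linear_scaleC)

primrec op_pow :: "'a::real_normed_vector bop \<Rightarrow> nat \<Rightarrow> 'a bop" where
  "op_pow A 0 = id_blinfun"
| "op_pow A (Suc k) = A o\<^sub>L op_pow A k"

definition selfadjoint_op :: "'a::chilbert_space bop \<Rightarrow> bool" where
  "selfadjoint_op A \<longleftrightarrow> clinear_op A \<and> (\<forall>x y. cinner (A x) y = cinner x (A y))"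

definition positive_op :: "'a::chilbert_space bop \<Rightarrow> bool" where
  "positive_op A \<longleftrightarrow> selfadjoint_op A \<and> (\<forall>x. Re (cinner x (A x)) \<ge> 0)"

text \<open>An inverse of a complex linear operator is automatically complex linear.\<close>

definition op_spectrum :: "'a::chilbert_space bop \<Rightarrow> complex set" where
  "op_spectrum A =
     {z. \<not> (\<exists>R. (A - scalar_op z) o\<^sub>L R = id_blinfun \<and> R o\<^sub>L (A - scalar_op z) = id_blinfun)}"

definition hilbert_schmidt :: "'a::chilbert_space bop \<Rightarrow> bool" where
  "hilbert_schmidt A \<longleftrightarrow>
     clinear_op A \<and> (\<exists>B. is_onb B \<and> (\<lambda>e. (norm (A e))\<^sup>2) summable_on B)"

text \<open>
  \<open>P\<close> is the positive square root of \<open>A\<^sup>*A\<close>; the equation \<open>P\<^sup>2 = A\<^sup>*A\<close> is stated in weak form.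
\<close>

definition is_abs_op :: "'a::chilbert_space bop \<Rightarrow> 'a bop \<Rightarrow> bool" where
  "is_abs_op P A \<longleftrightarrow> positive_op P \<and> (\<forall>x y. cinner (P x) (P y) = cinner (A x) (A y))"

definition trace_class :: "'a::chilbert_space bop \<Rightarrow> bool" where
  "trace_class A \<longleftrightarrow>
     clinear_op A \<and>
     (\<exists>P B. is_abs_op P A \<and> is_onb B \<and> (\<lambda>e. cinner e (P e)) summable_on B)"

text \<open>For trace class operators the choice of the orthonormal basis is irrelevant.\<close>

definition op_trace :: "'a::chilbert_space bop \<Rightarrow> complex" where
  "op_trace A = infsum (\<lambda>e. cinner e (A e)) (SOME B. is_onb B)"

section \<open>Spectral measures and Riemann-Stieltjes integrals\<close>

definition projection_valued_measure :: "(real set \<Rightarrow> 'a::chilbert_space bop) \<Rightarrow> bool" where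
  "projection_valued_measure E \<longleftrightarrow>
     (\<forall>S\<in>sets borel. selfadjoint_op (E S) \<and> E S o\<^sub>L E S = E S) \<and>
     E UNIV = id_blinfun \<and>
     (\<forall>F :: nat \<Rightarrow> real set. range F \<subseteq> sets borel \<longrightarrow> disjoint_family F \<longrightarrow>
        (\<forall>x. (\<lambda>n. E (F n) x) sums E (\<Union>n. F n) x))"

text \<open>The measure \<open>S \<mapsto> \<langle>x, E(S) x\<rangle>\<close>.\<close>

definition diag_measure :: "(real set \<Rightarrow> 'a::chilbert_space bop) \<Rightarrow> 'a \<Rightarrow> real measure" where
  "diag_measure E x = measure_of UNIV (sets borel) (\<lambda>S. ennreal (Re (cinner x (E S x))))"

text \<open>\<open>E\<close> has bounded support and \<open>A = \<integral> \<lambda> E(d\<lambda>)\<close> (weakly).\<close>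

definition is_spectral_measure :: "'a::chilbert_space bop \<Rightarrow> (real set \<Rightarrow> 'a bop) \<Rightarrow> bool" where
  "is_spectral_measure A E \<longleftrightarrow>
     projection_valued_measure E \<and>
     (\<exists>r. E {-r..r} = id_blinfun) \<and>
     (\<forall>x. cinner x (A x) = complex_of_real (\<integral>t. t \<partial>diag_measure E x))"

text \<open>
  For a bounded self-adjoint operator, \<open>E\<close> is unique on the Borel sets; its values on other sets
  are unspecified.
\<close>

definition spectral_measure :: "'a::chilbert_space bop \<Rightarrow> real set \<Rightarrow> 'a bop" where
  "spectral_measure A = (SOME E. is_spectral_measure A E)"

text \<open>
  Norm limit of the sums \<open>\<Sum>\<^sub>i T(\<xi>\<^sub>i) W(\<Delta>\<^sub>i)\<close> over tagged partitions of \<open>[a,b]\<close> into finitely many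
  (open, closed or half-open) intervals, as the mesh tends to 0.
\<close>

definition has_RS_integral ::
  "(real \<Rightarrow> 'a::chilbert_space bop) \<Rightarrow> (real set \<Rightarrow> 'a bop) \<Rightarrow> real \<Rightarrow> real \<Rightarrow> 'a bop \<Rightarrow> bool" where
  "has_RS_integral T W a b I \<longleftrightarrow>
     (\<forall>\<epsilon>>0. \<exists>\<delta>>0. \<forall>P \<xi>.
        finite P \<and> partition_on {a..b} P \<and>
        (\<forall>\<Delta>\<in>P. is_interval \<Delta> \<and> diameter \<Delta> < \<delta> \<and> \<xi> \<Delta> \<in> \<Delta>) \<longrightarrow>
        norm ((\<Sum>\<Delta>\<in>P. T (\<xi> \<Delta>) o\<^sub>L W \<Delta>) - I) < \<epsilon>)"

text \<open>
  \<open>op_integral a b A B F\<close> is \<open>\<integral>\<^sub>A\<^sup>B F(x) dx\<close>, that is, the integral of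
  \<open>\<integral>\<^sub>a\<^sup>\<alpha> F(x) dx\<close> against \<open>E\<^sub>B(d\<alpha>) - E\<^sub>A(d\<alpha>)\<close> over \<open>[a,b]\<close>.
\<close>

definition has_op_integral ::
  "real \<Rightarrow> real \<Rightarrow> 'a::chilbert_space bop \<Rightarrow> 'a bop \<Rightarrow> (real \<Rightarrow> 'a bop) \<Rightarrow> 'a bop \<Rightarrow> bool" where
  "has_op_integral a b A B F I \<longleftrightarrow>
     F integrable_on {a..b} \<and>
     has_RS_integral (\<lambda>\<alpha>. integral {a..\<alpha>} F)
       (\<lambda>\<Delta>. spectral_measure B \<Delta> - spectral_measure A \<Delta>) a b I"

definition op_integrable ::
  "real \<Rightarrow> real \<Rightarrow> 'a::chilbert_space bop \<Rightarrow> 'a bop \<Rightarrow> (real \<Rightarrow> 'a bop) \<Rightarrow> bool" where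
  "op_integrable a b A B F \<longleftrightarrow> (\<exists>I. has_op_integral a b A B F I)"

definition op_integral ::
  "real \<Rightarrow> real \<Rightarrow> 'a::chilbert_space bop \<Rightarrow> 'a bop \<Rightarrow> (real \<Rightarrow> 'a bop) \<Rightarrow> 'a bop" where
  "op_integral a b A B F = (THE I. has_op_integral a b A B F I)"

section \<open>Polynomials in two variables\<close>

definition poly2 :: "nat \<Rightarrow> (nat \<Rightarrow> nat \<Rightarrow> complex) \<Rightarrow> real \<Rightarrow> real \<Rightarrow> complex" where
  "poly2 n c x y =
     (\<Sum>(i, j)\<in>{(i, j). i + j \<le> n}. c i j * complex_of_real x ^ i * complex_of_real y ^ j)"

text \<open>A real number \<open>x\<close> is substituted as the operator \<open>x *\<^sub>R id_blinfun\<close>.\<close>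

definition op_poly2 ::
  "nat \<Rightarrow> (nat \<Rightarrow> nat \<Rightarrow> complex) \<Rightarrow> 'a::chilbert_space bop \<Rightarrow> 'a bop \<Rightarrow> 'a bop" where
  "op_poly2 n c X Y =
     (\<Sum>(i, j)\<in>{(i, j). i + j \<le> n}. scalar_op (c i j) o\<^sub>L op_pow X i o\<^sub>L op_pow Y j)"

definition op_poly2_left ::
  "nat \<Rightarrow> (nat \<Rightarrow> nat \<Rightarrow> complex) \<Rightarrow> real \<Rightarrow> 'a::chilbert_space bop \<Rightarrow> 'a bop" where
  "op_poly2_left n c x C = op_poly2 n c (x *\<^sub>R id_blinfun) C"

definition op_poly2_right ::
  "nat \<Rightarrow> (nat \<Rightarrow> nat \<Rightarrow> complex) \<Rightarrow> 'a::chilbert_space bop \<Rightarrow> real \<Rightarrow> 'a bop" where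
  "op_poly2_right n c C y = op_poly2 n c C (y *\<^sub>R id_blinfun)"

definition partial_x :: "(real \<Rightarrow> real \<Rightarrow> complex) \<Rightarrow> real \<Rightarrow> real \<Rightarrow> complex" where
  "partial_x f x y = vector_derivative (\<lambda>t. f t y) (at x)"

definition partial_y :: "(real \<Rightarrow> real \<Rightarrow> complex) \<Rightarrow> real \<Rightarrow> real \<Rightarrow> complex" where
  "partial_y f x y = vector_derivative (\<lambda>t. f x t) (at y)"

section \<open>Complex measures\<close>

text \<open>
  A complex measure on the measurable space \<open>M\<close> is a countably additive function on \<open>sets M\<close>;
  it is represented by its extension by 0 to all sets.
\<close>

definition complex_measure :: "'b measure \<Rightarrow> ('b set \<Rightarrow> complex) \<Rightarrow> bool" where
  "complex_measure M \<nu> \<longleftrightarrow>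
     (\<forall>S. S \<notin> sets M \<longrightarrow> \<nu> S = 0) \<and>
     (\<forall>F :: nat \<Rightarrow> 'b set. range F \<subseteq> sets M \<longrightarrow> disjoint_family F \<longrightarrow>
        (\<lambda>n. \<nu> (F n)) sums \<nu> (\<Union>n. F n))"

text \<open>
  The upper variation of a signed measure \<open>\<sigma>\<close>; its lower variation is the upper variation of
  \<open>-\<sigma>\<close>, and \<open>\<sigma>\<close> is the difference of the two (Jordan decomposition).
\<close>

definition upper_variation :: "'b measure \<Rightarrow> ('b set \<Rightarrow> real) \<Rightarrow> 'b measure" where
  "upper_variation M \<sigma> =
     measure_of (space M) (sets M) (\<lambda>S. SUP U\<in>{U \<in> sets M. U \<subseteq> S}. ennreal (\<sigma> U))"

definition complex_integral ::
  "'b measure \<Rightarrow> ('b set \<Rightarrow> complex) \<Rightarrow> ('b \<Rightarrow> complex) \<Rightarrow> complex" where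
  "complex_integral M \<nu> f =
     (integral\<^sup>L (upper_variation M (\<lambda>S. Re (\<nu> S))) f
        - integral\<^sup>L (upper_variation M (\<lambda>S. - Re (\<nu> S))) f)
     + \<i> * (integral\<^sup>L (upper_variation M (\<lambda>S. Im (\<nu> S))) f
        - integral\<^sup>L (upper_variation M (\<lambda>S. - Im (\<nu> S))) f)"

definition borel_square :: "real \<Rightarrow> real \<Rightarrow> (real \<times> real) measure" where
  "borel_square a b = restrict_space borel ({a..b} \<times> {a..b})"

end

theory Submission
  imports Defs "HOL-Probability.Probability" "HOL-Computational_Algebra.Polynomial"
begin

text \<open>
  Write \<open>V\<^sub>j = H\<^sub>j - H\<^sub>j\<^sup>0\<close>, \<open>P\<^sub>i = H\<^sub>1\<^sup>i - (H\<^sub>1\<^sup>0)\<^sup>i\<close> and \<open>Q\<^sub>j = H\<^sub>2\<^sup>j - (H\<^sub>2\<^sup>0)\<^sup>j\<close>.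

  \<^emph>\<open>Reduction to moments.\<close>  The Riemann-Stieltjes integral of \<open>t\<^sup>k\<close> against the spectral measure of \<open>A\<close> is \<open>A\<^sup>k\<close>, since spectral
  projections of disjoint sets are orthogonal.  Hence \<open>\<integral>\<^sub>A\<^sup>B x\<^sup>k C dx = C (B\<^sup>k\<^sup>+\<^sup>1 - A\<^sup>k\<^sup>+\<^sup>1) / (k + 1)\<close>, and both operators under
  the trace are one and the same combination (\<open>stokes_op\<close>) of products of Hilbert-Schmidt operators: \<open>c x\<^sup>i y\<^sup>j\<close> in \<open>p\<^sub>1\<close>
  contributes \<open>- c Q\<^sub>j P\<^sub>i\<^sub>+\<^sub>1 / (i + 1)\<close>, and \<open>d x\<^sup>r y\<^sup>s\<close> in \<open>p\<^sub>2\<close> contributes \<open>d P\<^sub>r Q\<^sub>s\<^sub>+\<^sub>1 / (s + 1)\<close>.  The trace of such a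
  product does not depend on the order of the factors, so the trace formula is equivalent to \<open>Tr (Q\<^sub>j\<^sub>+\<^sub>1 P\<^sub>i\<^sub>+\<^sub>1) = (i + 1) (j + 1) \<integral> x\<^sup>i y\<^sup>j d\<mu>\<close> for all \<open>i\<close> and \<open>j\<close>.

  \<^emph>\<open>Existence.\<close>  Telescoping gives \<open>P\<^sub>i\<^sub>+\<^sub>1 = \<Sum> H\<^sub>1\<^sup>p V\<^sub>1 (H\<^sub>1\<^sup>0)\<^sup>i\<^sup>-\<^sup>p\<close>, and likewise for \<open>Q\<^sub>j\<^sub>+\<^sub>1\<close>.  On the Hilbert-Schmidt class
  the multiplications \<open>L\<^sub>1\<close>, \<open>L\<^sub>2\<close> by \<open>H\<^sub>1\<close>, \<open>H\<^sub>2\<close> from the left and \<open>R\<^sub>1\<close>, \<open>R\<^sub>2\<close> by \<open>H\<^sub>1\<^sup>0\<close>, \<open>H\<^sub>2\<^sup>0\<close> from the right are four commuting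
  symmetric operators between \<open>a\<close> and \<open>b\<close>.  Moving the factors of \<open>Q\<^sub>j\<^sub>+\<^sub>1\<close> to the other side of the inner product gives
  \<open>Tr (Q\<^sub>j\<^sub>+\<^sub>1 P\<^sub>i\<^sub>+\<^sub>1) = \<Sum> \<langle>V\<^sub>2, L\<^sub>1\<^sup>p R\<^sub>1\<^sup>i\<^sup>-\<^sup>p L\<^sub>2\<^sup>r R\<^sub>2\<^sup>j\<^sup>-\<^sup>r V\<^sub>1\<rangle>\<close>, the sum being over \<open>p \<le> i\<close> and \<open>r \<le> j\<close>.  All Bernstein polynomials of
  degree \<open>i\<close> have the integral \<open>1 / (i + 1)\<close>, so this sum is \<open>(i + 1) (j + 1)\<close> times the average over \<open>s, t\<close> in \<open>[0,1]\<close> of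
  \<open>\<langle>V\<^sub>2, (s L\<^sub>1 + (1 - s) R\<^sub>1)\<^sup>i (t L\<^sub>2 + (1 - t) R\<^sub>2)\<^sup>j V\<^sub>1\<rangle>\<close>.  By polarization one may replace \<open>V\<^sub>1\<close> and \<open>V\<^sub>2\<close> by one vector, \<open>V\<^sub>1 + V\<^sub>2\<close> or
  \<open>V\<^sub>1 - V\<^sub>2\<close>.  For a single vector the averages satisfy the positivity conditions of the Hausdorff moment problem, because
  a product of commuting positive operators is positive (\<open>effect_comp\<close>); so they are the moments of a positive measure
  (\<open>averaged_moment_measure\<close>, \<open>trace_moment_measures\<close>).  The measure \<open>\<mu>\<close> is a quarter of the difference of the two.

  \<^emph>\<open>The moment problem.\<close>  Bernstein weights on the grid of points \<open>(k/n, l/n)\<close> have almost the right moments.  They are transported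
  to the line by a Peano curve, where Helly's selection theorem provides the limit (\<open>moment_measure\<close>).  The same theorem for a
  single operator gives the measures \<open>\<langle>x, E(dt) x\<rangle>\<close>, and with them the spectral theorem (\<open>spectral_measure_exists\<close>).

  \<^emph>\<open>Uniqueness.\<close>  The formula for \<open>p\<^sub>1 = 0\<close> determines all moments of \<open>\<mu>\<close>.  By the Stone-Weierstrass theorem these determine a measure on
  a compact set (\<open>moment_uniqueness\<close>), applied to the upper and lower variations of the real and imaginary parts
  (\<open>complex_measure_eqI\<close>).

  \<^emph>\<open>Trace class.\<close>  Bounds for \<open>\<Sum> \<langle>e, \<bar>D\<bar> e\<rangle>\<close> are obtained by writing \<open>\<bar>D\<bar>\<close>, up to a small error, as \<open>W\<^sup>* D\<close> with a contraction \<open>W\<close>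
  (\<open>trace_class_sum_products\<close>).
\<close>

section \<open>Operators defined by bounded bilinear forms\<close>

text \<open>
  The functional \<open>\<bar>x\<bar>\<^sup>2 / 2 - f x\<close> is bounded below.  By the parallelogram law every minimizing sequence is
  Cauchy, and at the minimum \<open>v\<close> the derivative \<open>\<langle>v, h\<rangle> - f h\<close> vanishes in every direction \<open>h\<close>.
\<close>

lemma riesz_representation:
  fixes f :: "'a::{real_inner,banach} \<Rightarrow> real"
  assumes "bounded_linear f"
  shows "\<exists>v. \<forall>x. f x = inner v x"
proof -
  interpret f: bounded_linear f by fact
  obtain K where K: "\<And>x. norm (f x) \<le> norm x * K"
    using f.bounded by blast
  define g where "g x = (norm x)\<^sup>2 / 2 - f x" for x
  have lower: "- K\<^sup>2 / 2 \<le> g x" for x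
  proof -
    have "f x \<le> norm x * K" using K[of x] by simp
    moreover have "0 \<le> (norm x - K)\<^sup>2" by simp
    ultimately show ?thesis unfolding g_def by (simp add: power2_diff)
  qed
  define I where "I = Inf (range g)"
  have bdd: "bdd_below (range g)"
    using lower by (intro bdd_belowI[where m = "- K\<^sup>2 / 2"]) auto
  have I_le: "I \<le> g x" for x
    unfolding I_def using bdd by (intro cInf_lower) auto
  have par: "(norm (x - y))\<^sup>2 / 4 = g x + g y - 2 * g ((1/2) *\<^sub>R (x + y))" for x y
    unfolding g_def
    by (simp add: f.scaleR f.add power2_norm_eq_inner algebra_simps inner_commute)
       (simp add: field_simps)
  have "\<exists>x. g x < I + 1 / (real n + 1)" for n
  proof -
    have "Inf (range g) < I + 1 / (real n + 1)"
      unfolding I_def by (simp add: add_pos_nonneg)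
    then show ?thesis
      using bdd cInf_less_iff[of "range g"] by auto
  qed
  then obtain X where X: "\<And>n. g (X n) < I + 1 / (real n + 1)" by metis
  have dist: "(norm (X m - X n))\<^sup>2 \<le> 4 * (1 / (real m + 1)) + 4 * (1 / (real n + 1))" for m n
    using par[of "X m" "X n"] I_le[of "(1/2) *\<^sub>R (X m + X n)"] X[of m] X[of n]
    by argo
  have "Cauchy X"
  proof (rule metric_CauchyI)
    fix e :: real assume e: "e > 0"
    obtain M where M: "8 / e\<^sup>2 < real M" using reals_Archimedean2 by blast
    have "dist (X m) (X n) < e" if "m \<ge> M" "n \<ge> M" for m n
    proof -
      have pos: "0 < 8 / e\<^sup>2" using e by simp
      have "4 / (real m + 1) < e\<^sup>2 / 2" "4 / (real n + 1) < e\<^sup>2 / 2"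
      proof -
        have *: "4 / (real k + 1) < e\<^sup>2 / 2" if "k \<ge> M" for k
        proof -
          have "8 / e\<^sup>2 < real k + 1" using M that by linarith
          then have "8 < (real k + 1) * e\<^sup>2" using e by (simp add: field_simps)
          then show ?thesis by (simp add: field_simps)
        qed
        show "4 / (real m + 1) < e\<^sup>2 / 2" "4 / (real n + 1) < e\<^sup>2 / 2"
          using * that by auto
      qed
      then have "(norm (X m - X n))\<^sup>2 < e\<^sup>2" using dist[of m n] by simp
      then show ?thesis using e by (simp add: dist_norm power_less_imp_less_base)
    qed
    then show "\<exists>M. \<forall>m\<ge>M. \<forall>n\<ge>M. dist (X m) (X n) < e" by blast
  qed
  then obtain v where v: "X \<longlonglongrightarrow> v"
    using Cauchy_convergent_iff convergent_def by blast
  have "(\<lambda>n. g (X n)) \<longlonglongrightarrow> g v"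
    unfolding g_def by (intro tendsto_intros f.tendsto v) auto
  moreover have "(\<lambda>n. I + 1 / (real n + 1)) \<longlonglongrightarrow> I + 0"
    using LIMSEQ_inverse_real_of_nat
    by (intro tendsto_add tendsto_const) (simp add: inverse_eq_divide add.commute)
  ultimately have gv: "g v \<le> I"
    using LIMSEQ_le[of "\<lambda>n. g (X n)" "g v" "\<lambda>n. I + 1 / (real n + 1)" I] X
    by (auto intro: less_imp_le)
  have "f h = inner v h" for h
  proof (rule ccontr)
    assume "f h \<noteq> inner v h"
    \<comment> \<open>The minimum over \<open>t\<close> of \<open>t c + t\<^sup>2 N / 2\<close> is at \<open>- c / N\<close>;
        dividing by \<open>N + 1\<close> instead of \<open>N\<close> covers \<open>h = 0\<close> and still gives a negative value.\<close>
    define c where "c = inner v h - f h"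
    define N where "N = inner h h"
    define u where "u = 1 / (N + 1)"
    define t where "t = - c * u"
    have c: "c \<noteq> 0" using \<open>f h \<noteq> inner v h\<close> by (simp add: c_def)
    have N: "N \<ge> 0" by (simp add: N_def)
    have "g v \<le> g (v + t *\<^sub>R h)" using gv I_le[of "v + t *\<^sub>R h"] by linarith
    also have "g (v + t *\<^sub>R h) = g v + t * c + t\<^sup>2 * N / 2"
      unfolding g_def c_def N_def
      by (simp add: f.scaleR f.add power2_norm_eq_inner algebra_simps inner_commute)
         (simp add: power2_eq_square algebra_simps)
    finally have "0 \<le> t * c + t\<^sup>2 * N / 2" by simp
    moreover have "t * c + t\<^sup>2 * N / 2 = - (c\<^sup>2 * u * (1 + u) / 2)"
    proof -
      have uN: "u * N = 1 - u" using N by (simp add: u_def field_simps)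
      have "t * c + t\<^sup>2 * N / 2 = - (c\<^sup>2 * u) + c\<^sup>2 * u * (u * N) / 2"
        by (simp add: t_def power2_eq_square)
      also have "\<dots> = - (c\<^sup>2 * u) + c\<^sup>2 * u * (1 - u) / 2" by (simp only: uN)
      also have "\<dots> = - (c\<^sup>2 * u * (1 + u) / 2)" by (simp add: field_simps)
      finally show ?thesis .
    qed
    moreover have "0 < c\<^sup>2 * u * (1 + u) / 2"
    proof -
      have "0 < u" using N by (simp add: u_def)
      then show ?thesis using c by simp
    qed
    ultimately show False by linarith
  qed
  then show ?thesis by blast
qed

lemma bounded_bilinear_imp_operator:
  fixes f :: "'a::{real_inner,banach} \<Rightarrow> 'a \<Rightarrow> real"
  assumes "bounded_bilinear f"
  shows "\<exists>T :: 'a \<Rightarrow>\<^sub>L 'a. \<forall>x y. inner x (T y) = f x y"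
proof -
  interpret f: bounded_bilinear f by fact
  have "\<exists>v. \<forall>x. f x y = inner v x" for y
    by (rule riesz_representation) (rule f.bounded_linear_left)
  then obtain T where T: "\<And>x y. f x y = inner (T y) x" by metis
  obtain K where K0: "0 \<le> K" and K: "\<And>x y. norm (f x y) \<le> norm x * norm y * K"
    using f.nonneg_bounded by blast
  have eqI: "u = v" if "\<And>x. inner u x = inner v x" for u v :: 'a
    using that[of "u - v"] by (metis inner_diff_left inner_eq_zero_iff eq_iff_diff_eq_0)
  have "bounded_linear T"
  proof (rule bounded_linear_intro[where K = K])
    show "T (x + y) = T x + T y" for x y
      by (rule eqI) (simp add: T[symmetric] f.add_right inner_add_left)
    show "T (r *\<^sub>R x) = r *\<^sub>R T x" for r x
      by (rule eqI) (simp add: T[symmetric] f.scaleR_right)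
    show "norm (T x) \<le> norm x * K" for x
    proof (cases "T x = 0")
      case True
      then show ?thesis
        using K0 by simp
    next
      case False
      have "norm (T x) * norm (T x) = f (T x) x"
        by (simp add: T power2_norm_eq_inner[symmetric] power2_eq_square)
      also have "\<dots> \<le> norm (T x) * norm x * K" using K[of "T x" x] by simp
      finally show ?thesis using False by (simp add: mult.assoc)
    qed
  qed
  then show ?thesis
    by (intro exI[where x = "Blinfun T"]) (simp add: bounded_linear_Blinfun_apply T inner_commute)
qed

lemma inner_right_eqI:
  fixes u v :: "'a::real_inner"
  assumes "\<And>x. inner x u = inner x v"
  shows "u = v"
  using assms[of "u - v"] by (metis inner_diff_right inner_eq_zero_iff eq_iff_diff_eq_0)

definition adj :: "('a::{real_inner,banach} \<Rightarrow>\<^sub>L 'a) \<Rightarrow> 'a \<Rightarrow>\<^sub>L 'a" where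
  "adj A = (SOME T :: 'a \<Rightarrow>\<^sub>L 'a. \<forall>x y. inner x (T y) = inner (A x) y)"

lemma inner_adj_right: "inner x (adj A y) = inner (A x) y"
proof -
  have "bounded_bilinear (\<lambda>x y. inner (A x) y)"
    by (rule bounded_bilinear.comp1[OF bounded_bilinear_inner blinfun.bounded_linear_right])
  then show ?thesis
    unfolding adj_def using someI_ex[OF bounded_bilinear_imp_operator, of "\<lambda>x y. inner (A x) y"]
    by blast
qed

lemma inner_adj_left: "inner (adj A x) y = inner x (A y)"
  by (metis inner_adj_right inner_commute)

lemma adj_unique:
  fixes A T :: "'a::{real_inner,banach} \<Rightarrow>\<^sub>L 'a"
  assumes "\<And>x y. inner x (blinfun_apply T y) = inner (A x) y"
  shows "adj A = T"
  by (rule blinfun_eqI, rule inner_right_eqI) (simp add: inner_adj_right assms)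

lemma adj_adj: "adj (adj A) = A"
  by (rule adj_unique) (simp add: inner_adj_left)

lemma adj_compose: "adj (A o\<^sub>L B) = adj B o\<^sub>L adj A"
  by (rule adj_unique) (simp add: inner_adj_right)

text \<open>
  Since \<open>4 \<langle>x, Ty\<rangle> = \<langle>x + y, T(x + y)\<rangle> - \<langle>x - y, T(x - y)\<rangle>\<close>, the parallelogram law bounds the bilinear form by
  the quadratic one; take for \<open>y\<close> the multiple of \<open>Tx\<close> that has the norm of \<open>x\<close>.
\<close>

lemma norm_symmetric_le:
  fixes T :: "'a::real_inner \<Rightarrow>\<^sub>L 'a"
  assumes sym: "\<And>x y. inner (T x) y = inner x (T y)"
    and d: "d \<ge> 0" and bd: "\<And>x. \<bar>inner x (T x)\<bar> \<le> d * (norm x)\<^sup>2"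
  shows "norm T \<le> d"
proof (rule norm_blinfun_bound[OF d])
  fix x
  show "norm (T x) \<le> d * norm x"
  proof (cases "T x = 0 \<or> x = 0")
    case True
    then show ?thesis using d by auto
  next
    case False
    define r where "r = norm x / norm (T x)"
    define y where "y = r *\<^sub>R T x"
    have ny: "norm y = norm x" using False by (simp add: y_def r_def)
    have xy: "inner x (T y) = norm x * norm (T x)"
      using False unfolding y_def
      by (simp add: blinfun.scaleR_right sym[symmetric] r_def power2_norm_eq_inner[symmetric]
          power2_eq_square)
    have "4 * inner x (T y) = inner (x + y) (T (x + y)) - inner (x - y) (T (x - y))"
      using sym[of x y] by (simp add: blinfun.add_right blinfun.diff_right algebra_simps inner_commute)
    also have "\<dots> \<le> d * (norm (x + y))\<^sup>2 + d * (norm (x - y))\<^sup>2"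
      using bd[of "x + y"] bd[of "x - y"] by linarith
    also have "\<dots> = d * (2 * (norm x)\<^sup>2 + 2 * (norm y)\<^sup>2)"
      by (simp add: power2_norm_eq_inner algebra_simps inner_commute)
    also have "\<dots> = 4 * d * (norm x)\<^sup>2" by (simp add: ny)
    finally have "norm x * norm (T x) \<le> d * norm x * norm x"
      by (simp add: xy power2_eq_square)
    then show ?thesis using False by (simp add: mult.commute mult.left_commute)
  qed
qed

section \<open>Commuting positive operators on a pre-Hilbert space\<close>

text \<open>
  The space is a subspace \<open>V\<close> with a positive semidefinite form that may be degenerate, and \<open>V\<close> need not be complete.
  Besides Hilbert spaces this covers the Hilbert-Schmidt class as a subspace of the bounded operators.
\<close>

locale form_space =
  fixes V :: "'v::real_vector set" and q :: "'v \<Rightarrow> 'v \<Rightarrow> real"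
  assumes subspace_V: "subspace V"
    and q_add: "\<lbrakk>x \<in> V; y \<in> V; z \<in> V\<rbrakk> \<Longrightarrow> q (x + y) z = q x z + q y z"
    and q_scale: "\<lbrakk>x \<in> V; z \<in> V\<rbrakk> \<Longrightarrow> q (c *\<^sub>R x) z = c * q x z"
    and q_commute: "\<lbrakk>x \<in> V; y \<in> V\<rbrakk> \<Longrightarrow> q x y = q y x"
    and q_nonneg: "x \<in> V \<Longrightarrow> 0 \<le> q x x"
begin

lemma V_closed [simp]: "x \<in> V \<Longrightarrow> y \<in> V \<Longrightarrow> x + y \<in> V" "x \<in> V \<Longrightarrow> y \<in> V \<Longrightarrow> x - y \<in> V"
  "x \<in> V \<Longrightarrow> c *\<^sub>R x \<in> V" "0 \<in> V"
  using subspace_V by (auto simp: subspace_add subspace_diff subspace_scale subspace_0)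

lemma q_add_right: "\<lbrakk>x \<in> V; y \<in> V; z \<in> V\<rbrakk> \<Longrightarrow> q z (x + y) = q z x + q z y"
  using q_add[of x y z] q_commute[of z] by simp

lemma q_scale_right: "\<lbrakk>x \<in> V; z \<in> V\<rbrakk> \<Longrightarrow> q z (c *\<^sub>R x) = c * q z x"
  using q_scale[of x z c] q_commute[of z] by simp

lemma q_diff: "\<lbrakk>x \<in> V; y \<in> V; z \<in> V\<rbrakk> \<Longrightarrow> q (x - y) z = q x z - q y z"
  using q_add[of x "(-1) *\<^sub>R y" z] q_scale[of y z "-1"] V_closed(3)[of y "-1"] by simp

lemma q_diff_right: "\<lbrakk>x \<in> V; y \<in> V; z \<in> V\<rbrakk> \<Longrightarrow> q z (x - y) = q z x - q z y"
  using q_diff[of x y z] q_commute[of z] by simp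

lemma q_sum_right: "\<lbrakk>\<And>i. i \<in> I \<Longrightarrow> x i \<in> V; z \<in> V\<rbrakk> \<Longrightarrow> q z (\<Sum>i\<in>I. x i) = (\<Sum>i\<in>I. q z (x i))"
proof (induction I rule: infinite_finite_induct)
  case (insert i I)
  then show ?case
    using subspace_sum[OF subspace_V, of I x] by (simp add: q_add_right)
next
  case empty
  then show ?case using q_scale_right[of 0 z 0] by simp
next
  case (infinite I)
  then show ?case using q_scale_right[of 0 z 0] by simp
qed

lemma q_Cauchy_Schwarz:
  assumes "x \<in> V" "y \<in> V"
  shows "(q x y)\<^sup>2 \<le> q x x * q y y"
proof -
  have nn: "0 \<le> q x x + 2 * t * q x y + t\<^sup>2 * q y y" for t
    using q_nonneg[of "x + t *\<^sub>R y"] assms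
    by (simp add: q_add q_add_right q_scale q_scale_right q_commute[of y x] power2_eq_square algebra_simps)
  show ?thesis
  proof (cases "q y y = 0")
    case True
    have "q x y = 0"
    proof (rule ccontr)
      assume *: "q x y \<noteq> 0"
      show False
        using nn[of "- (q x x + 1) / (2 * q x y)"] * True by (simp add: field_simps)
    qed
    then show ?thesis using True by simp
  next
    case False
    then have pos: "q y y > 0" using q_nonneg[of y] assms by simp
    have "0 \<le> q x x - (q x y)\<^sup>2 / q y y"
      using nn[of "- q x y / q y y"] pos by (simp add: field_simps power2_eq_square)
    then show ?thesis using pos by (simp add: field_simps)
  qed
qed

definition symop :: "('v \<Rightarrow> 'v) \<Rightarrow> bool" where
  "symop T \<longleftrightarrow> linear T \<and> (\<forall>x\<in>V. T x \<in> V) \<and> (\<forall>x\<in>V. \<forall>y\<in>V. q (T x) y = q x (T y))"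

text \<open>Effects, in the terminology of quantum mechanics, are the operators with \<open>0 \<le> T \<le> 1\<close>.\<close>

definition effect :: "('v \<Rightarrow> 'v) \<Rightarrow> bool" where
  "effect T \<longleftrightarrow> symop T \<and> (\<forall>x\<in>V. 0 \<le> q x (T x) \<and> q x (T x) \<le> q x x)"

lemma symopD:
  assumes "symop T"
  shows "linear T" "x \<in> V \<Longrightarrow> T x \<in> V" "x \<in> V \<Longrightarrow> y \<in> V \<Longrightarrow> q (T x) y = q x (T y)"
    "T (x + y) = T x + T y" "T (x - y) = T x - T y" "T (c *\<^sub>R x) = c *\<^sub>R T x"
  using assms unfolding symop_def by (auto simp: linear_add linear_diff linear_scale)

lemma effectD:
  assumes "effect T"
  shows "symop T" "x \<in> V \<Longrightarrow> 0 \<le> q x (T x)" "x \<in> V \<Longrightarrow> q x (T x) \<le> q x x"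
  using assms unfolding effect_def by auto

lemma symop_id: "symop (\<lambda>x. x)"
  unfolding symop_def by (simp add: linear_ident[unfolded id_def])

lemma symop_diff:
  assumes "symop S" "symop T"
  shows "symop (\<lambda>x. S x - T x)"
  unfolding symop_def
  using symopD[OF assms(1)] symopD[OF assms(2)]
  by (auto simp: q_diff q_diff_right intro!: linear_compose_sub)

lemma symop_add:
  assumes "symop S" "symop T"
  shows "symop (\<lambda>x. S x + T x)"
  unfolding symop_def
  using symopD[OF assms(1)] symopD[OF assms(2)]
  by (auto simp: q_add q_add_right intro!: linear_compose_add)

lemma symop_scale:
  assumes "symop T"
  shows "symop (\<lambda>x. c *\<^sub>R T x)"
  unfolding symop_def
  using symopD[OF assms]
  by (auto simp: q_scale q_scale_right intro!: linear_compose_scale_right)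

lemma symop_comp:
  assumes "symop S" "symop T" "\<And>x. S (T x) = T (S x)"
  shows "symop (\<lambda>x. S (T x))"
  unfolding symop_def
  using symopD[OF assms(1)] symopD[OF assms(2)] assms(3)
  by (auto simp: linear_compose[unfolded o_def])

lemma effect_id: "effect (\<lambda>x. x)"
  unfolding effect_def by (simp add: symop_id q_nonneg)

lemma effect_complement:
  assumes "effect T"
  shows "effect (\<lambda>x. x - T x)"
  using symop_diff[OF symop_id effectD(1)[OF assms]] effectD[OF assms] symopD[OF effectD(1)[OF assms]]
  unfolding effect_def by (auto simp: q_diff_right)

text \<open>Use \<open>R - R\<^sup>2 = R (1 - R) R + (1 - R) R (1 - R)\<close>.\<close>

lemma effect_minus_square:
  assumes R: "effect R"
  shows "effect (\<lambda>x. R x - R (R x))"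
proof -
  note s = effectD(1)[OF R]
  note d = symopD[OF s]
  have "0 \<le> q x (R x - R (R x))" "q x (R x - R (R x)) \<le> q x x" if x: "x \<in> V" for x
  proof -
    have "0 \<le> q (R x) (R x) - q (R x) (R (R x))"
      using effectD(3)[OF R, of "R x"] d x by simp
    moreover have "0 \<le> q (x - R x) (R (x - R x))"
      using effectD(2)[OF R, of "x - R x"] d x by simp
    moreover have "q (x - R x) (R (x - R x)) =
        q x (R x) - 2 * q (R x) (R x) + q (R x) (R (R x))"
      using x d by (simp add: q_diff q_diff_right)
    moreover have eq: "q x (R x - R (R x)) = q x (R x) - q (R x) (R x)"
      using x d by (simp add: q_diff_right)
    ultimately show "0 \<le> q x (R x - R (R x))" by linarith
    show "q x (R x - R (R x)) \<le> q x x"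
      using eq effectD(3)[OF R x] q_nonneg[of "R x"] d x by simp
  qed
  then show ?thesis
    unfolding effect_def using symop_diff[OF s symop_comp[OF s s]] by simp
qed

text \<open>
  With \<open>R\<^sub>0 = S\<close> and \<open>R\<^sub>n\<^sub>+\<^sub>1 = R\<^sub>n - R\<^sub>n\<^sup>2\<close> one has \<open>S = \<Sum>\<^sub>k R\<^sub>k\<^sup>2\<close> strongly, and every
  \<open>R\<^sub>k\<^sup>2 T = R\<^sub>k T R\<^sub>k\<close> is positive.  This replaces the square root of \<open>S\<close>, which need not exist
  as the space is not assumed to be complete.
\<close>

lemma effect_comp_nonneg:
  assumes S: "effect S" and T: "effect T" and comm: "\<And>x. S (T x) = T (S x)" and x: "x \<in> V"
  shows "0 \<le> q x (S (T x))"
proof -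
  define R where "R n = rec_nat S (\<lambda>_ R x. R x - R (R x)) n" for n
  have R0: "R 0 = S" and RS: "\<And>n. R (Suc n) = (\<lambda>x. R n x - R n (R n x))"
    by (simp_all add: R_def)
  have eff: "effect (R n)" for n
    by (induction n) (simp_all add: R0 RS S effect_minus_square)
  have sym: "symop (R n)" for n using effectD(1)[OF eff] .
  note d = symopD[OF sym]
  note dT = symopD[OF effectD(1)[OF T]]
  have commR: "R n (T y) = T (R n y)" for n y
    by (induction n arbitrary: y) (simp_all add: R0 RS comm dT)
  have sum_eq: "(\<Sum>k<n. q (R k x) (R k x)) = q x (S x) - q x (R n x)" for n
    by (induction n) (use x d in \<open>simp_all add: R0 RS q_diff_right\<close>)
  have "summable (\<lambda>k. q (R k x) (R k x))"
  proof (rule bounded_imp_summable)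
    show "0 \<le> q (R k x) (R k x)" for k using q_nonneg d x by blast
    show "(\<Sum>k\<le>n. q (R k x) (R k x)) \<le> q x (S x)" for n
      using sum_eq[of "Suc n"] effectD(2)[OF eff x, of "Suc n"] unfolding lessThan_Suc_atMost by linarith
  qed
  then have lim: "(\<lambda>k. q (R k x) (R k x)) \<longlonglongrightarrow> 0" by (rule summable_LIMSEQ_zero)
  have dec: "q x (R (Suc n) (T x)) \<le> q x (R n (T x))" for n
  proof -
    have "q x (R n (R n (T x))) = q (R n x) (T (R n x))"
      using x d dT commR by metis
    then have "0 \<le> q x (R n (R n (T x)))" using effectD(2)[OF T, of "R n x"] d x by simp
    then show ?thesis using x d dT by (simp add: RS q_diff_right)
  qed
  have le: "q x (R n (T x)) \<le> q x (S (T x))" for n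
    by (induction n) (use dec in \<open>auto simp: R0 intro: order_trans\<close>)
  have "(\<lambda>n. (q x (R n (T x)))\<^sup>2) \<longlonglongrightarrow> 0"
  proof (rule tendsto_sandwich[OF _ _ tendsto_const])
    show "\<forall>\<^sub>F n in sequentially. (q x (R n (T x)))\<^sup>2 \<le> q (R n x) (R n x) * q (T x) (T x)"
    proof (rule always_eventually, rule allI)
      fix n
      have "q x (R n (T x)) = q (R n x) (T x)" using d dT x by simp
      then show "(q x (R n (T x)))\<^sup>2 \<le> q (R n x) (R n x) * q (T x) (T x)"
        using q_Cauchy_Schwarz[of "R n x" "T x"] d dT x by simp
    qed
    show "(\<lambda>n. q (R n x) (R n x) * q (T x) (T x)) \<longlonglongrightarrow> 0"
      using tendsto_mult[OF lim tendsto_const, of "q (T x) (T x)"] by simp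
  qed simp
  then have "(\<lambda>n. q x (R n (T x))) \<longlonglongrightarrow> 0"
    using tendsto_rabs_zero_cancel tendsto_real_sqrt[of "\<lambda>n. (q x (R n (T x)))\<^sup>2" 0 sequentially] by simp
  then show ?thesis using le by (intro LIMSEQ_le_const2) auto
qed

text \<open>
  The lower bound is the preceding lemma.  The upper bound is its application to \<open>1 - S\<close>, which gives \<open>S T \<le> T \<le> 1\<close>.
\<close>

lemma effect_comp:
  assumes S: "effect S" and T: "effect T" and comm: "\<And>x. S (T x) = T (S x)"
  shows "effect (\<lambda>x. S (T x))"
proof -
  note dT = symopD[OF effectD(1)[OF T]] and dS = symopD[OF effectD(1)[OF S]]
  have "q x (S (T x)) \<le> q x x" if x: "x \<in> V" for x
  proof -
    have "0 \<le> q x (T x - S (T x))"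
      using effect_comp_nonneg[OF effect_complement[OF S] T _ x] comm dT by simp
    then show ?thesis using effectD(3)[OF T x] dT dS x by (simp add: q_diff_right)
  qed
  then show ?thesis
    unfolding effect_def
    using symop_comp[OF effectD(1)[OF S] effectD(1)[OF T] comm] effect_comp_nonneg[OF S T comm] by auto
qed

lemma funpow_commute:
  assumes "\<And>x. S (T x) = T (S x)"
  shows "(S ^^ m) ((T ^^ n) x) = (T ^^ n) ((S ^^ m) x)"
proof -
  have 1: "S ((T ^^ n) x) = (T ^^ n) (S x)" for x
    by (induction n) (simp_all add: assms)
  show ?thesis by (induction m) (simp_all add: 1)
qed

lemma effect_funpow:
  assumes T: "effect T"
  shows "effect (T ^^ n)"
proof (induction n)
  case 0
  then show ?case using effect_id by (simp add: id_def)
next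
  case (Suc n)
  have "effect (\<lambda>x. T ((T ^^ n) x))"
    by (rule effect_comp[OF T Suc]) (simp add: funpow_swap1)
  then show ?case by (simp add: o_def)
qed

end

section \<open>A continuous curve through the unit square\<close>

text \<open>
  Helly's selection theorem is a statement about measures on the line, whereas the measures wanted here live on a
  square.  They are therefore pulled back along a continuous curve whose values on \<open>[0,1]\<close> are dense in the unit square.
  The curve is Schoenberg's form of the Peano curve: if \<open>t\<close> has the base 3 digits \<open>2 a\<^sub>1, 2 b\<^sub>1, 2 a\<^sub>2, 2 b\<^sub>2, \<dots>\<close>
  then its coordinates have the binary digits \<open>a\<^sub>1 a\<^sub>2 \<dots>\<close> and \<open>b\<^sub>1 b\<^sub>2 \<dots>\<close>.

  The even function \<open>peano_step\<close> of period 2 equals 0 on \<open>[0,1/3]\<close> and 1 on \<open>[2/3,1]\<close>, so it reads off the leading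
  digit; multiplication by 9 moves on by one pair of digits, and multiplication by 3 from the digits of the first
  coordinate to those of the second.
\<close>

definition peano_step :: "real \<Rightarrow> real" where
  "peano_step t = max 0 (min 1 (1/2 - cos (pi * t)))"

definition peano_x :: "real \<Rightarrow> real" where
  "peano_x t = (\<Sum>k. peano_step (9 ^ k * t) / 2 ^ Suc k)"

definition peano_y :: "real \<Rightarrow> real" where
  "peano_y t = peano_x (3 * t)"

lemma peano_step_bounds: "0 \<le> peano_step t" "peano_step t \<le> 1"
  by (simp_all add: peano_step_def)

lemma peano_step_periodic: "peano_step (t + 2 * real m) = peano_step t"
proof -
  have "cos (pi * (t + 2 * real m)) = cos (pi * t + real m * (2 * pi))"
    by (simp add: algebra_simps)
  also have "\<dots> = cos (pi * t)"
    using cos.plus_of_nat[of "pi * t" m] by simp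
  finally show ?thesis by (simp add: peano_step_def)
qed

lemma peano_step_eq_0: "0 \<le> t \<Longrightarrow> t \<le> 1/3 \<Longrightarrow> peano_step t = 0"
  using cos_monotone_0_pi_le[of "pi * t" "pi / 3"] pi_gt_zero
  by (simp add: peano_step_def cos_60)

lemma peano_step_eq_1: "2/3 \<le> t \<Longrightarrow> t \<le> 1 \<Longrightarrow> peano_step t = 1"
proof -
  assume t: "2/3 \<le> t" "t \<le> 1"
  have "cos (pi * t) \<le> cos (2 * pi / 3)"
    using t pi_gt_zero mult_left_mono[OF t(1), of pi] by (intro cos_monotone_0_pi_le) auto
  then show ?thesis by (simp add: peano_step_def cos_120)
qed

lemma peano_step_digit:
  assumes "0 \<le> r" "r \<le> 1/3"
  shows "peano_step (2 * (if a then 1 else 0) / 3 + r) = (if a then 1 else 0)"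
  using assms peano_step_eq_0[of r] peano_step_eq_1[of "2/3 + r"] by auto

lemma summable_half_power: "summable (\<lambda>k. 1 / 2 ^ Suc k :: real)"
  using power_half_series sums_summable by (auto simp: power_divide)

lemma peano_summable: "summable (\<lambda>k. peano_step (9 ^ k * t) / 2 ^ Suc k)"
  by (rule summable_comparison_test[OF _ summable_half_power])
     (auto intro!: exI[of _ 0] divide_right_mono simp: peano_step_bounds)

lemma peano_x_bounds: "0 \<le> peano_x t" "peano_x t \<le> 1"
proof -
  show "0 \<le> peano_x t"
    unfolding peano_x_def by (intro suminf_nonneg peano_summable) (simp add: peano_step_bounds)
  have "peano_x t \<le> (\<Sum>k. 1 / 2 ^ Suc k)"
    unfolding peano_x_def
    by (intro suminf_le peano_summable summable_half_power) (simp add: peano_step_bounds divide_right_mono)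
  also have "\<dots> = 1"
    using sums_unique[OF power_half_series] by (simp add: power_divide)
  finally show "peano_x t \<le> 1" .
qed

lemma peano_x_step: "peano_x t = peano_step t / 2 + peano_x (9 * t) / 2"
proof -
  have "peano_x t = peano_step t / 2 + (\<Sum>k. peano_step (9 ^ Suc k * t) / 2 ^ Suc (Suc k))"
    using suminf_split_head[OF peano_summable[of t]] by (simp add: peano_x_def)
  also have "(\<lambda>k. peano_step (9 ^ Suc k * t) / 2 ^ Suc (Suc k))
      = (\<lambda>k. (peano_step (9 ^ k * (9 * t)) / 2 ^ Suc k) / 2)"
    by (simp add: ac_simps)
  also have "(\<Sum>k. (peano_step (9 ^ k * (9 * t)) / 2 ^ Suc k) / 2) = peano_x (9 * t) / 2"
    unfolding peano_x_def by (intro suminf_divide peano_summable)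
  finally show ?thesis .
qed

lemma peano_x_periodic: "peano_x (t + 2 * real m) = peano_x t"
proof -
  have "peano_step (9 ^ k * (t + 2 * real m)) = peano_step (9 ^ k * t)" for k
    using peano_step_periodic[of "9 ^ k * t" "9 ^ k * m"] by (simp add: algebra_simps)
  then show ?thesis by (simp add: peano_x_def)
qed

lemma continuous_peano_step: "continuous_on A peano_step"
  unfolding peano_step_def by (intro continuous_intros)

lemma continuous_peano_x: "continuous_on UNIV peano_x"
proof (rule uniform_limit_theorem)
  show "uniform_limit UNIV (\<lambda>n t. \<Sum>k<n. peano_step (9 ^ k * t) / 2 ^ Suc k) peano_x sequentially"
    unfolding peano_x_def
    by (rule Weierstrass_m_test[OF _ summable_half_power])
       (simp add: peano_step_bounds divide_right_mono)
  show "\<forall>\<^sub>F n in sequentially. continuous_on UNIV (\<lambda>t. \<Sum>k<n. peano_step (9 ^ k * t) / 2 ^ Suc k)"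
    by (intro always_eventually allI continuous_intros continuous_on_compose2[OF continuous_peano_step]) auto
qed simp

lemma continuous_peano_y: "continuous_on UNIV peano_y"
  unfolding peano_y_def[abs_def]
  by (intro continuous_on_compose2[OF continuous_peano_x] continuous_intros) auto

text \<open>
  One binary digit of both coordinates is prescribed at a time: doubling \<open>(x, y)\<close> and removing the leading digits leads
  to the point treated by the induction hypothesis, and prefixing \<open>2 a, 2 b\<close> to the base 3 digits of its parameter \<open>t\<close>
  undoes this.
\<close>

lemma peano_dense:
  assumes "x \<in> {0..1}" "y \<in> {0..1}"
  shows "\<exists>t\<in>{0..1}. \<bar>peano_x t - x\<bar> \<le> 1 / 2 ^ n \<and> \<bar>peano_y t - y\<bar> \<le> 1 / 2 ^ n"
  using assms
proof (induction n arbitrary: x y)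
  case 0
  then show ?case
    using peano_x_bounds[of 0] by (intro bexI[of _ 0]) (auto simp: peano_y_def abs_le_iff)
next
  case (Suc n)
  define digit where "digit c = (if c then 1 else 0 :: real)" for c
  define tail where "tail z = 2 * z - digit (z \<ge> 1/2)" for z :: real
  have tail: "tail z \<in> {0..1}" if "z \<in> {0..1}" for z
    using that by (auto simp: tail_def digit_def)
  obtain t where t: "t \<in> {0..1}" "\<bar>peano_x t - tail x\<bar> \<le> 1 / 2 ^ n" "\<bar>peano_y t - tail y\<bar> \<le> 1 / 2 ^ n"
    using Suc.IH[OF tail[OF Suc.prems(1)] tail[OF Suc.prems(2)]] by auto
  define a b where "a = digit (x \<ge> 1/2)" and "b = digit (y \<ge> 1/2)"
  define s where "s = 2 * a / 3 + 2 * b / 9 + t / 9"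
  have ab: "0 \<le> a" "a \<le> 1" "0 \<le> b" "b \<le> 1" by (auto simp: a_def b_def digit_def)
  obtain A B where AB: "a = real A" "b = real B"
    by (metis a_def b_def digit_def of_nat_0 of_nat_1)
  \<comment> \<open>The multiples of 2 that remain after multiplication by 3 or 9 disappear by periodicity.\<close>
  have "peano_step s = a"
    using peano_step_digit[of "2 * b / 9 + t / 9" "x \<ge> 1/2"] t(1) ab
    by (simp add: s_def a_def digit_def add.assoc)
  moreover have "peano_x (9 * s) = peano_x t"
    using peano_x_periodic[of t "3 * A + B"] AB by (simp add: s_def algebra_simps)
  ultimately have X: "peano_x s = a / 2 + peano_x t / 2"
    using peano_x_step[of s] by simp
  have "peano_step (3 * s) = b"
    using peano_step_digit[of "t / 3" "y \<ge> 1/2"] peano_step_periodic[of "2 * b / 3 + t / 3" A] t(1) AB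
    by (simp add: s_def b_def digit_def algebra_simps)
  moreover have "peano_x (9 * (3 * s)) = peano_y t"
    using peano_x_periodic[of "3 * t" "9 * A + 3 * B"] AB by (simp add: s_def peano_y_def algebra_simps)
  ultimately have Y: "peano_y s = b / 2 + peano_y t / 2"
    using peano_x_step[of "3 * s"] by (simp add: peano_y_def)
  have "\<bar>peano_x s - x\<bar> = \<bar>peano_x t - tail x\<bar> / 2" "\<bar>peano_y s - y\<bar> = \<bar>peano_y t - tail y\<bar> / 2"
    by (simp_all add: X Y tail_def a_def b_def abs_if field_simps)
  then have "\<bar>peano_x s - x\<bar> \<le> 1 / 2 ^ Suc n" "\<bar>peano_y s - y\<bar> \<le> 1 / 2 ^ Suc n"
    using divide_right_mono[OF t(2), of 2] divide_right_mono[OF t(3), of 2] by (simp_all add: mult.commute)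
  moreover have "s \<in> {0..1}" using t(1) ab by (auto simp: s_def)
  ultimately show ?case by blast
qed

section \<open>The moment problem on the unit square\<close>

text \<open>Pascal's rule in summed form.\<close>

lemma sum_binomial_Suc:
  fixes h :: "nat \<Rightarrow> real"
  shows "(\<Sum>k\<le>Suc n. real (Suc n choose k) * h k) = (\<Sum>k\<le>n. real (n choose k) * (h k + h (Suc k)))"
proof -
  have "(\<Sum>k\<le>Suc n. real (Suc n choose k) * h k)
      = h 0 + (\<Sum>k\<le>n. real (n choose k) * h (Suc k)) + (\<Sum>k\<le>n. real (n choose Suc k) * h (Suc k))"
    by (simp only: sum.atMost_Suc_shift binomial_Suc_Suc of_nat_add distrib_right sum.distrib)
       simp
  also have "h 0 + (\<Sum>k\<le>n. real (n choose Suc k) * h (Suc k)) = (\<Sum>k\<le>Suc n. real (n choose k) * h k)"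
    by (simp only: sum.atMost_Suc_shift) simp
  then have "h 0 + (\<Sum>k\<le>n. real (n choose k) * h (Suc k)) + (\<Sum>k\<le>n. real (n choose Suc k) * h (Suc k))
     = (\<Sum>k\<le>n. real (n choose k) * h k) + (\<Sum>k\<le>n. real (n choose k) * h (Suc k))"
    by (simp add: algebra_simps)
  finally show ?thesis by (simp add: sum.distrib distrib_left)
qed

text \<open>
  Splitting arrays are those which behave like \<open>f k k' = \<integral> x\<^sup>k (1 - x)\<^sup>k\<^sup>' dm\<close>, as \<open>1 = x + (1 - x)\<close>.
\<close>

definition splitting :: "(nat \<Rightarrow> nat \<Rightarrow> real) \<Rightarrow> bool" where
  "splitting f \<longleftrightarrow> (\<forall>k k'. f k k' = f (Suc k) k' + f k (Suc k'))"

lemma splittingD: "splitting f \<Longrightarrow> f k k' = f (Suc k) k' + f k (Suc k')"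
  unfolding splitting_def by blast

lemma splitting_sum:
  assumes "splitting f"
  shows "(\<Sum>k\<le>n. real (n choose k) * f k (n - k)) = f 0 0"
proof (induction n)
  case (Suc n)
  have "(\<Sum>k\<le>Suc n. real (Suc n choose k) * f k (Suc n - k))
     = (\<Sum>k\<le>n. real (n choose k) * (f k (Suc n - k) + f (Suc k) (Suc n - Suc k)))"
    by (rule sum_binomial_Suc)
  also have "\<dots> = (\<Sum>k\<le>n. real (n choose k) * f k (n - k))"
    using splittingD[OF assms, symmetric] by (intro sum.cong) (simp_all add: Suc_diff_le add.commute)
  finally show ?case using Suc by simp
qed simp

text \<open>
  This is \<open>k (k - 1) \<cdots> (k - i + 1) / (n (n - 1) \<cdots> (n - i + 1))\<close>.  A discrete measure with Bernstein weights
  \<open>(n choose k) f k (n - k)\<close> has exactly the prescribed \<open>i\<close>-th moment if \<open>(k/n)\<^sup>i\<close> is replaced by this ratio, and the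
  two differ by at most a constant times \<open>1/n\<close>.
\<close>

definition falling_ratio :: "nat \<Rightarrow> nat \<Rightarrow> nat \<Rightarrow> real" where
  "falling_ratio n i k = (\<Prod>u<i. (real k - real u) / (real n - real u))"

text \<open>
  As \<open>(n choose k) k / n = (n - 1 choose k - 1)\<close>, one factor of the ratio lowers \<open>n\<close> and \<open>k\<close> by one and shifts the array
  in its first index.
\<close>

lemma splitting_falling_moment:
  assumes "splitting f" "i \<le> n"
  shows "(\<Sum>k\<le>n. real (n choose k) * falling_ratio n i k * f k (n - k)) = f i 0"
  using assms
proof (induction i arbitrary: n f)
  case 0
  then show ?case using splitting_sum by (simp add: falling_ratio_def)
next
  case (Suc i)
  obtain n' where n: "n = Suc n'" using Suc.prems by (cases n) auto
  have fr: "real (n choose Suc k) * falling_ratio n (Suc i) (Suc k) = real (n' choose k) * falling_ratio n' i k" for k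
  proof -
    have "falling_ratio n (Suc i) (Suc k) = (real (Suc k) / real n) * falling_ratio n' i k"
      unfolding falling_ratio_def n by (simp add: prod.lessThan_Suc_shift del: prod.lessThan_Suc)
    moreover have "real (n choose Suc k) * real (Suc k) = real n * real (n' choose k)"
      using Suc_times_binomial[of k n'] unfolding n by (metis mult.commute of_nat_mult)
    moreover have "real (n choose Suc k) * (real (Suc k) / real n * falling_ratio n' i k)
        = (real (n choose Suc k) * real (Suc k)) / real n * falling_ratio n' i k" by simp
    ultimately show ?thesis using n by simp
  qed
  have z: "falling_ratio n (Suc i) 0 = 0"
    unfolding falling_ratio_def by (simp add: prod.lessThan_Suc_shift del: prod.lessThan_Suc)
  have "(\<Sum>k\<le>n. real (n choose k) * falling_ratio n (Suc i) k * f k (n - k))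
     = (\<Sum>k\<le>n'. real (n' choose k) * falling_ratio n' i k * f (Suc k) (n' - k))"
    by (subst n, subst sum.atMost_Suc_shift) (simp add: n[symmetric] z fr, simp add: n)
  also have "\<dots> = f (Suc i) 0"
  proof (rule Suc.IH)
    show "splitting (\<lambda>k. f (Suc k))"
      unfolding splitting_def by (intro allI splittingD[OF Suc.prems(1)])
  qed (use Suc.prems(2) n in simp)
  finally show ?case .
qed

lemma falling_ratio_bounds:
  assumes "k \<le> n" "2 * i \<le> n" "0 < n"
  shows "\<bar>falling_ratio n i k\<bar> \<le> 1"
    and "\<bar>falling_ratio n i k - (real k / real n) ^ i\<bar> \<le> real i * (2 * real i / real n)"
proof -
  have z: "\<bar>(real k - real u) / (real n - real u)\<bar> \<le> 1" if "u < i" for u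
  proof -
    have "0 < real n - real u" "\<bar>real k - real u\<bar> \<le> real n - real u"
      using that assms(1,3) of_nat_mono[OF assms(2), where 'a = real] by auto
    then show ?thesis by (simp add: abs_divide)
  qed
  show "\<bar>falling_ratio n i k\<bar> \<le> 1"
    unfolding falling_ratio_def abs_prod by (rule prod_le_1) (use z in auto)
  have d: "\<bar>(real k - real u) / (real n - real u) - real k / real n\<bar> \<le> 2 * real i / real n" if u: "u < i" for u
  proof -
    have nu: "real n - real u > 0" "2 * (real n - real u) \<ge> real n"
      using u assms(3) of_nat_mono[OF assms(2), where 'a = real] by auto
    have "(real k - real u) / (real n - real u) - real k / real n
        = - (real u * (real n - real k)) / (real n * (real n - real u))"
      using nu assms(3) by (simp add: field_simps)
    then have "\<bar>(real k - real u) / (real n - real u) - real k / real n\<bar>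
        = (real u * (real n - real k)) / (real n * (real n - real u))"
      using nu assms by (simp add: abs_mult)
    also have "\<dots> \<le> (real i * real n) / (real n * (real n / 2))"
      using nu assms u by (intro frac_le mult_mono) auto
    also have "\<dots> = 2 * real i / real n" using assms by (simp add: field_simps)
    finally show ?thesis .
  qed
  have "norm ((\<Prod>u<i. (real k - real u) / (real n - real u)) - (\<Prod>u<i. real k / real n))
    \<le> (\<Sum>u<i. norm ((real k - real u) / (real n - real u) - real k / real n))"
    using z assms by (intro norm_prod_diff) auto
  also have "\<dots> \<le> (\<Sum>u<i. 2 * real i / real n)"
    by (intro sum_mono) (use d in auto)
  finally show "\<bar>falling_ratio n i k - (real k / real n) ^ i\<bar> \<le> real i * (2 * real i / real n)"
    by (simp add: falling_ratio_def)
qed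

lemma abs_mult_diff_le:
  fixes a b c d :: real
  assumes "\<bar>b\<bar> \<le> 1" "\<bar>c\<bar> \<le> 1"
  shows "\<bar>a * b - c * d\<bar> \<le> \<bar>a - c\<bar> + \<bar>b - d\<bar>"
proof -
  have "a * b - c * d = (a - c) * b + c * (b - d)" by (simp add: algebra_simps)
  then have "\<bar>a * b - c * d\<bar> \<le> \<bar>a - c\<bar> * \<bar>b\<bar> + \<bar>c\<bar> * \<bar>b - d\<bar>"
    by (metis abs_mult abs_triangle_ineq)
  also have "\<dots> \<le> \<bar>a - c\<bar> * 1 + 1 * \<bar>b - d\<bar>"
    using assms by (intro add_mono mult_mono) auto
  finally show ?thesis by simp
qed

text \<open>
  The array stands for \<open>\<integral> x\<^sup>k (1 - x)\<^sup>k\<^sup>' y\<^sup>l (1 - y)\<^sup>l\<^sup>' dm\<close>.  The three assumptions are the obvious necessary conditions;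
  Hausdorff's theorem says that they suffice for the existence of \<open>m\<close>.
\<close>

locale moment_array =
  fixes m :: "nat \<Rightarrow> nat \<Rightarrow> nat \<Rightarrow> nat \<Rightarrow> real"
  assumes m_nonneg: "0 \<le> m k k' l l'"
    and m_x: "m k k' l l' = m (Suc k) k' l l' + m k (Suc k') l l'"
    and m_y: "m k k' l l' = m k k' (Suc l) l' + m k k' l (Suc l')"
begin

lemma splitting_x: "splitting (\<lambda>k k'. m k k' l l')"
  unfolding splitting_def using m_x by blast

lemma splitting_y: "splitting (m k k')"
  unfolding splitting_def using m_y by blast

definition weight :: "nat \<Rightarrow> nat \<Rightarrow> nat \<Rightarrow> real" where
  "weight n k l = real (n choose k) * real (n choose l) * m k (n - k) l (n - l)"

lemma weight_nonneg: "0 \<le> weight n k l"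
  by (simp add: weight_def m_nonneg)

lemma weight_falling_moment:
  assumes "i \<le> n" "j \<le> n"
  shows "(\<Sum>(k, l)\<in>{..n} \<times> {..n}. weight n k l * (falling_ratio n i k * falling_ratio n j l)) = m i 0 j 0"
proof -
  have "(\<Sum>(k, l)\<in>{..n} \<times> {..n}. weight n k l * (falling_ratio n i k * falling_ratio n j l))
    = (\<Sum>k\<le>n. real (n choose k) * falling_ratio n i k *
        (\<Sum>l\<le>n. real (n choose l) * falling_ratio n j l * m k (n - k) l (n - l)))"
    by (simp add: sum.cartesian_product[symmetric] weight_def sum_distrib_left algebra_simps)
  also have "\<dots> = (\<Sum>k\<le>n. real (n choose k) * falling_ratio n i k * m k (n - k) j 0)"
    using splitting_falling_moment[OF splitting_y assms(2)] by simp
  also have "\<dots> = m i 0 j 0"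
    using splitting_falling_moment[OF splitting_x assms(1)] by simp
  finally show ?thesis .
qed

lemma weight_sum: "(\<Sum>(k, l)\<in>{..n} \<times> {..n}. weight n k l) = m 0 0 0 0"
  using weight_falling_moment[of 0 n 0] by (simp add: falling_ratio_def)

text \<open>
  A parameter at which the curve almost passes through the grid point \<open>(k/n, l/n)\<close>.
\<close>

definition node :: "nat \<Rightarrow> nat \<Rightarrow> nat \<Rightarrow> real" where
  "node n k l = (SOME t. t \<in> {0..1} \<and> \<bar>peano_x t - real k / real n\<bar> \<le> 1 / 2 ^ n
     \<and> \<bar>peano_y t - real l / real n\<bar> \<le> 1 / 2 ^ n)"

lemma node:
  assumes "k \<le> n" "l \<le> n" "0 < n"
  shows "node n k l \<in> {0..1}" "\<bar>peano_x (node n k l) - real k / real n\<bar> \<le> 1 / 2 ^ n"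
    "\<bar>peano_y (node n k l) - real l / real n\<bar> \<le> 1 / 2 ^ n"
proof -
  have "\<exists>t. t \<in> {0..1} \<and> \<bar>peano_x t - real k / real n\<bar> \<le> 1 / 2 ^ n
     \<and> \<bar>peano_y t - real l / real n\<bar> \<le> 1 / 2 ^ n"
    using peano_dense[of "real k / real n" "real l / real n" n] assms by auto
  from someI_ex[OF this]
  show "node n k l \<in> {0..1}" "\<bar>peano_x (node n k l) - real k / real n\<bar> \<le> 1 / 2 ^ n"
    "\<bar>peano_y (node n k l) - real l / real n\<bar> \<le> 1 / 2 ^ n"
    by (simp_all add: node_def)
qed

lemma node_power_diff:
  assumes "k \<le> n" "l \<le> n" "2 * i \<le> n" "2 * j \<le> n" "0 < n"
  shows "\<bar>peano_x (node n k l) ^ i * peano_y (node n k l) ^ j - falling_ratio n i k * falling_ratio n j l\<bar>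
    \<le> (real i + real j) * (1 / 2 ^ n) + 2 * ((real i)\<^sup>2 + (real j)\<^sup>2) / real n"
proof -
  let ?t = "node n k l"
  have *: "\<bar>z ^ e - falling_ratio n e h\<bar> \<le> real e * (1 / 2 ^ n) + 2 * (real e)\<^sup>2 / real n"
    if "\<bar>z - real h / real n\<bar> \<le> 1 / 2 ^ n" "\<bar>z\<bar> \<le> 1" "h \<le> n" "2 * e \<le> n" for z e h
  proof -
    have "\<bar>z ^ e - (real h / real n) ^ e\<bar> \<le> real e * \<bar>z - real h / real n\<bar>"
      using norm_power_diff[of z "real h / real n" e] that assms(5) by simp
    also have "\<dots> \<le> real e * (1 / 2 ^ n)" using that by (intro mult_left_mono) auto
    finally have "\<bar>z ^ e - (real h / real n) ^ e\<bar> \<le> real e * (1 / 2 ^ n)" .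
    moreover have "\<bar>falling_ratio n e h - (real h / real n) ^ e\<bar> \<le> 2 * (real e)\<^sup>2 / real n"
      using falling_ratio_bounds(2)[of h n e] that assms(5) by (simp add: power2_eq_square ac_simps)
    ultimately show ?thesis by linarith
  qed
  have b: "\<bar>peano_x ?t\<bar> \<le> 1" "\<bar>peano_y ?t\<bar> \<le> 1"
    using peano_x_bounds by (auto simp: peano_y_def abs_le_iff intro: order_trans[of _ 0])
  have "\<bar>peano_x ?t ^ i * peano_y ?t ^ j - falling_ratio n i k * falling_ratio n j l\<bar>
    \<le> \<bar>peano_x ?t ^ i - falling_ratio n i k\<bar> + \<bar>peano_y ?t ^ j - falling_ratio n j l\<bar>"
    using b falling_ratio_bounds(1)[of k n i] assms
    by (intro abs_mult_diff_le) (simp_all add: power_abs power_le_one)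
  also have "\<dots> \<le> (real i * (1 / 2 ^ n) + 2 * (real i)\<^sup>2 / real n) + (real j * (1 / 2 ^ n) + 2 * (real j)\<^sup>2 / real n)"
    using node[OF assms(1,2,5)] b assms by (intro add_mono *) auto
  finally show ?thesis by (simp add: algebra_simps add_divide_distrib)
qed

text \<open>
  Mass \<open>weight n k l\<close>, normalized to a probability measure, sits at the parameter of the grid point \<open>(k/n, l/n)\<close>; the image
  under the curve approximates the wanted measure.
\<close>

definition approx :: "nat \<Rightarrow> real measure" where
  "approx n = distr (point_measure ({..n} \<times> {..n}) (\<lambda>(k, l). ennreal (weight n k l / m 0 0 0 0))) borel
     (\<lambda>(k, l). node n k l)"

lemma integral_approx:
  assumes "g \<in> borel_measurable borel"
  shows "integral\<^sup>L (approx n) g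
     = (\<Sum>(k, l)\<in>{..n} \<times> {..n}. weight n k l / m 0 0 0 0 * (g (node n k l) :: real))"
proof -
  have "point_measure ({..n} \<times> {..n}) (\<lambda>(k, l). ennreal (weight n k l / m 0 0 0 0))
     = point_measure ({..n} \<times> {..n}) (\<lambda>p. ennreal ((\<lambda>(k, l). weight n k l / m 0 0 0 0) p))"
    by (simp add: case_prod_unfold)
  then show ?thesis
    unfolding approx_def
    by (subst integral_distr)
       (use assms in \<open>auto simp: lebesgue_integral_point_measure_finite weight_nonneg m_nonneg case_prod_unfold\<close>)
qed

lemma approx_distribution:
  assumes "m 0 0 0 0 > 0"
  shows "real_distribution (approx n)"
proof -
  have "emeasure (point_measure ({..n} \<times> {..n}) (\<lambda>(k, l). ennreal (weight n k l / m 0 0 0 0))) ({..n} \<times> {..n})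
     = (\<Sum>p\<in>{..n} \<times> {..n}. ennreal ((\<lambda>(k, l). weight n k l / m 0 0 0 0) p))"
    by (simp add: emeasure_point_measure_finite case_prod_unfold)
  also have "\<dots> = ennreal (\<Sum>p\<in>{..n} \<times> {..n}. (\<lambda>(k, l). weight n k l / m 0 0 0 0) p)"
    by (intro sum_ennreal) (auto simp: weight_nonneg m_nonneg)
  also have "(\<Sum>p\<in>{..n} \<times> {..n}. (\<lambda>(k, l). weight n k l / m 0 0 0 0) p) = 1"
    using assms weight_sum[of n] by (simp add: case_prod_unfold sum_divide_distrib[symmetric])
  finally have "prob_space (point_measure ({..n} \<times> {..n}) (\<lambda>(k, l). ennreal (weight n k l / m 0 0 0 0)))"
    by (intro prob_spaceI) (simp add: space_point_measure)
  then show ?thesis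
    unfolding approx_def by (rule prob_space.real_distribution_distr) simp
qed

text \<open>
  All nodes lie in \<open>[0,1]\<close>.  The index starts at 1 since for \<open>n = 0\<close> there is no grid.
\<close>

lemma approx_tight:
  assumes "m 0 0 0 0 > 0"
  shows "tight (\<lambda>n. approx (Suc n))"
  unfolding tight_def
proof (intro conjI allI impI)
  fix e :: real assume "e > 0"
  have "measure (approx (Suc n)) {-1<..1} = 1" for n
  proof -
    interpret real_distribution "approx (Suc n)" by (rule approx_distribution[OF assms])
    have "measure (approx (Suc n)) {-1<..1} = integral\<^sup>L (approx (Suc n)) (indicator {-1<..1})"
      by simp
    also have "\<dots> = (\<Sum>(k, l)\<in>{..Suc n} \<times> {..Suc n}. weight (Suc n) k l / m 0 0 0 0)"
      by (subst integral_approx, simp, intro sum.cong)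
         (use node[of _ "Suc n"] in \<open>force simp: indicator_def\<close>)+
    also have "\<dots> = 1"
      using assms weight_sum[of "Suc n"] by (simp add: case_prod_unfold sum_divide_distrib[symmetric])
    finally show ?thesis .
  qed
  then show "\<exists>a b. a < b \<and> (\<forall>n. 1 - e < measure (approx (Suc n)) {a<..b})"
    using \<open>e > 0\<close> by (intro exI[of _ "-1"] exI[of _ 1]) simp
qed (rule approx_distribution[OF assms])

lemma integral_approx_tendsto:
  assumes pos: "m 0 0 0 0 > 0"
  shows "(\<lambda>n. integral\<^sup>L (approx n) (\<lambda>t. peano_x t ^ i * peano_y t ^ j)) \<longlonglongrightarrow> m i 0 j 0 / m 0 0 0 0"
proof -
  have meas: "(\<lambda>t. peano_x t ^ i * peano_y t ^ j) \<in> borel_measurable borel"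
    by (intro borel_measurable_continuous_onI continuous_intros continuous_peano_x continuous_peano_y)
  define err where "err n = (real i + real j) * (1 / 2 ^ n) + 2 * ((real i)\<^sup>2 + (real j)\<^sup>2) / real n" for n
  have "(\<lambda>n. (1/2) ^ n :: real) \<longlonglongrightarrow> 0" by (rule LIMSEQ_realpow_zero) auto
  then have "err \<longlonglongrightarrow> (real i + real j) * 0 + 0"
    unfolding err_def
    by (intro tendsto_add tendsto_mult tendsto_const lim_const_over_n) (simp add: power_divide)
  then have err: "err \<longlonglongrightarrow> 0" by simp
  have "\<bar>integral\<^sup>L (approx n) (\<lambda>t. peano_x t ^ i * peano_y t ^ j) - m i 0 j 0 / m 0 0 0 0\<bar> \<le> err n"
    if n: "n \<ge> Suc (2 * i + 2 * j)" for n
  proof -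
    let ?G = "{..n} \<times> {..n}"
    let ?w = "\<lambda>p. weight n (fst p) (snd p) / m 0 0 0 0"
    let ?d = "\<lambda>p. peano_x (node n (fst p) (snd p)) ^ i * peano_y (node n (fst p) (snd p)) ^ j
       - falling_ratio n i (fst p) * falling_ratio n j (snd p)"
    have "m i 0 j 0 / m 0 0 0 0 = (\<Sum>p\<in>?G. ?w p * (falling_ratio n i (fst p) * falling_ratio n j (snd p)))"
      using weight_falling_moment[of i n j] n
      by (simp add: case_prod_unfold sum_divide_distrib[symmetric])
    then have "\<bar>integral\<^sup>L (approx n) (\<lambda>t. peano_x t ^ i * peano_y t ^ j) - m i 0 j 0 / m 0 0 0 0\<bar>
       = \<bar>\<Sum>p\<in>?G. ?w p * ?d p\<bar>"
      by (simp add: integral_approx[OF meas] case_prod_unfold sum_subtractf[symmetric] right_diff_distrib)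
    also have "\<dots> \<le> (\<Sum>p\<in>?G. ?w p * err n)"
      using node_power_diff[of _ n _ i j] n pos
      by (intro order_trans[OF sum_abs] sum_mono)
         (auto simp: abs_mult weight_nonneg err_def intro!: divide_right_mono mult_left_mono)
    also have "\<dots> = err n"
      using weight_sum[of n] pos
      by (simp add: sum_distrib_right[symmetric] sum_divide_distrib[symmetric] case_prod_unfold)
    finally show ?thesis .
  qed
  then have "\<forall>\<^sub>F n in sequentially. norm (integral\<^sup>L (approx n) (\<lambda>t. peano_x t ^ i * peano_y t ^ j)
      - m i 0 j 0 / m 0 0 0 0) \<le> err n"
    by (auto intro: eventually_sequentiallyI[of "Suc (2 * i + 2 * j)"])
  from Lim_null_comparison[OF this err] show ?thesis by (simp add: LIM_zero_iff)
qed

text \<open>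
  By Helly's theorem a subsequence of the approximations converges weakly to a law \<open>M\<close> on the line.  The integrands
  \<open>peano_x\<^sup>i peano_y\<^sup>j\<close> are bounded and continuous, so the image of \<open>M\<close> under the curve, rescaled by the total mass, has the
  right moments.  If the total mass is zero then so are all moments, for they decrease in \<open>i\<close> and \<open>j\<close>.
\<close>

theorem moment_measure:
  "\<exists>\<nu>. finite_measure \<nu> \<and> sets \<nu> = sets (borel_square 0 1) \<and>
     (\<forall>i j. (\<integral>p. fst p ^ i * snd p ^ j \<partial>\<nu>) = m i 0 j 0)"
proof (cases "m 0 0 0 0 = 0")
  case True
  have "m (Suc i) 0 j 0 \<le> m i 0 j 0" "m i 0 (Suc j) 0 \<le> m i 0 j 0" for i j
    using m_x[of i 0 j 0] m_y[of i 0 j 0] m_nonneg[of i "Suc 0" j 0] m_nonneg[of i 0 j "Suc 0"]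
    by linarith+
  then have le: "m i 0 j 0 \<le> m i 0 0 0" "m i 0 0 0 \<le> m 0 0 0 0" for i j
    using lift_Suc_antimono_le[where f = "\<lambda>j. m i 0 j 0" and n = 0 and n' = j]
      lift_Suc_antimono_le[where f = "\<lambda>i. m i 0 0 0" and n = 0 and n' = i]
    by auto
  have "m i 0 j 0 = 0" for i j
    using le(1)[of i j] le(2)[of i] m_nonneg[of i 0 j 0] True by linarith
  then show ?thesis
    by (intro exI[of _ "null_measure (borel_square 0 1)"]) (auto intro!: finite_measureI)
next
  case False
  then have pos: "m 0 0 0 0 > 0" using m_nonneg[of 0 0 0 0] by simp
  obtain r M where r: "strict_mono r" and M: "real_distribution M"
    and conv: "weak_conv_m ((\<lambda>n. approx (Suc n)) \<circ> id \<circ> r) M"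
    using tight_imp_convergent_subsubsequence[OF approx_tight[OF pos], of id] strict_mono_id by blast
  interpret M: real_distribution M by fact
  define h where "h t = (peano_x t, peano_y t)" for t
  have meas1: "h \<in> borel_measurable borel"
    unfolding h_def
    by (intro borel_measurable_continuous_onI continuous_on_Pair continuous_peano_x continuous_peano_y)
  have h_in: "h t \<in> {0..1} \<times> {0..1}" for t
    using peano_x_bounds by (auto simp: h_def peano_y_def)
  have meas: "h \<in> measurable M (borel_square 0 1)"
    unfolding borel_square_def using meas1 h_in by (intro measurable_restrict_space2) auto
  define \<nu> where "\<nu> = density (distr M (borel_square 0 1) h) (\<lambda>_. ennreal (m 0 0 0 0))"
  have "finite_measure (distr M (borel_square 0 1) h)"
    by (rule M.finite_measure_distr[OF meas])
  then have fin: "finite_measure \<nu>"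
    unfolding \<nu>_def by (intro finite_measureI)
      (simp add: emeasure_density_const finite_measure.emeasure_finite ennreal_mult_eq_top_iff)
  have mom: "(\<integral>p. fst p ^ i * snd p ^ j \<partial>\<nu>) = m i 0 j 0" for i j
  proof -
    have pm: "(\<lambda>p. fst p ^ i * snd p ^ j) \<in> borel_measurable (borel_square 0 1)"
      unfolding borel_square_def by (intro measurable_restrict_space1 borel_measurable_continuous_onI continuous_intros)
    have A: "(\<integral>p. fst p ^ i * snd p ^ j \<partial>\<nu>) = m 0 0 0 0 * (\<integral>t. peano_x t ^ i * peano_y t ^ j \<partial>M)"
      unfolding \<nu>_def using pos
      by (subst integral_density) (use pm in \<open>auto simp: integral_distr[OF meas pm] h_def\<close>)
    have B: "(\<lambda>n. integral\<^sup>L (((\<lambda>n. approx (Suc n)) \<circ> id \<circ> r) n) (\<lambda>t. peano_x t ^ i * peano_y t ^ j))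
       \<longlonglongrightarrow> (\<integral>t. peano_x t ^ i * peano_y t ^ j \<partial>M)"
    proof (rule weak_conv_imp_integral_bdd_continuous_conv[OF _ M conv])
      show "isCont (\<lambda>t. peano_x t ^ i * peano_y t ^ j) t" for t
        using continuous_peano_x continuous_peano_y
        by (intro continuous_intros) (auto simp: continuous_on_eq_continuous_at)
      show "norm (peano_x t ^ i * peano_y t ^ j) \<le> 1" for t
        using peano_x_bounds by (simp add: peano_y_def mult_le_one power_le_one)
    qed (use approx_distribution[OF pos] in auto)
    have C: "(\<lambda>n. integral\<^sup>L (((\<lambda>n. approx (Suc n)) \<circ> id \<circ> r) n) (\<lambda>t. peano_x t ^ i * peano_y t ^ j))
       \<longlonglongrightarrow> m i 0 j 0 / m 0 0 0 0"
      using LIMSEQ_subseq_LIMSEQ[OF LIMSEQ_Suc[OF integral_approx_tendsto[OF pos]] r]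
      by (simp add: o_def)
    show ?thesis using A LIMSEQ_unique[OF B C] pos by simp
  qed
  show ?thesis using fin mom by (intro exI[of _ \<nu>]) (auto simp: \<nu>_def)
qed

end

section \<open>Averaged moments of four commuting operators\<close>

lemma continuous_integrable_square:
  fixes f :: "real \<times> real \<Rightarrow> 'b::{banach, second_countable_topology}"
  assumes "finite_measure \<nu>" "sets \<nu> = sets (borel_square a b)" "continuous_on UNIV f"
  shows "integrable \<nu> f"
proof -
  have sp: "space \<nu> = {a..b} \<times> {a..b}"
    using sets_eq_imp_space_eq[OF assms(2)] by (simp add: borel_square_def space_restrict_space)
  have "compact (f ` ({a..b} \<times> {a..b}))"
    by (intro compact_continuous_image compact_Times compact_Icc continuous_on_subset[OF assms(3)]) auto
  then obtain B where B: "\<And>p. p \<in> {a..b} \<times> {a..b} \<Longrightarrow> norm (f p) \<le> B"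
    using compact_imp_bounded bounded_iff by (metis imageI)
  have "f \<in> borel_measurable (borel_square a b)"
    unfolding borel_square_def
    by (intro measurable_restrict_space1 borel_measurable_continuous_onI assms(3))
  then have "f \<in> borel_measurable \<nu>" using assms(2) measurable_cong_sets by blast
  then show ?thesis
    using B sp by (intro finite_measure.integrable_const_bound[OF assms(1), of _ B]) auto
qed

text \<open>
  Integration by parts shows that all Bernstein polynomials of the same degree have the same integral.
\<close>

lemma Beta_integral:
  "integral {0..1} (\<lambda>s::real. real (p + r choose p) * (s ^ p * (1 - s) ^ r)) = 1 / real (Suc (p + r))"
proof (induction r arbitrary: p)
  case 0
  have "((\<lambda>s::real. s ^ p) has_integral (1 ^ Suc p / real (Suc p) - 0 ^ Suc p / real (Suc p))) {0..1}"
  proof (rule fundamental_theorem_of_calculus)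
    show "((\<lambda>s. s ^ Suc p / real (Suc p)) has_vector_derivative s ^ p) (at s within {0..1})" for s :: real
      using DERIV_cdivide[OF DERIV_pow[of "Suc p" s "{0..1}"], of "real (Suc p)"]
      by (simp add: has_real_derivative_iff_has_vector_derivative del: of_nat_Suc power_Suc)
  qed simp
  then show ?case by (simp add: integral_unique)
next
  case (Suc r)
  have 1: "((\<lambda>s::real. real (Suc p) * (s ^ p * (1 - s) ^ Suc r) - real (Suc r) * (s ^ Suc p * (1 - s) ^ r)) has_integral
      (1 ^ Suc p * (1 - 1) ^ Suc r - 0 ^ Suc p * (1 - 0) ^ Suc r)) {0..1}"
  proof (rule fundamental_theorem_of_calculus)
    fix s :: real
    have "((\<lambda>s. (1 - s) ^ Suc r) has_real_derivative real (Suc r) * ((0 - 1) * (1 - s) ^ (Suc r - Suc 0)))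
        (at s within {0..1})"
      by (rule DERIV_power) (intro derivative_intros)
    from DERIV_mult[OF DERIV_pow[of "Suc p" s "{0..1}"] this]
    show "((\<lambda>s. s ^ Suc p * (1 - s) ^ Suc r) has_vector_derivative
        real (Suc p) * (s ^ p * (1 - s) ^ Suc r) - real (Suc r) * (s ^ Suc p * (1 - s) ^ r)) (at s within {0..1})"
      by (simp add: has_real_derivative_iff_has_vector_derivative algebra_simps del: of_nat_Suc power_Suc)
  qed simp
  have int: "(\<lambda>s::real. s ^ u * (1 - s) ^ v) integrable_on {0..1}" for u v
    by (intro integrable_continuous_real continuous_intros)
  have "integral {0..1} (\<lambda>s::real. real (Suc p) * (s ^ p * (1 - s) ^ Suc r))
     = integral {0..1} (\<lambda>s::real. real (Suc r) * (s ^ Suc p * (1 - s) ^ r))"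
    using integral_unique[OF 1] int
    by (subst (asm) integral_diff) (auto simp del: power_Suc of_nat_Suc)
  then have 2: "real (Suc p) * integral {0..1} (\<lambda>s::real. s ^ p * (1 - s) ^ Suc r)
     = real (Suc r) * integral {0..1} (\<lambda>s::real. s ^ Suc p * (1 - s) ^ r)"
    by (simp del: power_Suc of_nat_Suc)
  have 3: "real (p + Suc r choose p) * real (Suc r) = real (Suc p + r choose Suc p) * real (Suc p)"
  proof -
    have "Suc (p + r) * (p + r choose p) = (Suc (p + r) choose Suc p) * Suc p"
      by (rule Suc_times_binomial_eq)
    moreover have "(Suc (p + r) choose p) * Suc r = Suc (p + r) * (p + r choose p)"
      using binomial_absorb_comp[of "Suc (p + r)" p] by (simp add: mult.commute)
    ultimately show ?thesis by (metis add_Suc add_Suc_right of_nat_mult)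
  qed
  define I where "I = integral {0..1} (\<lambda>s::real. s ^ p * (1 - s) ^ Suc r)"
  define J where "J = integral {0..1} (\<lambda>s::real. s ^ Suc p * (1 - s) ^ r)"
  have J: "real (Suc p + r choose Suc p) * J = 1 / real (Suc (Suc p + r))"
    using Suc.IH[of "Suc p"] unfolding J_def by simp
  have "real (Suc p) * (real (p + Suc r choose p) * I) = real (p + Suc r choose p) * real (Suc r) * J"
    using 2 unfolding I_def J_def by (simp del: power_Suc of_nat_Suc)
  also have "\<dots> = real (Suc p) * (real (Suc p + r choose Suc p) * J)"
    unfolding 3 by simp
  finally have "real (p + Suc r choose p) * I = real (Suc p + r choose Suc p) * J"
    by (simp del: of_nat_Suc)
  then show ?case unfolding J unfolding I_def by simp
qed

lemma linear_funpow:
  fixes T :: "'v::real_vector \<Rightarrow> 'v"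
  shows "linear T \<Longrightarrow> linear (T ^^ n)"
proof (induction n)
  case 0
  have "T ^^ 0 = (\<lambda>x. x)" by (rule ext) simp
  then show ?case by (simp only: linear_ident)
next
  case (Suc n)
  have "T ^^ Suc n = T \<circ> (T ^^ n)" by (rule ext) simp
  then show ?case using Suc linear_compose by metis
qed

text \<open>The binomial theorem for commuting linear maps.\<close>

lemma funpow_mix:
  fixes S T :: "'v::real_vector \<Rightarrow> 'v"
  assumes S: "linear S" and T: "linear T" and comm: "\<And>x. S (T x) = T (S x)"
  shows "((\<lambda>x. s *\<^sub>R S x + u *\<^sub>R T x) ^^ n) x
    = (\<Sum>p\<le>n. (real (n choose p) * (s ^ p * u ^ (n - p))) *\<^sub>R (S ^^ p) ((T ^^ (n - p)) x))"
proof (induction n)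
  case (Suc n)
  have TS: "T ((S ^^ p) y) = (S ^^ p) (T y)" for p y
    by (induction p) (simp_all add: comm[symmetric])
  have cs: "Suc n - p = Suc (n - p)" if "p \<le> n" for p using that by (simp add: Suc_diff_le)
  let ?h = "\<lambda>p. (s ^ p * u ^ (Suc n - p)) *\<^sub>R (S ^^ p) ((T ^^ (Suc n - p)) x)"
  have "((\<lambda>x. s *\<^sub>R S x + u *\<^sub>R T x) ^^ Suc n) x
     = (\<Sum>p\<le>n. real (n choose p) *\<^sub>R ?h (Suc p)) + (\<Sum>p\<le>n. real (n choose p) *\<^sub>R ?h p)"
    by (simp add: Suc linear_sum[OF S] linear_sum[OF T] linear_scale[OF S] linear_scale[OF T] TS
        scaleR_sum_right cs mult.assoc mult.left_commute mult.commute)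
  also have "\<dots> = (\<Sum>p\<le>Suc n. real (Suc n choose p) *\<^sub>R ?h p)"
  proof -
    have "(\<Sum>p\<le>Suc n. real (Suc n choose p) *\<^sub>R ?h p)
      = ?h 0 + (\<Sum>p\<le>n. real (n choose p) *\<^sub>R ?h (Suc p)) + (\<Sum>p\<le>n. real (n choose Suc p) *\<^sub>R ?h (Suc p))"
      by (simp only: sum.atMost_Suc_shift binomial_Suc_Suc of_nat_add scaleR_add_left sum.distrib)
         simp
    moreover have "?h 0 + (\<Sum>p\<le>n. real (n choose Suc p) *\<^sub>R ?h (Suc p)) = (\<Sum>p\<le>Suc n. real (n choose p) *\<^sub>R ?h p)"
      by (simp only: sum.atMost_Suc_shift) simp
    moreover have "(\<Sum>p\<le>Suc n. real (n choose p) *\<^sub>R ?h p) = (\<Sum>p\<le>n. real (n choose p) *\<^sub>R ?h p)"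
      by simp
    ultimately show ?thesis by (simp add: algebra_simps)
  qed
  finally show ?case by simp
qed simp

context form_space
begin

definition between :: "real \<Rightarrow> real \<Rightarrow> ('v \<Rightarrow> 'v) \<Rightarrow> bool" where
  "between a b T \<longleftrightarrow> symop T \<and> (\<forall>x\<in>V. a * q x x \<le> q x (T x) \<and> q x (T x) \<le> b * q x x)"

definition rescale :: "real \<Rightarrow> real \<Rightarrow> ('v \<Rightarrow> 'v) \<Rightarrow> 'v \<Rightarrow> 'v" where
  "rescale a b T x = (1 / (b - a)) *\<^sub>R (T x - a *\<^sub>R x)"

lemma effect_rescale:
  assumes "a < b" "between a b T"
  shows "effect (rescale a b T)"
proof -
  have s: "symop T" using assms by (simp add: between_def)
  have "symop (rescale a b T)"
    unfolding rescale_def[abs_def] by (intro symop_scale symop_diff s symop_id)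
  moreover have "0 \<le> q x (rescale a b T x) \<and> q x (rescale a b T x) \<le> q x x" if x: "x \<in> V" for x
  proof -
    have "q x (rescale a b T x) = (q x (T x) - a * q x x) / (b - a)"
      using x symopD[OF s] by (simp add: rescale_def q_scale_right q_diff_right)
    moreover have "a * q x x \<le> q x (T x)" "q x (T x) \<le> b * q x x"
      using assms x by (auto simp: between_def)
    ultimately show ?thesis using assms(1) by (auto simp: divide_le_eq algebra_simps)
  qed
  ultimately show ?thesis by (simp add: effect_def)
qed

lemma rescale_commute:
  assumes "linear S" "linear T" "\<And>x. S (T x) = T (S x)"
  shows "rescale a b S (rescale a b T x) = rescale a b T (rescale a b S x)"
  by (simp add: rescale_def linear_diff[OF assms(1)] linear_diff[OF assms(2)] linear_scale[OF assms(1)]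
      linear_scale[OF assms(2)] assms(3) algebra_simps)

definition mix :: "real \<Rightarrow> ('v \<Rightarrow> 'v) \<Rightarrow> ('v \<Rightarrow> 'v) \<Rightarrow> 'v \<Rightarrow> 'v" where
  "mix s S T x = s *\<^sub>R S x + (1 - s) *\<^sub>R T x"

lemma effect_mix:
  assumes "effect S" "effect T" "s \<in> {0..1}"
  shows "effect (mix s S T)"
proof -
  note s = effectD(1)[OF assms(1)] effectD(1)[OF assms(2)]
  have "symop (mix s S T)" unfolding mix_def[abs_def] by (intro symop_add symop_scale s)
  moreover have "0 \<le> q x (mix s S T x) \<and> q x (mix s S T x) \<le> q x x" if x: "x \<in> V" for x
  proof -
    have eq: "q x (mix s S T x) = s * q x (S x) + (1 - s) * q x (T x)"
      using x symopD[OF s(1)] symopD[OF s(2)] by (simp add: mix_def q_add_right q_scale_right)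
    have "s * q x (S x) \<le> s * q x x" "(1 - s) * q x (T x) \<le> (1 - s) * q x x"
      using assms x by (auto intro!: mult_left_mono effectD)
    moreover have "0 \<le> s * q x (S x)" "0 \<le> (1 - s) * q x (T x)"
      using assms x by (auto intro!: mult_nonneg_nonneg effectD)
    ultimately show ?thesis unfolding eq by (simp add: algebra_simps)
  qed
  ultimately show ?thesis by (simp add: effect_def)
qed

text \<open>
  Continuity of \<open>Y\<close> is required weakly; a symmetric operator applied to \<open>Y\<close> can then be moved to
  the other argument of the form.
\<close>

definition cont_family :: "(real \<Rightarrow> real \<Rightarrow> 'v) \<Rightarrow> bool" where
  "cont_family Y \<longleftrightarrow> (\<forall>s t. Y s t \<in> V) \<and>
     (\<forall>U\<in>V. continuous_on UNIV (\<lambda>p. q U (Y (fst p) (snd p))))"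

lemma cont_family_const: "X \<in> V \<Longrightarrow> cont_family (\<lambda>s t. X)"
  by (simp add: cont_family_def)

lemma cont_family_symop:
  assumes "cont_family Y" "symop T"
  shows "cont_family (\<lambda>s t. T (Y s t))"
  unfolding cont_family_def
proof (intro conjI allI ballI)
  show "T (Y s t) \<in> V" for s t using assms symopD by (simp add: cont_family_def)
  fix U assume U: "U \<in> V"
  have "q U (T (Y s t)) = q (T U) (Y s t)" for s t
    using assms symopD U by (simp add: cont_family_def)
  moreover have "T U \<in> V" using U assms(2) symopD by blast
  ultimately show "continuous_on UNIV (\<lambda>p. q U (T (Y (fst p) (snd p))))"
    using assms(1) by (simp add: cont_family_def)
qed

lemma cont_family_combination:
  assumes "cont_family Y" "cont_family Y'" "continuous_on UNIV c" "continuous_on UNIV d"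
  shows "cont_family (\<lambda>s t. c (s, t) *\<^sub>R Y s t + d (s, t) *\<^sub>R Y' s t)"
proof -
  have "q U (c p *\<^sub>R Y (fst p) (snd p) + d p *\<^sub>R Y' (fst p) (snd p))
      = c p * q U (Y (fst p) (snd p)) + d p * q U (Y' (fst p) (snd p))"
    if "U \<in> V" for U p
    using assms that by (simp add: cont_family_def q_add_right q_scale_right)
  then show ?thesis
    using assms by (auto simp: cont_family_def intro!: continuous_on_add continuous_on_mult)
qed

lemma cont_family_mix:
  assumes "cont_family Y" "symop S" "symop T"
  shows "cont_family (\<lambda>s t. mix s S T (Y s t))" "cont_family (\<lambda>s t. mix t S T (Y s t))"
  using cont_family_combination[OF cont_family_symop[OF assms(1,2)] cont_family_symop[OF assms(1,3)],
      of fst "\<lambda>p. 1 - fst p"]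
    cont_family_combination[OF cont_family_symop[OF assms(1,2)] cont_family_symop[OF assms(1,3)],
      of snd "\<lambda>p. 1 - snd p"]
  by (simp_all add: mix_def continuous_on_fst continuous_on_snd continuous_on_diff)

lemma cont_family_diff:
  assumes "cont_family Y" "cont_family Y'"
  shows "cont_family (\<lambda>s t. Y s t - Y' s t)"
  using cont_family_combination[OF assms, of "\<lambda>_. 1" "\<lambda>_. -1"] by (simp add: continuous_on_const)

lemma cont_family_funpow:
  assumes "\<And>Y. cont_family Y \<Longrightarrow> cont_family (\<lambda>s t. F s t (Y s t))" "cont_family Y"
  shows "cont_family (\<lambda>s t. (F s t ^^ n) (Y s t))"
  by (induction n) (use assms in auto)

lemma integrable_cont_family:
  assumes "cont_family Y" "U \<in> V"
  shows "(\<lambda>p. q U (Y (fst p) (snd p))) integrable_on cbox (0, 0) (1, 1)"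
  using assms by (intro integrable_continuous) (auto simp: cont_family_def intro: continuous_on_subset)

end

text \<open>
  In the application \<open>L\<^sub>1\<close>, \<open>L\<^sub>2\<close> are multiplications from the left and \<open>R\<^sub>1\<close>, \<open>R\<^sub>2\<close> multiplications from the right.  After
  affine rescaling to \<open>[0,1]\<close>, the mixtures \<open>Z s\<close> of \<open>L\<^sub>1, R\<^sub>1\<close> and \<open>W t\<close> of \<open>L\<^sub>2, R\<^sub>2\<close> are commuting effects.
\<close>

locale commuting_quadruple = form_space +
  fixes L1 R1 L2 R2 :: "'a \<Rightarrow> 'a" and a b :: real
  assumes ab: "a < b"
    and bounds: "between a b L1" "between a b R1" "between a b L2" "between a b R2"
    and comm: "\<And>x. L1 (R1 x) = R1 (L1 x)" "\<And>x. L1 (L2 x) = L2 (L1 x)" "\<And>x. L1 (R2 x) = R2 (L1 x)"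
      "\<And>x. R1 (L2 x) = L2 (R1 x)" "\<And>x. R1 (R2 x) = R2 (R1 x)" "\<And>x. L2 (R2 x) = R2 (L2 x)"
begin

definition Z where "Z s = mix s (rescale a b L1) (rescale a b R1)"
definition W where "W t = mix t (rescale a b L2) (rescale a b R2)"

lemma symops: "symop L1" "symop R1" "symop L2" "symop R2"
  using bounds by (auto simp: between_def)

lemma lins: "linear L1" "linear R1" "linear L2" "linear R2"
  using symops symopD(1) by auto

lemma effects: "effect (rescale a b L1)" "effect (rescale a b R1)" "effect (rescale a b L2)" "effect (rescale a b R2)"
  using effect_rescale[OF ab] bounds by auto

lemma symop_rescaled: "symop (rescale a b L1)" "symop (rescale a b R1)" "symop (rescale a b L2)" "symop (rescale a b R2)"
  using effects effectD(1) by auto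

lemma effect_Z: "s \<in> {0..1} \<Longrightarrow> effect (Z s)" and effect_W: "t \<in> {0..1} \<Longrightarrow> effect (W t)"
  by (simp_all add: Z_def W_def effect_mix effects)

lemma linear_Z: "linear (Z s)" and linear_W: "linear (W t)"
  unfolding Z_def W_def mix_def[abs_def]
  by (intro linear_compose_add linear_compose_scale_right symopD(1) symop_rescaled)+

lemma Z_eq: "a *\<^sub>R x + (b - a) *\<^sub>R Z s x = s *\<^sub>R L1 x + (1 - s) *\<^sub>R R1 x"
  and W_eq: "a *\<^sub>R x + (b - a) *\<^sub>R W t x = t *\<^sub>R L2 x + (1 - t) *\<^sub>R R2 x"
  using ab by (simp_all add: Z_def W_def mix_def rescale_def scaleR_add_right)
    (simp_all add: algebra_simps)

lemma ZW_commute: "Z s (W t x) = W t (Z s x)"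
proof -
  note d = symopD[OF symop_rescaled(1)] symopD[OF symop_rescaled(2)]
    symopD[OF symop_rescaled(3)] symopD[OF symop_rescaled(4)]
  note c = rescale_commute[OF lins(1) lins(3) comm(2)] rescale_commute[OF lins(1) lins(4) comm(3)]
    rescale_commute[OF lins(2) lins(3) comm(4)] rescale_commute[OF lins(2) lins(4) comm(5)]
  show ?thesis by (simp add: Z_def W_def mix_def d c algebra_simps)
qed

definition Zc where "Zc s x = x - Z s x"
definition Wc where "Wc t x = x - W t x"

lemma effect_Zc: "s \<in> {0..1} \<Longrightarrow> effect (Zc s)" and effect_Wc: "t \<in> {0..1} \<Longrightarrow> effect (Wc t)"
  using effect_complement[OF effect_Z] effect_complement[OF effect_W]
  by (simp_all add: Zc_def[abs_def] Wc_def[abs_def])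

text \<open>
  The operator analogue of \<open>x\<^sup>k (1 - x)\<^sup>k\<^sup>' y\<^sup>l (1 - y)\<^sup>l\<^sup>'\<close>.  As a product of commuting effects it is positive, which is the
  positivity condition in the moment problem.
\<close>

definition word :: "real \<Rightarrow> real \<Rightarrow> nat \<Rightarrow> nat \<Rightarrow> nat \<Rightarrow> nat \<Rightarrow> 'a \<Rightarrow> 'a" where
  "word s t k k' l l' x = (Z s ^^ k) ((Zc s ^^ k') ((W t ^^ l) ((Wc t ^^ l') x)))"

lemma commutes:
  "Z s (Zc s x) = Zc s (Z s x)" "Z s (Wc t x) = Wc t (Z s x)"
  "Zc s (W t x) = W t (Zc s x)" "Zc s (Wc t x) = Wc t (Zc s x)" "W t (Wc t x) = Wc t (W t x)"
  by (simp_all add: Zc_def Wc_def ZW_commute linear_diff[OF linear_Z] linear_diff[OF linear_W])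

lemma effect_word:
  assumes "s \<in> {0..1}" "t \<in> {0..1}"
  shows "effect (word s t k k' l l')"
proof -
  note e = effect_funpow[OF effect_Z[OF assms(1)]] effect_funpow[OF effect_Zc[OF assms(1)]]
    effect_funpow[OF effect_W[OF assms(2)]] effect_funpow[OF effect_Wc[OF assms(2)]]
  note c = funpow_commute[of "Z s" "Zc s", OF commutes(1)] funpow_commute[of "Z s" "W t", OF ZW_commute]
    funpow_commute[of "Z s" "Wc t", OF commutes(2)] funpow_commute[of "Zc s" "W t", OF commutes(3)]
    funpow_commute[of "Zc s" "Wc t", OF commutes(4)] funpow_commute[of "W t" "Wc t", OF commutes(5)]
  have 1: "effect (\<lambda>x. (W t ^^ l) ((Wc t ^^ l') x))"
    by (rule effect_comp[OF e(3,4)]) (rule c(6))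
  have 2: "effect (\<lambda>x. (Zc s ^^ k') ((W t ^^ l) ((Wc t ^^ l') x)))"
    by (rule effect_comp[OF e(2) 1]) (simp only: c(4,5))
  show ?thesis
    unfolding word_def[abs_def] by (rule effect_comp[OF e(1) 2]) (simp only: c(1-3))
qed

lemma word_split_x: "word s t k k' l l' x = word s t (Suc k) k' l l' x + word s t k (Suc k') l l' x"
proof -
  have "(Z s ^^ k) y = (Z s ^^ Suc k) y + (Z s ^^ k) (Zc s y)" for y
    by (simp add: Zc_def linear_diff[OF linear_funpow[OF linear_Z]] funpow_swap1)
  then show ?thesis unfolding word_def by simp
qed

lemma linear_Zc: "linear (Zc s)"
  unfolding Zc_def[abs_def] by (intro linear_compose_sub linear_Z linear_ident)

lemma word_split_y: "word s t k k' l l' x = word s t k k' (Suc l) l' x + word s t k k' l (Suc l') x"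
proof -
  have "(W t ^^ l) y = (W t ^^ Suc l) y + (W t ^^ l) (Wc t y)" for y
    by (simp add: Wc_def linear_diff[OF linear_funpow[OF linear_W]] funpow_swap1)
  from this[of "(Wc t ^^ l') x"] show ?thesis
    by (simp add: word_def linear_add[OF linear_funpow[OF linear_Zc], symmetric]
        linear_add[OF linear_funpow[OF linear_Z], symmetric])
qed

lemma cont_family_word:
  assumes X: "X \<in> V"
  shows "cont_family (\<lambda>s t. word s t k k' l l' X)"
proof -
  have "cont_family (\<lambda>s t. Z s (Y s t))" "cont_family (\<lambda>s t. W t (Y s t))" if "cont_family Y" for Y
    using that cont_family_mix symop_rescaled by (auto simp: Z_def W_def)
  moreover from this have "cont_family (\<lambda>s t. Zc s (Y s t))" "cont_family (\<lambda>s t. Wc t (Y s t))" if "cont_family Y" for Y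
    using that cont_family_diff by (auto simp: Zc_def Wc_def)
  ultimately show ?thesis
    unfolding word_def by (intro cont_family_funpow cont_family_const X) auto
qed

definition mean :: "'a \<Rightarrow> nat \<Rightarrow> nat \<Rightarrow> nat \<Rightarrow> nat \<Rightarrow> real" where
  "mean X k k' l l' = integral (cbox (0, 0) (1, 1)) (\<lambda>p. q X (word (fst p) (snd p) k k' l l' X))"

lemma mean_moment_array:
  assumes X: "X \<in> V"
  shows "moment_array (mean X)"
proof
  note int = integrable_cont_family[OF cont_family_word[OF X] X]
  have inV: "word s t k k' l l' X \<in> V" for s t k k' l l'
    using cont_family_word[OF X] by (simp add: cont_family_def)
  show "0 \<le> mean X k k' l l'" for k k' l l'
    unfolding mean_def
    by (rule integral_nonneg[OF int]) (use effectD(2)[OF effect_word X] in auto)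
  show "mean X k k' l l' = mean X (Suc k) k' l l' + mean X k (Suc k') l l'" for k k' l l'
    unfolding mean_def
    by (subst integral_add[symmetric, OF int int], subst word_split_x) (simp add: q_add_right inV X)
  show "mean X k k' l l' = mean X k k' (Suc l) l' + mean X k k' l (Suc l')" for k k' l l'
    unfolding mean_def
    by (subst integral_add[symmetric, OF int int], subst word_split_y) (simp add: q_add_right inV X)
qed

text \<open>
  Binomial expansion of \<open>(s L\<^sub>1 + (1 - s) R\<^sub>1)\<^sup>i\<close> produces the Bernstein polynomials in \<open>s\<close>, which all have the integral
  \<open>1/(i + 1)\<close>.  Averaging over \<open>s\<close> thus turns the power into the sum of the \<open>L\<^sub>1\<^sup>p R\<^sub>1\<^sup>i\<^sup>-\<^sup>p\<close> with equal weights, and likewise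
  for \<open>t\<close>.
\<close>

lemma integral_mix_powers:
  assumes X: "X \<in> V"
  shows "real (Suc i) * real (Suc j) * integral (cbox (0, 0) (1, 1)) (\<lambda>p.
       q X (((\<lambda>x. fst p *\<^sub>R L1 x + (1 - fst p) *\<^sub>R R1 x) ^^ i) (((\<lambda>x. snd p *\<^sub>R L2 x + (1 - snd p) *\<^sub>R R2 x) ^^ j) X)))
     = (\<Sum>p\<le>i. \<Sum>r\<le>j. q X ((L1 ^^ p) ((R1 ^^ (i - p)) ((L2 ^^ r) ((R2 ^^ (j - r)) X)))))"
proof -
  have fp: "(T ^^ n) x \<in> V" if "symop T" "x \<in> V" for T n x
    by (induction n) (use that symopD in auto)
  define T where "T p r = (L1 ^^ p) ((R1 ^^ (i - p)) ((L2 ^^ r) ((R2 ^^ (j - r)) X)))" for p r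
  have TV: "T p r \<in> V" for p r unfolding T_def by (intro fp symops X)
  define B where "B n p s = real (n choose p) * (s ^ p * (1 - s) ^ (n - p))" for n p and s :: real
  note l1 = linear_funpow[OF lins(1)] and l2 = linear_funpow[OF lins(2)]
  have "q X (((\<lambda>x. s *\<^sub>R L1 x + (1 - s) *\<^sub>R R1 x) ^^ i) (((\<lambda>x. t *\<^sub>R L2 x + (1 - t) *\<^sub>R R2 x) ^^ j) X))
     = (\<Sum>p\<le>i. \<Sum>r\<le>j. B i p s * B j r t * q X (T p r))" for s t
  proof -
    have "((\<lambda>x. s *\<^sub>R L1 x + (1 - s) *\<^sub>R R1 x) ^^ i) (((\<lambda>x. t *\<^sub>R L2 x + (1 - t) *\<^sub>R R2 x) ^^ j) X)
       = (\<Sum>p\<le>i. \<Sum>r\<le>j. (B i p s * B j r t) *\<^sub>R T p r)"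
      by (simp add: funpow_mix[OF lins(1,2) comm(1)] funpow_mix[OF lins(3,4) comm(6)] B_def[symmetric]
          linear_sum[OF l1] linear_sum[OF l2] linear_scale[OF l1] linear_scale[OF l2] scaleR_sum_right T_def)
    then show ?thesis
      using TV X by (simp add: q_sum_right q_scale_right subspace_sum[OF subspace_V])
  qed
  then have "integral (cbox (0, 0) (1, 1)) (\<lambda>p.
       q X (((\<lambda>x. fst p *\<^sub>R L1 x + (1 - fst p) *\<^sub>R R1 x) ^^ i) (((\<lambda>x. snd p *\<^sub>R L2 x + (1 - snd p) *\<^sub>R R2 x) ^^ j) X)))
     = integral (cbox (0, 0) (1, 1)) (\<lambda>z. \<Sum>p\<le>i. \<Sum>r\<le>j. B i p (fst z) * B j r (snd z) * q X (T p r))"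
    by simp
  also have "\<dots> = (\<Sum>p\<le>i. \<Sum>r\<le>j. integral (cbox (0, 0) (1, 1)) (\<lambda>z. B i p (fst z) * B j r (snd z) * q X (T p r)))"
    unfolding B_def
    by (subst integral_sum, simp, intro integrable_continuous continuous_intros,
        intro sum.cong refl integral_sum integrable_continuous continuous_intros) simp
  also have "\<dots> = (\<Sum>p\<le>i. \<Sum>r\<le>j. 1 / (real (Suc i) * real (Suc j)) * q X (T p r))"
  proof (intro sum.cong refl)
    fix p r assume pr: "p \<in> {..i}" "r \<in> {..j}"
    have B: "integral {0..1} (B n p) = 1 / real (Suc n)" if "p \<le> n" for n p
      using Beta_integral[of p "n - p"] that unfolding B_def[abs_def] by simp
    have "integral (cbox (0, 0) (1, 1)) (\<lambda>z. B i p (fst z) * B j r (snd z) * q X (T p r))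
      = integral (cbox 0 1) (\<lambda>s. integral (cbox 0 1) (\<lambda>t. B i p s * B j r t * q X (T p r)))"
      by (subst integral_prod_continuous) (auto simp: B_def intro!: continuous_intros)
    also have "\<dots> = 1 / (real (Suc i) * real (Suc j)) * q X (T p r)"
      using B pr by (simp add: mult.assoc)
    finally show "integral (cbox (0, 0) (1, 1)) (\<lambda>z. B i p (fst z) * B j r (snd z) * q X (T p r))
      = 1 / (real (Suc i) * real (Suc j)) * q X (T p r)" .
  qed
  finally show ?thesis by (simp add: sum_divide_distrib[symmetric] T_def del: of_nat_Suc)
qed

text \<open>
  The moment theorem gives a measure on \<open>[0,1]\<^sup>2\<close> for the rescaled operators; its image under \<open>x \<mapsto> a + (b - a) x\<close> in
  both coordinates has the moments of the original ones, because \<open>a + (b - a) Z s = s L\<^sub>1 + (1 - s) R\<^sub>1\<close>.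
\<close>

theorem averaged_moment_measure:
  assumes X: "X \<in> V"
  shows "\<exists>\<nu>. finite_measure \<nu> \<and> sets \<nu> = sets (borel_square a b) \<and>
     (\<forall>i j. real (Suc i) * real (Suc j) * (\<integral>p. fst p ^ i * snd p ^ j \<partial>\<nu>)
        = (\<Sum>p\<le>i. \<Sum>r\<le>j. q X ((L1 ^^ p) ((R1 ^^ (i - p)) ((L2 ^^ r) ((R2 ^^ (j - r)) X))))))"
proof -
  interpret moment_array "mean X" by (rule mean_moment_array[OF X])
  obtain \<nu> where \<nu>: "finite_measure \<nu>" "sets \<nu> = sets (borel_square 0 1)"
    and mom: "\<And>i j. (\<integral>p. fst p ^ i * snd p ^ j \<partial>\<nu>) = mean X i 0 j 0"
    using moment_measure by blast
  define h where "h p = (a + (b - a) * fst p, a + (b - a) * snd p)" for p :: "real \<times> real"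
  have h: "h \<in> measurable \<nu> (borel_square a b)"
  proof -
    have sp: "space \<nu> = {0..1} \<times> {0..1}"
      using sets_eq_imp_space_eq[OF \<nu>(2)] by (simp add: borel_square_def space_restrict_space)
    have "h \<in> borel_measurable (borel_square 0 1)"
      unfolding borel_square_def h_def
      by (intro measurable_restrict_space1 borel_measurable_continuous_onI continuous_intros)
    then have "h \<in> borel_measurable \<nu>" using \<nu>(2) measurable_cong_sets by blast
    moreover have "a + (b - a) * x \<in> {a..b}" if "x \<in> {0..1}" for x
    proof -
      have "(b - a) * x \<le> (b - a) * 1" using ab that by (intro mult_left_mono) auto
      moreover have "0 \<le> (b - a) * x" using ab that by simp
      ultimately show ?thesis by simp
    qed
    ultimately show ?thesis
      unfolding borel_square_def using sp by (intro measurable_restrict_space2) (auto simp: h_def)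
  qed
  define \<nu>' where "\<nu>' = distr \<nu> (borel_square a b) h"
  have fin: "finite_measure \<nu>'" unfolding \<nu>'_def by (rule finite_measure.finite_measure_distr[OF \<nu>(1) h])
  have "(\<integral>p. fst p ^ i * snd p ^ j \<partial>\<nu>') = integral (cbox (0, 0) (1, 1)) (\<lambda>p.
       q X (((\<lambda>x. fst p *\<^sub>R L1 x + (1 - fst p) *\<^sub>R R1 x) ^^ i) (((\<lambda>x. snd p *\<^sub>R L2 x + (1 - snd p) *\<^sub>R R2 x) ^^ j) X)))"
    for i j
  proof -
    \<comment> \<open>The same binomial coefficients expand the image measure's moments and the operator powers.\<close>
    define C where "C n p = real (n choose p) * ((b - a) ^ p * a ^ (n - p))" for n p
    have pm: "(\<lambda>p. fst p ^ i * snd p ^ j) \<in> borel_measurable (borel_square a b)"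
      unfolding borel_square_def by (intro measurable_restrict_space1 borel_measurable_continuous_onI continuous_intros)
    have bin: "(a + (b - a) * x) ^ n = (\<Sum>p\<le>n. C n p * x ^ p)" for x n
      using binomial_ring[of "(b - a) * x" a n] by (simp add: C_def add.commute power_mult_distrib ac_simps)
    have "(\<integral>p. fst p ^ i * snd p ^ j \<partial>\<nu>') = (\<integral>z. (\<Sum>p\<le>i. \<Sum>r\<le>j. C i p * C j r * (fst z ^ p * snd z ^ r)) \<partial>\<nu>)"
      unfolding \<nu>'_def
      by (subst integral_distr[OF h pm], simp only: h_def fst_conv snd_conv bin sum_product)
         (simp add: ac_simps)
    also have "\<dots> = (\<Sum>p\<le>i. \<Sum>r\<le>j. C i p * C j r * mean X p 0 r 0)"
      by (subst Bochner_Integration.integral_sum, intro continuous_integrable_square[OF \<nu>] continuous_intros,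
          intro sum.cong refl, subst Bochner_Integration.integral_sum,
          intro continuous_integrable_square[OF \<nu>] continuous_intros) (simp add: mom)
    also have "\<dots> = integral (cbox (0, 0) (1, 1)) (\<lambda>z. \<Sum>p\<le>i. \<Sum>r\<le>j. C i p * C j r *
          q X (word (fst z) (snd z) p 0 r 0 X))"
      using integrable_cont_family[OF cont_family_word[OF X] X]
      by (subst integral_sum, simp, intro integrable_sum integrable_on_mult_right, simp, simp,
          intro sum.cong refl, subst integral_sum, simp, intro integrable_on_mult_right, simp)
         (simp add: mean_def)
    also have "\<dots> = integral (cbox (0, 0) (1, 1)) (\<lambda>p.
       q X (((\<lambda>x. fst p *\<^sub>R L1 x + (1 - fst p) *\<^sub>R R1 x) ^^ i) (((\<lambda>x. snd p *\<^sub>R L2 x + (1 - snd p) *\<^sub>R R2 x) ^^ j) X)))"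
    proof (rule arg_cong[of _ _ "integral _"], rule ext)
      fix z :: "real \<times> real"
      have lid: "linear (\<lambda>x::'a. x)" by (rule linear_ident)
      have idp: "((\<lambda>x::'a. x) ^^ n) x = x" for n x by (induction n) auto
      have e1: "(\<lambda>x. fst z *\<^sub>R L1 x + (1 - fst z) *\<^sub>R R1 x) = (\<lambda>x. (b - a) *\<^sub>R Z (fst z) x + a *\<^sub>R x)"
        and e2: "(\<lambda>x. snd z *\<^sub>R L2 x + (1 - snd z) *\<^sub>R R2 x) = (\<lambda>x. (b - a) *\<^sub>R W (snd z) x + a *\<^sub>R x)"
        by (simp_all add: Z_eq[symmetric] W_eq[symmetric] add.commute)
      have inV: "word s t k k' l l' X \<in> V" for s t k k' l l'
        using cont_family_word[OF X] by (simp add: cont_family_def)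
      note lZ = linear_funpow[OF linear_Z]
      have "((\<lambda>x. fst z *\<^sub>R L1 x + (1 - fst z) *\<^sub>R R1 x) ^^ i) (((\<lambda>x. snd z *\<^sub>R L2 x + (1 - snd z) *\<^sub>R R2 x) ^^ j) X)
        = (\<Sum>p\<le>i. \<Sum>r\<le>j. (C i p * C j r) *\<^sub>R word (fst z) (snd z) p 0 r 0 X)"
        unfolding e1 e2
        by (simp add: funpow_mix[OF linear_Z lid refl] funpow_mix[OF linear_W lid refl] idp
            C_def[symmetric] linear_sum[OF lZ] linear_scale[OF lZ] scaleR_sum_right word_def)
      then show "(\<Sum>p\<le>i. \<Sum>r\<le>j. C i p * C j r * q X (word (fst z) (snd z) p 0 r 0 X))
        = q X (((\<lambda>x. fst z *\<^sub>R L1 x + (1 - fst z) *\<^sub>R R1 x) ^^ i) (((\<lambda>x. snd z *\<^sub>R L2 x + (1 - snd z) *\<^sub>R R2 x) ^^ j) X))"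
        using inV X by (simp add: q_sum_right q_scale_right subspace_sum[OF subspace_V])
    qed
    finally show ?thesis .
  qed
  then show ?thesis
    using fin integral_mix_powers[OF X] by (intro exI[of _ \<nu>']) (simp add: \<nu>'_def)
qed

end

section \<open>Uniqueness in the moment problem\<close>

lemma closed_indicator_limit:
  fixes x :: "'a::metric_space"
  assumes "closed C" "C \<noteq> {}"
  shows "(\<lambda>n. max 0 (1 - real n * infdist x C)) \<longlonglongrightarrow> indicator C x"
proof (cases "x \<in> C")
  case True
  then show ?thesis by simp
next
  case False
  then have pos: "infdist x C > 0"
    using assms in_closed_iff_infdist_zero[of C x] infdist_nonneg[of x C] by force
  obtain N where N: "1 / infdist x C < real N" using reals_Archimedean2 by blast
  have "max 0 (1 - real n * infdist x C) = 0" if "n \<ge> N" for n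
  proof -
    have "1 < real N * infdist x C" using N pos by (simp add: field_simps)
    also have "\<dots> \<le> real n * infdist x C" using that pos by simp
    finally show ?thesis by simp
  qed
  then have "\<forall>\<^sub>F n in sequentially. max 0 (1 - real n * infdist x C) = indicator C x"
    using False by (auto intro: eventually_sequentiallyI[of N])
  then show ?thesis by (rule tendsto_eventually)
qed

text \<open>
  A finite sum of measures with bounded densities on a compact set vanishes as soon as it annihilates all polynomials.
  This passes to continuous functions by the Stone-Weierstrass theorem, to indicators of closed sets by dominated
  convergence, and to Borel sets because the closed sets are a generator stable under intersection.  The family of
  measures with densities allows for signed combinations and for densities that are themselves indicators.
\<close>

lemma moment_uniqueness:
  fixes K :: "'a::euclidean_space set" and m :: "'i \<Rightarrow> 'a measure" and f :: "'i \<Rightarrow> 'a \<Rightarrow> real"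
  assumes I: "finite I" and K: "compact K"
    and fin: "\<And>i. i \<in> I \<Longrightarrow> finite_measure (m i)"
    and sets: "\<And>i. i \<in> I \<Longrightarrow> sets (m i) = sets (restrict_space borel K)"
    and f_meas: "\<And>i. i \<in> I \<Longrightarrow> f i \<in> borel_measurable (m i)"
    and f_bound: "\<And>i x. i \<in> I \<Longrightarrow> x \<in> K \<Longrightarrow> \<bar>f i x\<bar> \<le> B i"
    and zero: "\<And>g. real_polynomial_function g \<Longrightarrow> (\<Sum>i\<in>I. \<integral>x. g x * f i x \<partial>m i) = 0"
    and S: "S \<in> sets borel"
  shows "(\<Sum>i\<in>I. \<integral>x. indicator S x * f i x \<partial>m i) = 0"
proof -
  have space: "space (m i) = K" if "i \<in> I" for i
    using sets_eq_imp_space_eq[OF sets[OF that]] by (simp add: space_restrict_space)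
  have meas: "g \<in> borel_measurable (m i)" if "g \<in> borel_measurable borel" "i \<in> I" for g :: "'a \<Rightarrow> real" and i
    using measurable_restrict_space1[OF that(1), of K] sets[OF that(2)] measurable_cong_sets by blast
  have int: "integrable (m i) (\<lambda>x. g x * f i x)"
    if "g \<in> borel_measurable borel" "i \<in> I" "\<And>x. x \<in> K \<Longrightarrow> \<bar>g x\<bar> \<le> c" for g :: "'a \<Rightarrow> real" and i c
  proof (rule finite_measure.integrable_const_bound[OF fin[OF that(2)], of _ "c * B i"])
    show "AE x in m i. norm (g x * f i x) \<le> c * B i"
    proof (rule AE_I2)
      fix x assume "x \<in> space (m i)"
      then have "x \<in> K" using space that by simp
      then have "\<bar>g x\<bar> \<le> c" "\<bar>f i x\<bar> \<le> B i" using that f_bound by auto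
      then show "norm (g x * f i x) \<le> c * B i"
        by (simp add: abs_mult) (intro mult_mono, auto)
    qed
  qed (intro borel_measurable_times meas that f_meas)
  have cont: "(\<Sum>i\<in>I. \<integral>x. g x * f i x \<partial>m i) = 0" if g: "continuous_on UNIV g" for g :: "'a \<Rightarrow> real"
  proof -
    define C where "C = (\<Sum>i\<in>I. B i * measure (m i) K)"
    have gm: "g \<in> borel_measurable borel" by (rule borel_measurable_continuous_onI[OF g])
    have le: "\<bar>\<Sum>i\<in>I. \<integral>x. g x * f i x \<partial>m i\<bar> \<le> e * C" if e: "e > 0" for e
    proof -
      obtain h where h: "real_polynomial_function h" and he: "\<And>x. x \<in> K \<Longrightarrow> \<bar>g x - h x\<bar> < e"
        using Stone_Weierstrass_real_polynomial_function[OF K continuous_on_subset[OF g] e] by blast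
      have hm: "h \<in> borel_measurable borel"
        using continuous_real_polymonial_function[OF h]
        by (intro borel_measurable_continuous_onI continuous_at_imp_continuous_on) auto
      obtain c where c: "\<And>x. x \<in> K \<Longrightarrow> \<bar>g x\<bar> \<le> c"
        using compact_imp_bounded[OF compact_continuous_image[OF continuous_on_subset[OF g] K]]
        unfolding bounded_iff by auto
      have ch: "\<bar>h x\<bar> \<le> c + e" if "x \<in> K" for x
        using c[OF that] he[OF that] by linarith
      have "(\<Sum>i\<in>I. \<integral>x. g x * f i x \<partial>m i) = (\<Sum>i\<in>I. \<integral>x. g x * f i x \<partial>m i) - (\<Sum>i\<in>I. \<integral>x. h x * f i x \<partial>m i)"
        using zero[OF h] by simp
      also have "\<dots> = (\<Sum>i\<in>I. \<integral>x. g x * f i x - h x * f i x \<partial>m i)"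
        using int[OF gm _ c] int[OF hm _ ch] by (simp add: sum_subtractf)
      finally have "\<bar>\<Sum>i\<in>I. \<integral>x. g x * f i x \<partial>m i\<bar> \<le> (\<Sum>i\<in>I. \<bar>\<integral>x. g x * f i x - h x * f i x \<partial>m i\<bar>)"
        by simp
      also have "\<dots> \<le> (\<Sum>i\<in>I. e * (B i * measure (m i) K))"
      proof (rule sum_mono)
        fix i assume i: "i \<in> I"
        interpret finite_measure "m i" by (rule fin[OF i])
        have "\<bar>\<integral>x. g x * f i x - h x * f i x \<partial>m i\<bar> \<le> (\<integral>x. e * B i \<partial>m i)"
        proof (rule order_trans[OF integral_abs_bound integral_mono_AE])
          show "AE x in m i. \<bar>g x * f i x - h x * f i x\<bar> \<le> e * B i"
          proof (rule AE_I2)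
            fix x assume "x \<in> space (m i)"
            then have x: "x \<in> K" using space i by simp
            have "\<bar>g x * f i x - h x * f i x\<bar> = \<bar>g x - h x\<bar> * \<bar>f i x\<bar>"
              by (simp add: abs_mult[symmetric] left_diff_distrib)
            also have "\<dots> \<le> e * B i"
              using he[OF x] f_bound[OF i x] by (intro mult_mono) auto
            finally show "\<bar>g x * f i x - h x * f i x\<bar> \<le> e * B i" .
          qed
        qed (use int[OF gm i c] int[OF hm i ch] in auto)
        then show "\<bar>\<integral>x. g x * f i x - h x * f i x \<partial>m i\<bar> \<le> e * (B i * measure (m i) K)"
          using space[OF i] by (simp add: ac_simps)
      qed
      finally show ?thesis by (simp add: C_def sum_distrib_left)
    qed
    have "\<bar>\<Sum>i\<in>I. \<integral>x. g x * f i x \<partial>m i\<bar> \<le> e" if "e > 0" for e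
    proof -
      have "\<bar>\<Sum>i\<in>I. \<integral>x. g x * f i x \<partial>m i\<bar> \<le> e / (\<bar>C\<bar> + 1) * C" using le[of "e / (\<bar>C\<bar> + 1)"] that by simp
      also have "\<dots> \<le> e / (\<bar>C\<bar> + 1) * (\<bar>C\<bar> + 1)" using that by (intro mult_left_mono) auto
      also have "\<dots> = e" by simp
      finally show ?thesis .
    qed
    then have "\<bar>\<Sum>i\<in>I. \<integral>x. g x * f i x \<partial>m i\<bar> \<le> 0 + e" if "e > 0" for e using that by simp
    then have "\<bar>\<Sum>i\<in>I. \<integral>x. g x * f i x \<partial>m i\<bar> \<le> 0" by (rule field_le_epsilon)
    then show ?thesis by simp
  qed
  have limit: "(\<Sum>i\<in>I. \<integral>x. h x * f i x \<partial>m i) = 0"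
    if g: "\<And>n. g n \<in> borel_measurable borel" and h: "h \<in> borel_measurable borel"
      and conv: "\<And>x. (\<lambda>n. g n x) \<longlonglongrightarrow> h x" and bd: "\<And>n x. \<bar>g n x\<bar> \<le> 1"
      and z: "\<And>n. (\<Sum>i\<in>I. \<integral>x. g n x * f i x \<partial>m i) = 0" for g :: "nat \<Rightarrow> 'a \<Rightarrow> real" and h
  proof -
    have "(\<lambda>n. \<Sum>i\<in>I. \<integral>x. g n x * f i x \<partial>m i) \<longlonglongrightarrow> (\<Sum>i\<in>I. \<integral>x. h x * f i x \<partial>m i)"
    proof (rule tendsto_sum)
      fix i assume i: "i \<in> I"
      interpret finite_measure "m i" by (rule fin[OF i])
      show "(\<lambda>n. \<integral>x. g n x * f i x \<partial>m i) \<longlonglongrightarrow> (\<integral>x. h x * f i x \<partial>m i)"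
      proof (rule integral_dominated_convergence[where w = "\<lambda>_. B i"])
        show "AE x in m i. norm (g n x * f i x) \<le> B i" for n
        proof (rule AE_I2)
          fix x assume "x \<in> space (m i)"
          then have "\<bar>g n x\<bar> * \<bar>f i x\<bar> \<le> 1 * B i"
            using bd[of n x] f_bound[OF i] space[OF i] by (intro mult_mono) auto
          then show "norm (g n x * f i x) \<le> B i" by (simp add: abs_mult)
        qed
        show "AE x in m i. (\<lambda>n. g n x * f i x) \<longlonglongrightarrow> h x * f i x"
          by (intro AE_I2 tendsto_mult conv tendsto_const)
      qed (rule borel_measurable_times[OF meas[OF h i] f_meas[OF i]],
          rule borel_measurable_times[OF meas[OF g i] f_meas[OF i]], simp)
    qed
    then show ?thesis by (simp add: z LIMSEQ_const_iff)
  qed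
  have closed: "(\<Sum>i\<in>I. \<integral>x. indicator C x * f i x \<partial>m i) = 0" if C: "closed C" for C
  proof (cases "C = {}")
    case False
    have c: "continuous_on UNIV (\<lambda>x. max 0 (1 - real n * infdist x C))" for n
      by (intro continuous_intros)
    show ?thesis
    proof (rule limit[of "\<lambda>n x. max 0 (1 - real n * infdist x C)"])
      show "(\<lambda>n. max 0 (1 - real n * infdist x C)) \<longlonglongrightarrow> indicator C x" for x
        by (rule closed_indicator_limit[OF C False])
      show "\<bar>max 0 (1 - real n * infdist x C)\<bar> \<le> 1" for n x
        using infdist_nonneg[of x C] by (auto simp: max_def)
      show "indicat_real C \<in> borel_measurable borel" using C by (intro borel_measurable_indicator) auto
    qed (intro borel_measurable_continuous_onI c cont)+
  qed simp
  have ind_int: "integrable (m i) (\<lambda>x. indicator T x * f i x)" if "T \<in> sets borel" "i \<in> I" for T i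
    by (rule int[OF _ that(2), of _ 1]) (use that in \<open>auto simp: indicator_def\<close>)
  have gen: "Int_stable (Collect closed :: 'a set set)" "Collect closed \<subseteq> Pow (UNIV :: 'a set)"
    by (auto simp: Int_stable_def)
  have "S \<in> sigma_sets UNIV (Collect closed)" using S by (simp add: borel_eq_closed)
  then show ?thesis
  proof (induction rule: sigma_sets_induct_disjoint[OF gen, consumes 1, case_names basic empty compl union])
    case (compl A)
    then have A: "A \<in> sets borel" by (simp add: borel_eq_closed)
    have "(\<Sum>i\<in>I. \<integral>x. indicator (UNIV - A) x * f i x \<partial>m i)
      = (\<Sum>i\<in>I. (\<integral>x. indicator UNIV x * f i x \<partial>m i) - (\<integral>x. indicator A x * f i x \<partial>m i))"
    proof (rule sum.cong[OF refl])
      fix i assume i: "i \<in> I"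
      have "(\<integral>x. indicator UNIV x * f i x \<partial>m i) - (\<integral>x. indicator A x * f i x \<partial>m i)
        = (\<integral>x. indicator UNIV x * f i x - indicator A x * f i x \<partial>m i)"
        by (rule Bochner_Integration.integral_diff[symmetric, OF ind_int[OF _ i] ind_int[OF A i]]) simp
      also have "\<dots> = (\<integral>x. indicator (UNIV - A) x * f i x \<partial>m i)"
        by (intro Bochner_Integration.integral_cong) (auto simp: indicator_def)
      finally show "(\<integral>x. indicator (UNIV - A) x * f i x \<partial>m i)
        = (\<integral>x. indicator UNIV x * f i x \<partial>m i) - (\<integral>x. indicator A x * f i x \<partial>m i)" by simp
    qed
    also have "\<dots> = 0" using compl closed[of UNIV] by (simp add: sum_subtractf)
    finally show ?case .
  next
    case (union A)
    then have A: "A k \<in> sets borel" for k by (auto simp: borel_eq_closed)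
    show ?case
    proof (rule limit[of "\<lambda>n x. \<Sum>k<n. indicator (A k) x"])
      have sums: "(\<lambda>k. indicator (A k) x :: real) sums indicator (\<Union>k. A k) x" for x
        using union(1) by (intro indicator_sums) (auto simp: disjoint_family_on_def)
      then show "(\<lambda>n. \<Sum>k<n. indicat_real (A k) x) \<longlonglongrightarrow> indicat_real (\<Union>k. A k) x" for x
        unfolding sums_def .
      show "\<bar>\<Sum>k<n. indicat_real (A k) x\<bar> \<le> 1" for n x
      proof -
        have "(\<Sum>k<n. indicat_real (A k) x) \<le> indicator (\<Union>k. A k) x"
          using sum_le_suminf[OF sums_summable[OF sums], of "{..<n}" x] sums_unique[OF sums, of x] by simp
        also have "\<dots> \<le> 1" by (simp add: indicator_def)
        finally show ?thesis by (simp add: sum_nonneg)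
      qed
      show "(\<Sum>i\<in>I. \<integral>x. (\<Sum>k<n. indicator (A k) x) * f i x \<partial>m i) = 0" for n
      proof -
        have "(\<Sum>i\<in>I. \<integral>x. (\<Sum>k<n. indicator (A k) x) * f i x \<partial>m i)
          = (\<Sum>i\<in>I. \<Sum>k<n. \<integral>x. indicator (A k) x * f i x \<partial>m i)"
          unfolding sum_distrib_right
          by (intro sum.cong refl Bochner_Integration.integral_sum ind_int A)
        also have "\<dots> = (\<Sum>k<n. \<Sum>i\<in>I. \<integral>x. indicator (A k) x * f i x \<partial>m i)" by (rule sum.swap)
        finally show ?thesis using union by simp
      qed
    qed (use A in auto)
  qed (auto intro: closed)
qed

section \<open>Polynomials of an operator\<close>

text \<open>
  Only real polynomials are substituted, and the scalars act as real ones; symmetric operators are mapped to symmetric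
  operators.
\<close>

definition op_eval :: "'a::real_normed_vector bop \<Rightarrow> real poly \<Rightarrow> 'a bop" where
  "op_eval A p = fold_coeffs (\<lambda>c T. c *\<^sub>R id_blinfun + (A o\<^sub>L T)) p 0"

lemma op_eval_0 [simp]: "op_eval A 0 = 0"
  by (simp add: op_eval_def)

lemma op_eval_pCons [simp]: "op_eval A (pCons c p) = c *\<^sub>R id_blinfun + (A o\<^sub>L op_eval A p)"
  by (cases "p = 0 \<and> c = 0") (auto simp: op_eval_def)

lemma blinfun_compose_assoc: "(S o\<^sub>L T) o\<^sub>L U = S o\<^sub>L (T o\<^sub>L U)"
  by (rule blinfun_eqI) simp

lemma blinfun_compose_id [simp]: "id_blinfun o\<^sub>L T = T" "T o\<^sub>L id_blinfun = T"
  by (simp_all add: blinfun_eqI)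

lemma op_eval_add: "op_eval A (p + q) = op_eval A p + op_eval A q"
  by (induction p q rule: poly_induct2)
     (simp_all add: bounded_bilinear.add_right[OF bounded_bilinear_blinfun_compose] scaleR_add_left algebra_simps)

lemma op_eval_smult: "op_eval A (smult c p) = c *\<^sub>R op_eval A p"
  by (induction p) (simp_all add: bounded_bilinear.scaleR_right[OF bounded_bilinear_blinfun_compose] scaleR_add_right)

lemma op_eval_mult: "op_eval A (p * q) = op_eval A p o\<^sub>L op_eval A q"
  by (induction p)
     (simp_all add: mult_pCons_left op_eval_add op_eval_smult bounded_bilinear.scaleR_left[OF bounded_bilinear_blinfun_compose] bounded_bilinear.add_left[OF bounded_bilinear_blinfun_compose] blinfun_compose_assoc)

lemma op_eval_commute: "A (op_eval A p x) = op_eval A p (A x)"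
  by (induction p) (simp_all add: blinfun.add_left blinfun.add_right blinfun.scaleR_left blinfun.scaleR_right)

lemma op_pow_commute: "A (op_pow A n x) = op_pow A n (A x)"
  by (induction n) simp_all

lemma op_pow_add: "op_pow A (m + n) = op_pow A m o\<^sub>L op_pow A n"
  by (induction m) (simp_all add: blinfun_compose_assoc)

lemma funpow_blinfun: "(blinfun_apply A ^^ n) x = op_pow A n x"
  by (induction n) simp_all

section \<open>The spectral measure of a bounded symmetric operator\<close>

text \<open>
  The space is real at first.  Complex linearity of the spectral projections is a consequence of uniqueness, obtained
  from the fact that they commute with multiplication by \<open>\<i>\<close>.
\<close>

locale symmetric_operator =
  fixes A :: "'a::{real_inner,banach} bop" and lo hi :: real
  assumes sym: "inner (A x) y = inner x (A y)"
    and lo_hi: "lo < hi"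
    and lower: "lo * inner x x \<le> inner x (A x)"
    and upper: "inner x (A x) \<le> hi * inner x x"
begin

lemma sym_eval: "inner (op_eval A p x) y = inner x (op_eval A p y)"
proof (induction p arbitrary: x y)
  case (pCons c p)
  have "inner (A (op_eval A p x)) y = inner x (A (op_eval A p y))"
    by (simp add: sym pCons.IH op_eval_commute)
  then show ?case by (simp add: blinfun.add_left blinfun.scaleR_left inner_add_left inner_add_right)
qed simp

text \<open>
  The moment theorem for four copies of \<open>A\<close>: all mixtures are then \<open>A\<close> itself, and the first marginal of the measure on the
  square has the moments \<open>\<langle>x, A\<^sup>k x\<rangle>\<close>.
\<close>

lemma vector_measure_ex:
  "\<exists>m. finite_measure m \<and> sets m = sets (restrict_space borel {lo..hi}) \<and>
     (\<forall>k. (\<integral>t. t ^ k \<partial>m) = inner x (op_pow A k x))"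
proof -
  interpret V: form_space "UNIV :: 'a set" inner
    by unfold_locales (auto simp: inner_add_left inner_add_right inner_commute)
  have btw: "V.between lo hi (blinfun_apply A)"
    unfolding V.between_def V.symop_def
    using lower upper sym by (auto intro: blinfun.bounded_linear_right bounded_linear.linear)
  interpret V: commuting_quadruple "UNIV :: 'a set" inner A A A A lo hi
    by unfold_locales (auto intro: lo_hi btw)
  obtain \<nu> where \<nu>: "finite_measure \<nu>" "sets \<nu> = sets (borel_square lo hi)"
    and mom: "\<And>i j. real (Suc i) * real (Suc j) * (\<integral>p. fst p ^ i * snd p ^ j \<partial>\<nu>)
        = (\<Sum>p\<le>i. \<Sum>r\<le>j. inner x ((blinfun_apply A ^^ p) ((blinfun_apply A ^^ (i - p))
            ((blinfun_apply A ^^ r) ((blinfun_apply A ^^ (j - r)) x)))))"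
    using V.averaged_moment_measure[of x] by auto
  have sp: "space \<nu> = {lo..hi} \<times> {lo..hi}"
    using sets_eq_imp_space_eq[OF \<nu>(2)] by (simp add: borel_square_def space_restrict_space)
  have "fst \<in> borel_measurable (borel_square lo hi)"
    unfolding borel_square_def
    by (rule measurable_restrict_space1[OF borel_measurable_continuous_onI])
       (rule continuous_on_fst[OF continuous_on_id])
  then have "fst \<in> borel_measurable \<nu>" by (simp only: measurable_cong_sets[OF \<nu>(2) refl])
  moreover have "fst \<in> space \<nu> \<rightarrow> {lo..hi}"
    by (rule funcsetI, unfold sp mem_Times_iff) (erule conjunct1)
  ultimately have m: "fst \<in> measurable \<nu> (restrict_space borel {lo..hi})"
    using measurable_restrict_space2 by blast
  have "(\<integral>t. t ^ k \<partial>distr \<nu> (restrict_space borel {lo..hi}) fst) = inner x (op_pow A k x)" for k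
  proof -
    have "(\<integral>t. t ^ k \<partial>distr \<nu> (restrict_space borel {lo..hi}) fst) = (\<integral>p. fst p ^ k \<partial>\<nu>)"
      by (rule integral_distr[OF m]) (intro measurable_restrict_space1, simp)
    moreover have "real (Suc k) * (\<integral>p. fst p ^ k \<partial>\<nu>) = real (Suc k) * inner x (op_pow A k x)"
    proof -
      have "op_pow A p (op_pow A q y) = op_pow A (p + q) y" for p q y by (simp add: op_pow_add)
      then show ?thesis using mom[of k 0] by (simp add: funpow_blinfun)
    qed
    ultimately show ?thesis by (simp del: of_nat_Suc)
  qed
  then show ?thesis
    using finite_measure.finite_measure_distr[OF \<nu>(1) m]
    by (intro exI[of _ "distr \<nu> (restrict_space borel {lo..hi}) fst"]) simp
qed

definition vector_measure :: "'a \<Rightarrow> real measure" where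
  "vector_measure x = (SOME m. finite_measure m \<and> sets m = sets (restrict_space borel {lo..hi}) \<and>
     (\<forall>k. (\<integral>t. t ^ k \<partial>m) = inner x (op_pow A k x)))"

lemma vector_measure:
  "finite_measure (vector_measure x)" "sets (vector_measure x) = sets (restrict_space borel {lo..hi})"
  "(\<integral>t. t ^ k \<partial>vector_measure x) = inner x (op_pow A k x)"
  unfolding vector_measure_def using someI_ex[OF vector_measure_ex[of x]] by auto

lemma space_vector_measure: "space (vector_measure x) = {lo..hi}"
  using sets_eq_imp_space_eq[OF vector_measure(2)] by (simp add: space_restrict_space)

lemma measurable_vector_measure:
  "g \<in> borel_measurable borel \<Longrightarrow> g \<in> borel_measurable (vector_measure x)" for g :: "real \<Rightarrow> 'b::topological_space"
  using measurable_restrict_space1[of g borel borel "{lo..hi}"] vector_measure(2) measurable_cong_sets by blast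

lemma integrable_vector_measure:
  fixes g :: "real \<Rightarrow> real"
  assumes "g \<in> borel_measurable borel" "\<And>t. t \<in> {lo..hi} \<Longrightarrow> \<bar>g t\<bar> \<le> B"
  shows "integrable (vector_measure x) g"
  using assms space_vector_measure
  by (intro finite_measure.integrable_const_bound[OF vector_measure(1), of _ B] measurable_vector_measure) auto

lemma poly_bounded: "\<exists>B. \<forall>t\<in>{lo..hi}. \<bar>poly p t\<bar> \<le> B"
  using compact_imp_bounded[OF compact_continuous_image[of "{lo..hi}" "poly p"]]
  unfolding bounded_iff by (auto simp: continuous_on_poly continuous_on_id)

lemma poly_measurable: "poly p \<in> borel_measurable (borel :: real measure)"
  by (intro borel_measurable_continuous_onI continuous_on_poly continuous_on_id)

lemma poly_integrable: "integrable (vector_measure x) (poly p)"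
  using poly_bounded[of p] integrable_vector_measure[OF poly_measurable] by blast

lemma integral_poly: "(\<integral>t. poly p t \<partial>vector_measure x) = inner x (op_eval A p x)"
proof -
  have "(\<integral>t. t ^ k * poly p t \<partial>vector_measure x) = inner x (op_pow A k (op_eval A p x))" for k
  proof (induction p arbitrary: k)
    case (pCons c p)
    have i: "integrable (vector_measure x) (\<lambda>t. t ^ n * poly q t)" for n q
      using poly_integrable[of x "monom 1 n * q"] unfolding poly_mult poly_monom by simp
    have "(\<integral>t. t ^ k * poly (pCons c p) t \<partial>vector_measure x)
      = (\<integral>t. c * t ^ k + t ^ Suc k * poly p t \<partial>vector_measure x)"
      by (simp add: algebra_simps)
    also have "\<dots> = c * (\<integral>t. t ^ k \<partial>vector_measure x) + (\<integral>t. t ^ Suc k * poly p t \<partial>vector_measure x)"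
      using i[of k 1] i[of "Suc k" p] by simp
    also have "\<dots> = inner x (op_pow A k (op_eval A (pCons c p) x))"
    proof -
      have "op_pow A (Suc k) y = op_pow A k (A y)" for y
        by (simp add: op_pow_commute)
      then show ?thesis
        by (simp only: pCons.IH vector_measure(3))
           (simp add: blinfun.add_left blinfun.scaleR_left blinfun.add_right blinfun.scaleR_right inner_add_right)
    qed
    finally show ?case .
  qed simp
  from this[of 0] show ?thesis by simp
qed

text \<open>
  A finite signed combination of the measures \<open>\<langle>v, E(dt) v\<rangle>\<close> with bounded densities vanishes
  if it annihilates polynomials.
\<close>

lemma combination_zero:
  assumes f: "\<And>f v. (f, v) \<in> set xs \<Longrightarrow> f \<in> borel_measurable borel \<and> (\<exists>B. \<forall>t\<in>{lo..hi}. \<bar>f t\<bar> \<le> B)"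
    and zero: "\<And>p. (\<Sum>(f, v)\<leftarrow>xs. \<integral>t. poly p t * f t \<partial>vector_measure v) = 0"
    and S: "S \<in> sets borel"
  shows "(\<Sum>(f, v)\<leftarrow>xs. \<integral>t. indicator S t * f t \<partial>vector_measure v) = (0::real)"
proof -
  define F where "F i = fst (xs ! i)" for i
  define v where "v i = snd (xs ! i)" for i
  have F: "F i \<in> borel_measurable borel" "\<exists>B. \<forall>t\<in>{lo..hi}. \<bar>F i t\<bar> \<le> B" if "i < length xs" for i
    using f[of "F i" "v i"] that by (auto simp: F_def v_def)
  then obtain B where B: "\<And>i t. i < length xs \<Longrightarrow> t \<in> {lo..hi} \<Longrightarrow> \<bar>F i t\<bar> \<le> B i" by metis
  have "(\<Sum>i\<in>{0..<length xs}. \<integral>t. indicator S t * F i t \<partial>vector_measure (v i)) = 0"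
  proof (rule moment_uniqueness[where K = "{lo..hi}" and B = B, OF _ _ vector_measure(1,2)])
    fix g :: "real \<Rightarrow> real" assume "real_polynomial_function g"
    then obtain a n where g: "g = (\<lambda>x. \<Sum>i\<le>n. a i * x ^ i)"
      using real_polynomial_function_iff_sum by blast
    have "g = poly (\<Sum>i\<le>n. monom (a i) i)" by (simp add: g poly_sum poly_monom fun_eq_iff)
    then show "(\<Sum>i\<in>{0..<length xs}. \<integral>t. g t * F i t \<partial>vector_measure (v i)) = 0"
      using zero[of "\<Sum>i\<le>n. monom (a i) i"] by (simp add: sum_list_sum_nth F_def v_def case_prod_unfold)
  qed (use F B S in \<open>auto intro: measurable_vector_measure\<close>)
  then show ?thesis by (simp add: sum_list_sum_nth F_def v_def case_prod_unfold)
qed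

text \<open>The integral of \<open>f\<close> against \<open>\<langle>x, E(dt) y\<rangle>\<close>, defined by polarization.\<close>

definition polar :: "(real \<Rightarrow> real) \<Rightarrow> 'a \<Rightarrow> 'a \<Rightarrow> real" where
  "polar f x y = ((\<integral>t. f t \<partial>vector_measure (x + y)) - (\<integral>t. f t \<partial>vector_measure (x - y))) / 4"

lemma polar_poly: "polar (poly p) x y = inner x (op_eval A p y)"
  unfolding polar_def integral_poly
  using sym_eval[of p x y]
  by (simp add: blinfun.add_right blinfun.diff_right inner_add_left inner_add_right inner_diff_left
      inner_diff_right inner_commute)

lemma polar_density_eq:
  assumes f: "f \<in> borel_measurable borel" "\<And>t. t \<in> {lo..hi} \<Longrightarrow> \<bar>f t\<bar> \<le> B"
    and h: "h \<in> borel_measurable borel" "\<And>t. t \<in> {lo..hi} \<Longrightarrow> \<bar>h t\<bar> \<le> C"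
    and eq: "\<And>p. polar (\<lambda>t. poly p t * f t) x y = polar (\<lambda>t. poly p t * h t) x' y'"
    and S: "S \<in> sets borel"
  shows "polar (\<lambda>t. indicat_real S t * f t) x y = polar (\<lambda>t. indicat_real S t * h t) x' y'"
proof -
  let ?xs = "[(f, x + y), (\<lambda>t. - f t, x - y), (\<lambda>t. - h t, x' + y'), (h, x' - y')]"
  have "(\<Sum>(f, v)\<leftarrow>?xs. \<integral>t. indicat_real S t * f t \<partial>vector_measure v) = 0"
  proof (rule combination_zero[OF _ _ S])
    show "(\<Sum>(f, v)\<leftarrow>?xs. \<integral>t. poly p t * f t \<partial>vector_measure v) = 0" for p
      using eq[of p] by (simp add: polar_def field_simps)
    have b: "\<exists>B. \<forall>t\<in>{lo..hi}. \<bar>f t\<bar> \<le> B" "\<exists>B. \<forall>t\<in>{lo..hi}. \<bar>h t\<bar> \<le> B"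
      using f(2) h(2) by blast+
    fix g v assume "(g, v) \<in> set ?xs"
    then have "g = f \<or> g = (\<lambda>t. - f t) \<or> g = (\<lambda>t. - h t) \<or> g = h" by auto
    then show "g \<in> borel_measurable borel \<and> (\<exists>B. \<forall>t\<in>{lo..hi}. \<bar>g t\<bar> \<le> B)"
      using b f(1) h(1) by (elim disjE) (simp_all only: abs_minus_cancel borel_measurable_uminus simp_thms)
  qed
  then show ?thesis by (simp add: polar_def field_simps)
qed

definition mass :: "'a \<Rightarrow> real set \<Rightarrow> real" where
  "mass x S = measure (vector_measure x) (S \<inter> {lo..hi})"

lemma integral_indicator_mass: "(\<integral>t. indicat_real S t \<partial>vector_measure x) = mass x S"
  by (simp add: mass_def space_vector_measure)

lemma polar_indicator: "polar (indicat_real S) x y = (mass (x + y) S - mass (x - y) S) / 4"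
  by (simp add: polar_def integral_indicator_mass del: Bochner_Integration.integral_indicator)

text \<open>
  Identities between the quadratic forms \<open>\<langle>v, E(S) v\<rangle>\<close> are inherited from the same identities for \<open>\<langle>v, p(A) v\<rangle>\<close>.  This
  is how bilinearity and symmetry of \<open>\<langle>x, E(S) y\<rangle>\<close> are obtained from measures chosen separately for each vector.
\<close>

lemma quadratic_combination_zero:
  assumes zero: "\<And>p. (\<Sum>(c, v)\<leftarrow>xs. c * inner v (op_eval A p v)) = 0" and S: "S \<in> sets borel"
  shows "(\<Sum>(c, v)\<leftarrow>xs. c * mass v S) = 0"
proof -
  let ?ys = "map (\<lambda>(c, v). (\<lambda>_. c, v)) xs"
  have "(\<Sum>(f, v)\<leftarrow>?ys. \<integral>t. indicat_real S t * f t \<partial>vector_measure v) = 0"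
  proof (rule combination_zero[OF _ _ S])
    show "(\<Sum>(f, v)\<leftarrow>?ys. \<integral>t. poly p t * f t \<partial>vector_measure v) = 0" for p
      using zero[of p] by (simp add: o_def case_prod_unfold integral_poly mult.commute)
  qed auto
  then show ?thesis
    by (simp add: o_def case_prod_unfold integral_indicator_mass mult.commute
        del: Bochner_Integration.integral_indicator)
qed

lemma inner_eval_commute: "inner x (op_eval A p y) = inner y (op_eval A p x)"
  using sym_eval[of p x y] by (simp add: inner_commute)

lemmas quadratic_expand = blinfun.add_right blinfun.diff_right blinfun.scaleR_right inner_add_left
  inner_add_right inner_diff_left inner_diff_right

lemma polar_indicator_add:
  assumes S: "S \<in> sets borel"
  shows "polar (indicat_real S) (x + x') y = polar (indicat_real S) x y + polar (indicat_real S) x' y"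
  using quadratic_combination_zero[OF _ S, of "[(1, x + x' + y), (-1, x + x' - y), (-1, x + y), (1, x - y),
      (-1, x' + y), (1, x' - y)]"]
  by (simp add: polar_indicator quadratic_expand inner_eval_commute[of y _ x] inner_eval_commute[of y _ x']
      inner_eval_commute[of x' _ x] field_simps)

lemma polar_indicator_scale:
  assumes S: "S \<in> sets borel"
  shows "polar (indicat_real S) (c *\<^sub>R x) y = c * polar (indicat_real S) x y"
  using quadratic_combination_zero[OF _ S, of "[(1, c *\<^sub>R x + y), (-1, c *\<^sub>R x - y), (-c, x + y), (c, x - y)]"]
  by (simp add: polar_indicator quadratic_expand inner_eval_commute[of y _ x] field_simps)

lemma polar_indicator_commute:
  assumes S: "S \<in> sets borel"
  shows "polar (indicat_real S) x y = polar (indicat_real S) y x"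
  using quadratic_combination_zero[OF _ S, of "[(1, x + y), (-1, x - y), (-1, y + x), (1, y - x)]"]
  by (simp add: polar_indicator quadratic_expand inner_eval_commute[of y _ x])

lemma mass_total: "mass x UNIV = (norm x)\<^sup>2"
  using vector_measure(3)[of x 0] by (simp add: mass_def space_vector_measure power2_norm_eq_inner)

lemma sets_vector_measure: "S \<in> sets borel \<Longrightarrow> S \<inter> {lo..hi} \<in> sets (vector_measure x)"
  using vector_measure(2)[of x] by (auto simp: sets_restrict_space intro!: image_eqI)

lemma mass_diff:
  assumes "S \<in> sets borel" "T \<in> sets borel" "S \<subseteq> T"
  shows "mass x (T - S) = mass x T - mass x S"
proof -
  interpret finite_measure "vector_measure x" by (rule vector_measure(1))
  have "(T - S) \<inter> {lo..hi} = (T \<inter> {lo..hi}) - (S \<inter> {lo..hi})" by auto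
  then show ?thesis
    unfolding mass_def using assms by (simp add: finite_measure_Diff sets_vector_measure inf.coboundedI1 le_infI1)
qed

lemma mass_bounds:
  assumes "S \<in> sets borel"
  shows "0 \<le> mass x S" "mass x S \<le> (norm x)\<^sup>2"
proof -
  show "0 \<le> mass x S" by (simp add: mass_def)
  have "0 \<le> mass x (UNIV - S)" by (simp add: mass_def)
  then show "mass x S \<le> (norm x)\<^sup>2"
    using mass_diff[of S UNIV x] assms by (simp add: mass_total)
qed

lemma polar_indicator_bilinear:
  assumes S: "S \<in> sets borel"
  shows "bounded_bilinear (polar (indicat_real S))"
proof
  note add = polar_indicator_add[OF S] and scale = polar_indicator_scale[OF S]
    and comm = polar_indicator_commute[OF S]
  show "polar (indicat_real S) (a + a') b = polar (indicat_real S) a b + polar (indicat_real S) a' b" for a a' b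
    by (rule add)
  show "polar (indicat_real S) a (b + b') = polar (indicat_real S) a b + polar (indicat_real S) a b'" for a b b'
    using add[of b b' a] comm[of a] by simp
  show "polar (indicat_real S) (r *\<^sub>R a) b = r *\<^sub>R polar (indicat_real S) a b" for r a b by (simp add: scale)
  show "polar (indicat_real S) a (r *\<^sub>R b) = r *\<^sub>R polar (indicat_real S) a b" for r a b
    using scale[of r b a] comm[of a] by simp
  have "norm (polar (indicat_real S) a b) \<le> norm a * norm b * 1" for a b
  proof (cases "a = 0 \<or> b = 0")
    case True
    then show ?thesis using scale[of 0 a b] scale[of 0 b a] comm[of a b] by auto
  next
    case False
    have unit: "\<bar>polar (indicat_real S) u v\<bar> \<le> 1" if "norm u = 1" "norm v = 1" for u v
    proof -
      have "(norm (u + v))\<^sup>2 + (norm (u - v))\<^sup>2 = 4"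
        using that by (simp add: power2_norm_eq_inner norm_eq_1 algebra_simps inner_commute)
      then have "\<bar>mass (u + v) S - mass (u - v) S\<bar> \<le> 4"
        using mass_bounds[OF S, of "u + v"] mass_bounds[OF S, of "u - v"]
          zero_le_power2[of "norm (u + v)"] zero_le_power2[of "norm (u - v)"] by linarith
      then show ?thesis by (simp add: polar_indicator)
    qed
    define u v where "u = (1 / norm a) *\<^sub>R a" and "v = (1 / norm b) *\<^sub>R b"
    have a: "norm a *\<^sub>R u = a" "norm b *\<^sub>R v = b" and n: "norm u = 1" "norm v = 1"
      using False by (simp_all add: u_def v_def)
    have "polar (indicat_real S) a b = polar (indicat_real S) (norm a *\<^sub>R u) (norm b *\<^sub>R v)"
      by (simp only: a)
    also have "\<dots> = norm a * norm b * polar (indicat_real S) u v"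
      by (simp only: scale comm[of u "norm b *\<^sub>R v"] comm[of v u] mult.assoc)
    finally show ?thesis
      using mult_left_mono[OF unit[OF n], of "norm a * norm b"] by (simp add: abs_mult)
  qed
  then show "\<exists>K. \<forall>a b. norm (polar (indicat_real S) a b) \<le> norm a * norm b * K" by blast
qed

definition proj :: "real set \<Rightarrow> 'a bop" where
  "proj S = (SOME T :: 'a bop. \<forall>x y. inner x (T y) = polar (indicat_real S) x y)"

lemma inner_proj: "S \<in> sets borel \<Longrightarrow> inner x (proj S y) = polar (indicat_real S) x y"
  unfolding proj_def
  using someI_ex[OF bounded_bilinear_imp_operator[OF polar_indicator_bilinear]] by blast

lemma proj_sym: "S \<in> sets borel \<Longrightarrow> inner (proj S x) y = inner x (proj S y)"
  by (simp add: inner_proj inner_commute[of "proj S x"] polar_indicator_commute[of S y])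

lemma inner_proj_diag:
  assumes S: "S \<in> sets borel"
  shows "inner x (proj S x) = mass x S"
  using quadratic_combination_zero[OF _ S, of "[(1, x + x), (-4, x)]"] mass_bounds[OF S, of 0]
  by (simp add: inner_proj S polar_indicator quadratic_expand)

text \<open>
  Uniqueness is applied twice.  From \<open>\<langle>q(A) p(A) x, y\<rangle> = \<langle>x, (p q)(A) y\<rangle>\<close> it follows that \<open>\<langle>p(A) x, E(S) y\<rangle>\<close> is the integral of
  \<open>p\<close> over \<open>S\<close> against \<open>\<langle>x, E(dt) y\<rangle>\<close>.  So \<open>\<langle>x, E(dt) E(S) y\<rangle>\<close> and the restriction of \<open>\<langle>x, E(dt) y\<rangle>\<close> to \<open>S\<close> have the same
  integrals of polynomials, and thus agree on \<open>S'\<close>.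
\<close>

lemma proj_mult:
  assumes S: "S \<in> sets borel" and S': "S' \<in> sets borel"
  shows "proj S' o\<^sub>L proj S = proj (S \<inter> S')"
proof (rule blinfun_eqI, rule inner_right_eqI)
  fix x y :: 'a
  have one: "(\<lambda>_. 1) \<in> borel_measurable borel" "\<bar>1 :: real\<bar> \<le> 1" by auto
  have ind: "indicator S \<in> borel_measurable borel" "\<bar>indicat_real S t\<bar> \<le> 1" for t
    using S by (auto simp: indicator_def)
  obtain B where B: "\<And>p t. t \<in> {lo..hi} \<Longrightarrow> \<bar>poly p t\<bar> \<le> B p"
    using poly_bounded by metis
  have step1: "inner (op_eval A p x) (proj S y) = polar (\<lambda>t. indicator S t * poly p t) x y" for p
  proof -
    have "polar (\<lambda>t. indicator S t * 1) (op_eval A p x) y = polar (\<lambda>t. indicator S t * poly p t) x y"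
    proof (rule polar_density_eq[OF one poly_measurable B _ S])
      show "polar (\<lambda>t. poly q t * 1) (op_eval A p x) y = polar (\<lambda>t. poly q t * poly p t) x y" for q
      proof -
        have "(\<lambda>t. poly q t * poly p t) = poly (p * q)" by (simp add: fun_eq_iff mult.commute)
        then show ?thesis by (simp add: polar_poly op_eval_mult sym_eval)
      qed
    qed
    then show ?thesis by (simp add: inner_proj S)
  qed
  have "polar (\<lambda>t. indicator S' t * 1) x (proj S y) = polar (\<lambda>t. indicator S' t * indicator S t) x y"
  proof (rule polar_density_eq[OF one ind _ S'])
    show "polar (\<lambda>t. poly p t * 1) x (proj S y) = polar (\<lambda>t. poly p t * indicator S t) x y" for p
      using step1[of p] by (simp add: polar_poly sym_eval mult.commute)
  qed
  moreover have "(\<lambda>t. indicator S' t * indicator S t) = (indicator (S \<inter> S') :: real \<Rightarrow> real)"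
    by (auto simp: indicator_def)
  ultimately show "inner x ((proj S' o\<^sub>L proj S) y) = inner x (proj (S \<inter> S') y)"
    using S S' by (simp add: inner_proj)
qed

lemma proj_UNIV: "proj UNIV = id_blinfun"
proof (rule blinfun_eqI, rule inner_right_eqI)
  fix x y :: 'a
  have "indicat_real UNIV = poly 1" by (simp add: fun_eq_iff)
  then show "inner x (proj UNIV y) = inner x (id_blinfun y)"
    by (simp add: inner_proj polar_poly one_pCons del: poly_1 poly_pCons)
qed

lemma proj_Icc: "proj {lo..hi} = id_blinfun"
proof (rule blinfun_eqI, rule inner_right_eqI)
  fix x y :: 'a
  have "polar (indicat_real {lo..hi}) x y = polar (indicat_real UNIV) x y"
    by (simp only: polar_indicator mass_def Int_absorb Int_UNIV_left)
  then have "inner x (proj {lo..hi} y) = inner x (proj UNIV y)"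
    using inner_proj[of "{lo..hi}" x y] inner_proj[of UNIV x y] by simp
  then show "inner x (proj {lo..hi} y) = inner x (id_blinfun y)" by (simp add: proj_UNIV)
qed

lemma proj_norm: "S \<in> sets borel \<Longrightarrow> (norm (proj S x))\<^sup>2 = mass x S"
  using proj_mult[of S S]
  by (metis Int_absorb blinfun_apply_blinfun_compose inner_proj_diag power2_norm_eq_inner proj_sym)

lemma proj_diff:
  assumes "S \<in> sets borel" "T \<in> sets borel" "S \<subseteq> T"
  shows "proj (T - S) = proj T - proj S"
proof (rule blinfun_eqI, rule inner_right_eqI)
  fix x y :: 'a
  show "inner x (proj (T - S) y) = inner x ((proj T - proj S) y)"
    using assms
    by (simp add: inner_proj blinfun.diff_left inner_diff_right polar_indicator mass_diff field_simps)
qed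

lemma proj_empty: "proj {} = 0"
  using proj_diff[of "{}" "{}"] by simp

text \<open>
  Strong convergence, since \<open>\<bar>E(T) x\<bar>\<^sup>2 = \<langle>x, E(T) x\<rangle>\<close> tends to 0 when \<open>T\<close> decreases to the empty set.
\<close>

lemma proj_sums:
  fixes F :: "nat \<Rightarrow> real set"
  assumes F: "range F \<subseteq> sets borel" "disjoint_family F"
  shows "(\<lambda>n. proj (F n) x) sums proj (\<Union>n. F n) x"
proof -
  have Fm: "F n \<in> sets borel" for n using F by auto
  define U where "U n = (\<Union>k<n. F k)" for n
  have Um: "U n \<in> sets borel" for n unfolding U_def using Fm by auto
  have UU: "U n \<subseteq> (\<Union>n. F n)" for n unfolding U_def by auto
  have sum: "(\<Sum>k<n. proj (F k) x) = proj (U n) x" for n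
  proof (induction n)
    case 0
    then show ?case by (simp add: U_def proj_empty)
  next
    case (Suc n)
    have "F k \<inter> F n = {}" if "k < n" for k
      using F(2) that unfolding disjoint_family_on_def by auto
    then have "U (Suc n) - F n = U n" unfolding U_def lessThan_Suc by blast
    moreover have "F n \<subseteq> U (Suc n)" unfolding U_def by auto
    ultimately have "proj (U n) = proj (U (Suc n)) - proj (F n)"
      using proj_diff[OF Fm Um, of n "Suc n"] by simp
    then show ?case using Suc by (simp add: blinfun.diff_left)
  qed
  interpret finite_measure "vector_measure x" by (rule vector_measure(1))
  have dist: "(norm (proj (U n) x - proj (\<Union>n. F n) x))\<^sup>2 = mass x ((\<Union>n. F n) - U n)" for n
  proof -
    have "proj ((\<Union>n. F n) - U n) x = proj (\<Union>n. F n) x - proj (U n) x"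
      using proj_diff[OF Um _ UU, of n] Fm by (simp add: blinfun.diff_left)
    then show ?thesis
      using proj_norm[of "(\<Union>n. F n) - U n" x] Fm Um by (simp add: norm_minus_commute)
  qed
  have "(\<lambda>n. measure (vector_measure x) (((\<Union>n. F n) - U n) \<inter> {lo..hi})) \<longlonglongrightarrow>
     measure (vector_measure x) (\<Inter>n. ((\<Union>n. F n) - U n) \<inter> {lo..hi})"
  proof (rule finite_Lim_measure_decseq)
    show "range (\<lambda>n. ((\<Union>n. F n) - U n) \<inter> {lo..hi}) \<subseteq> sets (vector_measure x)"
      using Fm Um by (auto intro!: sets_vector_measure)
    show "decseq (\<lambda>n. ((\<Union>n. F n) - U n) \<inter> {lo..hi})"
      unfolding decseq_def U_def by (auto intro: less_le_trans)
  qed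
  moreover have "(\<Inter>n. ((\<Union>n. F n) - U n) \<inter> {lo..hi}) = {}"
    unfolding U_def by (auto intro: lessI)
  ultimately have "(\<lambda>n. (norm (proj (U n) x - proj (\<Union>n. F n) x))\<^sup>2) \<longlonglongrightarrow> 0"
    by (simp add: dist mass_def)
  then have "(\<lambda>n. norm (proj (U n) x - proj (\<Union>n. F n) x)) \<longlonglongrightarrow> 0"
    using tendsto_real_sqrt[of "\<lambda>n. (norm (proj (U n) x - proj (\<Union>n. F n) x))\<^sup>2" 0 sequentially] by simp
  then show ?thesis
    unfolding sums_def sum by (simp add: tendsto_norm_zero_iff LIM_zero_iff)
qed

text \<open>
  An isometry commuting with \<open>A\<close> leaves the measures \<open>\<langle>x, E(dt) x\<rangle>\<close> invariant, by uniqueness.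
\<close>

lemma proj_commute_isometry:
  fixes J :: "'a \<Rightarrow> 'a"
  assumes J: "\<And>x y. inner (J x) (J y) = inner x y" "\<And>x. J (A x) = A (J x)"
    "linear J" "surj J" and S: "S \<in> sets borel"
  shows "proj S (J y) = J (proj S y)"
proof (rule inner_right_eqI)
  fix x
  obtain z where x: "x = J z" using J(4) by (metis surjD)
  have JE: "J (op_eval A p v) = op_eval A p (J v)" for p v
    by (induction p arbitrary: v)
       (simp_all add: linear_0[OF J(3)] linear_add[OF J(3)] linear_scale[OF J(3)] J(2) blinfun.add_left blinfun.scaleR_left)
  have "mass (J v) S = mass v S" for v
    using quadratic_combination_zero[OF _ S, of "[(1, J v), (-1, v)]"] by (simp add: J(1) flip: JE)
  then have "polar (indicat_real S) (J z) (J y) = polar (indicat_real S) z y"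
    by (simp add: polar_indicator linear_add[OF J(3), symmetric] linear_diff[OF J(3), symmetric])
  then show "inner x (proj S (J y)) = inner x (J (proj S y))"
    by (simp add: x inner_proj S J(1))
qed

end

interpretation blinfun_comp: bounded_bilinear "(o\<^sub>L)"
  by (rule bounded_bilinear_blinfun_compose)

section \<open>The complex inner product\<close>

lemma cinner_add_left: "cinner (x + y) z = cinner x z + cinner y (z :: 'a::chilbert_space)"
  by (metis cinner_add_right cinner_commute complex_cnj_add)

lemma cinner_scaleC_left: "cinner (c *\<^sub>C x) (z :: 'a::chilbert_space) = cnj c * cinner x z"
  by (metis cinner_scaleC_right cinner_commute complex_cnj_mult)

lemma cinner_scaleR_right: "cinner x (r *\<^sub>R y) = of_real r * cinner x (y :: 'a::chilbert_space)"
  by (metis cinner_scaleC_right scaleC_of_real)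

lemma cinner_scaleR_left: "cinner (r *\<^sub>R x) y = of_real r * cinner x (y :: 'a::chilbert_space)"
  by (metis cinner_commute cinner_scaleR_right complex_cnj_complex_of_real complex_cnj_mult)

lemma cinner_zero_right [simp]: "cinner x (0 :: 'a::chilbert_space) = 0"
  using cinner_scaleR_right[of x 0 x] by simp

lemma cinner_zero_left [simp]: "cinner (0 :: 'a::chilbert_space) x = 0"
  by (metis cinner_commute cinner_zero_right complex_cnj_zero)

lemma cinner_minus_right: "cinner x (- y) = - cinner x (y :: 'a::chilbert_space)"
  using cinner_scaleR_right[of x "-1" y] by simp

lemma cinner_diff_right: "cinner x (y - z) = cinner x y - cinner x (z :: 'a::chilbert_space)"
  using cinner_add_right[of x y "- z"] by (simp add: cinner_minus_right)

lemma cinner_diff_left: "cinner (x - y) z = cinner x z - cinner y (z :: 'a::chilbert_space)"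
  by (metis cinner_commute cinner_diff_right complex_cnj_diff)

lemma cinner_sum_right: "cinner x (\<Sum>i\<in>I. f i) = (\<Sum>i\<in>I. cinner x (f i :: 'a::chilbert_space))"
  by (induction I rule: infinite_finite_induct) (simp_all add: cinner_add_right)

lemma cinner_sum_left: "cinner (\<Sum>i\<in>I. f i) x = (\<Sum>i\<in>I. cinner (f i :: 'a::chilbert_space) x)"
  by (induction I rule: infinite_finite_induct) (simp_all add: cinner_add_left)

lemma Im_cinner: "Im (cinner x y) = inner (\<i> *\<^sub>C x) (y :: 'a::chilbert_space)"
  by (simp add: Re_cinner[symmetric] cinner_scaleC_left)

lemma cinner_self: "cinner x x = complex_of_real ((norm (x :: 'a::chilbert_space))\<^sup>2)"
proof (rule complex_eqI)
  show "Im (cinner x x) = Im (complex_of_real ((norm x)\<^sup>2))"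
    using arg_cong[OF cinner_commute[of x x], of Im] by simp
qed (simp add: Re_cinner power2_norm_eq_inner)

lemma inner_scaleC_i: "inner (\<i> *\<^sub>C x) (\<i> *\<^sub>C y) = inner x (y :: 'a::chilbert_space)"
  by (simp add: Re_cinner[symmetric] cinner_scaleC_left cinner_scaleC_right)

lemma scaleC_decompose: "z *\<^sub>C x = Re z *\<^sub>R x + Im z *\<^sub>R (\<i> *\<^sub>C (x :: 'a::chilbert_space))"
proof -
  have "z *\<^sub>C x = (complex_of_real (Re z) + complex_of_real (Im z) * \<i>) *\<^sub>C x"
    using complex_eq[of z] by (simp add: mult.commute)
  then show ?thesis by (simp only: scaleC_add_left scaleC_scaleC[symmetric] scaleC_of_real)
qed

lemma clinear_opI_i:
  fixes A :: "'a::chilbert_space bop"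
  assumes "\<And>x. A (\<i> *\<^sub>C x) = \<i> *\<^sub>C A x"
  shows "clinear_op A"
  unfolding clinear_op_def
  by (subst (1 2) scaleC_decompose) (simp add: blinfun.add_right blinfun.scaleR_right assms)

text \<open>
  The imaginary part of \<open>\<langle>x, y\<rangle>\<close> is the real inner product of \<open>\<i> x\<close> and \<open>y\<close>, so for complex linear operators symmetry
  for the real inner product is enough.
\<close>

lemma selfadjoint_op_iff_inner:
  "selfadjoint_op A \<longleftrightarrow> clinear_op A \<and> (\<forall>x y. inner (A x) y = inner x (A y))"
proof
  assume "selfadjoint_op A"
  then show "clinear_op A \<and> (\<forall>x y. inner (A x) y = inner x (A y))"
    by (simp add: selfadjoint_op_def flip: Re_cinner)
next
  assume A: "clinear_op A \<and> (\<forall>x y. inner (A x) y = inner x (A y))"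
  have "cinner (A x) y = cinner x (A y)" for x y
  proof (rule complex_eqI)
    show "Im (cinner (A x) y) = Im (cinner x (A y))"
    proof -
      have "\<i> *\<^sub>C A x = A (\<i> *\<^sub>C x)" using A by (simp add: clinear_op_def)
      then show ?thesis using A by (simp add: Im_cinner)
    qed
  qed (use A in \<open>simp add: Re_cinner\<close>)
  then show "selfadjoint_op A" using A by (simp add: selfadjoint_op_def)
qed

section \<open>Existence of the spectral measure\<close>

lemma linear_scaleC: "linear (\<lambda>x :: 'a::chilbert_space. z *\<^sub>C x)"
  using bounded_linear_scaleC bounded_linear.linear by blast

text \<open>
  The projections of the real symmetric operator are complex linear because they commute with the isometry \<open>x \<mapsto> \<i> x\<close>.
\<close>

theorem spectral_measure_exists:
  fixes A :: "'a::chilbert_space bop"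
  assumes A: "selfadjoint_op A"
  shows "\<exists>E. is_spectral_measure A E"
proof -
  define r where "r = norm A + 1"
  have bd: "\<bar>inner x (A x)\<bar> \<le> r * inner x x" for x
  proof -
    have "\<bar>inner x (A x)\<bar> \<le> norm x * norm (A x)" by (rule Cauchy_Schwarz_ineq2)
    also have "\<dots> \<le> norm x * (norm A * norm x)" by (intro mult_left_mono norm_blinfun) auto
    also have "\<dots> = norm A * inner x x" by (simp add: power2_norm_eq_inner[symmetric] power2_eq_square)
    also have "\<dots> \<le> r * inner x x" by (intro mult_right_mono) (auto simp: r_def)
    finally show ?thesis .
  qed
  have Ai: "inner (A x) y = inner x (A y)" for x y using A selfadjoint_op_iff_inner by blast
  have Acl: "A (z *\<^sub>C x) = z *\<^sub>C A x" for z x using A by (simp add: selfadjoint_op_def clinear_op_def)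
  interpret symmetric_operator A "-r" r
  proof
    show "- r < r" using norm_ge_zero[of A] unfolding r_def by linarith
    fix x
    show "- r * inner x x \<le> inner x (A x)" "inner x (A x) \<le> r * inner x x" using bd[of x] by linarith+
  qed (rule Ai)
  have cl: "clinear_op (proj S)" if S: "S \<in> sets borel" for S
  proof (rule clinear_opI_i)
    fix x
    have "surj (\<lambda>x :: 'a. \<i> *\<^sub>C x)"
    proof (rule surjI)
      show "\<i> *\<^sub>C ((- \<i>) *\<^sub>C x) = x" for x :: 'a
        using scaleC_of_real[of 1 x] by (simp add: scaleC_scaleC)
    qed
    then show "proj S (\<i> *\<^sub>C x) = \<i> *\<^sub>C proj S x"
      by (rule proj_commute_isometry[OF inner_scaleC_i Acl[symmetric] linear_scaleC _ S])
  qed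
  have sa: "selfadjoint_op (proj S)" if "S \<in> sets borel" for S
    using cl[OF that] proj_sym[OF that] selfadjoint_op_iff_inner by blast
  have "projection_valued_measure proj"
    unfolding projection_valued_measure_def
    using sa proj_mult proj_UNIV proj_sums by simp
  moreover have "cinner x (A x) = complex_of_real (\<integral>t. t \<partial>diag_measure proj x)" for x
  proof -
    have id: "(\<lambda>t. t) \<in> measurable (vector_measure x) borel" by (intro measurable_vector_measure) simp
    have "diag_measure proj x = measure_of UNIV (sets borel) (emeasure (distr (vector_measure x) borel (\<lambda>t. t)))"
      unfolding diag_measure_def
    proof (rule measure_of_eq)
      fix S assume "S \<in> sigma_sets UNIV (sets (borel :: real measure))"
      then have S: "S \<in> sets borel" using sets.sigma_sets_eq[of "borel :: real measure"] by simp
      interpret finite_measure "vector_measure x" by (rule vector_measure(1))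
      show "ennreal (Re (cinner x (proj S x))) = emeasure (distr (vector_measure x) borel (\<lambda>t. t)) S"
        using S by (simp add: Re_cinner inner_proj_diag mass_def emeasure_distr[OF id] space_vector_measure
            emeasure_eq_measure)
    qed auto
    also have "\<dots> = distr (vector_measure x) borel (\<lambda>t. t)"
      using measure_of_of_measure[of "distr (vector_measure x) borel (\<lambda>t. t)"] by simp
    finally have "(\<integral>t. t \<partial>diag_measure proj x) = (\<integral>t. t \<partial>vector_measure x)"
      by (simp add: integral_distr[OF id])
    also have "\<dots> = inner x (A x)" using vector_measure(3)[of x 1] by simp
    finally show ?thesis
      using Ai[of x "\<i> *\<^sub>C x"] arg_cong[OF cinner_commute[of x "A x"], of Im]
      by (intro complex_eqI) (simp_all add: Re_cinner Im_cinner Acl inner_commute)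
  qed
  ultimately show ?thesis
    unfolding is_spectral_measure_def using proj_Icc by blast
qed

section \<open>Riemann-Stieltjes sums against a spectral measure\<close>

lemma interval_borel:
  fixes S :: "real set"
  assumes "is_interval S"
  shows "S \<in> sets borel"
proof -
  have "\<exists>u v. S = {} \<or> S = UNIV \<or> S = {..<v} \<or> S = {..v} \<or> S = {u<..} \<or> S = {u..} \<or>
     S = {u<..<v} \<or> S = {u<..v} \<or> S = {u..<v} \<or> S = {u..v}"
    by (rule interval_cases) (use assms in \<open>unfold is_interval_1, blast\<close>)
  then show ?thesis by (elim exE disjE) simp_all
qed

lemma continuous_op_pow: "continuous_on UNIV (\<lambda>T :: 'a::real_normed_vector bop. op_pow T k)"
  by (induction k) (auto intro!: continuous_intros blinfun_comp.continuous_on)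

text \<open>
  \<open>E\<close> is any spectral measure of \<open>A\<close>: the defining choice of a spectral measure says nothing about how it was constructed.
  The bounds on the numerical range replace the inclusion of the spectrum in \<open>[a,b]\<close>.
\<close>

locale spectral =
  fixes A :: "'a::chilbert_space bop" and E :: "real set \<Rightarrow> 'a bop" and a b :: real
  assumes A: "selfadjoint_op A" and E: "is_spectral_measure A E"
    and numerical_range: "a * inner x x \<le> inner x (A x)" "inner x (A x) \<le> b * inner x x"
begin

lemma A_sym: "inner (A x) y = inner x (A y)"
  using A selfadjoint_op_iff_inner by blast

lemma E_sym: "S \<in> sets borel \<Longrightarrow> inner (E S x) y = inner x (E S y)"
  using E selfadjoint_op_iff_inner unfolding is_spectral_measure_def projection_valued_measure_def by blast

lemma E_idem: "S \<in> sets borel \<Longrightarrow> E S o\<^sub>L E S = E S"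
  using E unfolding is_spectral_measure_def projection_valued_measure_def by blast

lemma E_UNIV: "E UNIV = id_blinfun"
  using E unfolding is_spectral_measure_def projection_valued_measure_def by blast

lemma E_sums:
  fixes F :: "nat \<Rightarrow> real set"
  shows "range F \<subseteq> sets borel \<Longrightarrow> disjoint_family F \<Longrightarrow> (\<lambda>n. E (F n) x) sums E (\<Union>n. F n) x"
  using E unfolding is_spectral_measure_def projection_valued_measure_def by blast

lemma E_idem_apply: "S \<in> sets borel \<Longrightarrow> E S (E S x) = E S x"
  using E_idem by (metis blinfun_apply_blinfun_compose)

lemma E_empty: "E {} = 0"
proof (rule blinfun_eqI)
  fix x
  have "(\<lambda>n::nat. E {} x) sums E (\<Union>n::nat. {}) x"
    by (rule E_sums[of "\<lambda>_. {}"]) (auto simp: disjoint_family_on_def)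
  then have "(\<lambda>n::nat. E {} x) \<longlonglongrightarrow> 0" using sums_summable summable_LIMSEQ_zero by blast
  then show "E {} x = blinfun_apply 0 x" by (simp add: LIMSEQ_const_iff)
qed

lemma E_Un:
  assumes "S \<in> sets borel" "T \<in> sets borel" "S \<inter> T = {}"
  shows "E (S \<union> T) = E S + E T"
proof (rule blinfun_eqI)
  fix x
  define F where "F n = (if n = 0 then S else if n = 1 then T else {})" for n :: nat
  have "(\<lambda>n. E (F n) x) sums E (\<Union>n. F n) x"
    by (rule E_sums) (use assms in \<open>auto simp: F_def disjoint_family_on_def\<close>)
  moreover have "(\<Union>n. F n) = S \<union> T"
    unfolding F_def by (auto split: if_splits intro: exI[of _ "0::nat"] exI[of _ "1::nat"])
  moreover have "(\<lambda>n. E (F n) x) sums (\<Sum>n\<in>{0,1}. E (F n) x)"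
    by (rule sums_finite) (auto simp: F_def E_empty)
  ultimately show "E (S \<union> T) x = (E S + E T) x"
    using sums_unique2 by (fastforce simp: F_def blinfun.add_left)
qed

lemma E_Union:
  assumes "finite P" "P \<subseteq> sets borel" "disjoint P"
  shows "E (\<Union>P) = (\<Sum>S\<in>P. E S)"
  using assms
proof (induction P rule: finite_induct)
  case (insert S P)
  have "\<Union>P \<in> sets borel" using insert by (intro sets.finite_Union) auto
  moreover have "S \<inter> \<Union>P = {}" using insert by (auto simp: pairwise_insert disjnt_def)
  ultimately show ?case using insert E_Un[of S "\<Union>P"] by (simp add: pairwise_insert)
qed (simp add: E_empty)

text \<open>
  Additivity makes \<open>E S + E T\<close> idempotent, hence \<open>E S E T + E T E S = 0\<close>; multiplication by \<open>E T\<close> from both sides leaves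
  \<open>2 E T E S E T = 0\<close>, and \<open>\<bar>E S E T x\<bar>\<^sup>2 = \<langle>x, E T E S E T x\<rangle>\<close>.
\<close>

lemma E_orthogonal:
  assumes S: "S \<in> sets borel" and T: "T \<in> sets borel" and disj: "S \<inter> T = {}"
  shows "E S (E T x) = 0"
proof -
  have eq: "E S (E T x) + E T (E S x) = 0" for x
  proof -
    have "(E S + E T) ((E S + E T) x) = (E S + E T) x"
      using E_idem_apply[of "S \<union> T" x] E_Un[OF assms] S T by simp
    then show ?thesis
      using E_idem_apply[OF S, of x] E_idem_apply[OF T, of x]
      by (simp add: blinfun.add_left blinfun.add_right algebra_simps)
  qed
  have "inner (E S (E T x)) (E S (E T x)) = inner (E S (E T x)) (E T x)"
    using E_sym[OF S, of "E S (E T x)" "E T x"] E_idem_apply[OF S, of "E T x"] by simp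
  also have "\<dots> = inner (E T (E S (E T x))) x" by (rule E_sym[OF T, symmetric])
  also have "E T (E S (E T x)) = 0"
  proof -
    have "E S (E T x) + E T (E S (E T x)) = 0" using eq[of "E T x"] E_idem_apply[OF T] by simp
    moreover have "E T (E S (E T x)) + E T (E S (E T x)) = 0"
      using arg_cong[OF calculation, of "E T"] E_idem_apply[OF T] by (simp add: blinfun.add_right)
    ultimately show ?thesis by (simp flip: scaleR_2)
  qed
  finally show ?thesis by simp
qed

abbreviation m where "m x \<equiv> diag_measure E x"

lemma emeasure_m:
  assumes S: "S \<in> sets borel"
  shows "emeasure (m x) S = ennreal (inner x (E S x))"
  unfolding diag_measure_def Re_cinner
proof (rule emeasure_measure_of_sigma)
  have nn: "inner x (E S x) \<ge> 0" if "S \<in> sets borel" for S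
    using E_sym[OF that, of x "E S x"] E_idem_apply[OF that, of x] by (metis inner_ge_zero)
  show "sigma_algebra UNIV (sets (borel :: real measure))"
    using sets.sigma_algebra_axioms[of "borel :: real measure"] by simp
  show "positive (sets borel) (\<lambda>S. ennreal (inner x (E S x)))"
    by (simp add: positive_def E_empty)
  show "countably_additive (sets borel) (\<lambda>S. ennreal (inner x (E S x)))"
  proof (rule countably_additiveI)
    fix F :: "nat \<Rightarrow> real set" assume F: "range F \<subseteq> sets borel" "disjoint_family F"
    have "(\<lambda>n. inner x (E (F n) x)) sums inner x (E (\<Union>n. F n) x)"
      by (intro bounded_linear.sums[OF bounded_linear_inner_right] E_sums F)
    moreover have "0 \<le> inner x (E (F n) x)" for n using F by (intro nn) auto
    ultimately show "(\<Sum>n. ennreal (inner x (E (F n) x))) = ennreal (inner x (E (\<Union>n. F n) x))"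
      by (intro suminf_ennreal_eq) auto
  qed
qed (rule S)

lemma space_m [simp]: "space (m x) = UNIV" and sets_m [simp, measurable_cong]: "sets (m x) = sets borel"
  by (simp_all add: diag_measure_def sets.sigma_sets_eq[of borel, simplified])

lemma finite_m: "finite_measure (m x)"
  by (rule finite_measureI) (simp add: emeasure_m)

lemma measure_m: "S \<in> sets borel \<Longrightarrow> measure (m x) S = inner x (E S x)"
  using emeasure_m[of S x] E_sym[of S x "E S x"] E_idem_apply[of S x]
  by (metis inner_ge_zero measure_eq_emeasure_eq_ennreal)

lemma AE_m_I:
  assumes S: "S \<in> sets borel" and "E S x = x"
  shows "AE t in m x. t \<in> S"
proof (rule AE_I')
  have "E (- S) x = E UNIV x - E S x"
    using E_Un[of S "- S"] S by (simp add: Compl_partition blinfun.add_left algebra_simps)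
  then show "- S \<in> null_sets (m x)"
    using assms by (intro null_setsI) (auto simp: emeasure_m E_UNIV)
qed auto

lemma integrable_m: "integrable (m x) (\<lambda>t. t)"
proof -
  obtain r where r: "E {-r..r} = id_blinfun" using E unfolding is_spectral_measure_def by blast
  have "AE t in m x. t \<in> {-r..r}" by (rule AE_m_I) (auto simp: r)
  then have "AE t in m x. norm t \<le> r" by eventually_elim auto
  then show ?thesis by (intro finite_measure.integrable_const_bound[OF finite_m, of _ r]) auto
qed

lemma integral_m: "(\<integral>t. t \<partial>m x) = inner x (A x)"
proof -
  have "cinner x (A x) = complex_of_real (\<integral>t. t \<partial>m x)"
    using E unfolding is_spectral_measure_def by blast
  then have "Re (cinner x (A x)) = (\<integral>t. t \<partial>m x)" by simp
  then show ?thesis by (simp add: Re_cinner)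
qed

text \<open>
  For \<open>y\<close> in the range of \<open>E {b<..}\<close> the integral of \<open>t - b > 0\<close> against \<open>\<langle>y, E(dt) y\<rangle>\<close> is \<open>\<langle>y, A y\<rangle> - b \<langle>y, y\<rangle> \<le> 0\<close>, so
  this measure is zero.
\<close>

lemma E_above: "E {b<..} = 0"
proof (rule blinfun_eqI)
  fix x
  define y where "y = E {b<..} x"
  interpret finite_measure "m y" by (rule finite_m)
  have y: "E {b<..} y = y" unfolding y_def by (rule E_idem_apply) auto
  have ae: "AE t in m y. t \<in> {b<..}" by (rule AE_m_I) (auto simp: y)
  have tot: "(\<integral>t. b \<partial>m y) = b * inner y y" using measure_m[of UNIV y] by (simp add: E_UNIV)
  have int: "integrable (m y) (\<lambda>t. t - b)" using integrable_m by simp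
  have "(\<integral>t. t - b \<partial>m y) = inner y (A y) - b * inner y y"
    using tot integral_m integrable_m by simp
  then have "(\<integral>t. t - b \<partial>m y) \<le> 0" using numerical_range[of y] by simp
  moreover have nn: "AE t in m y. 0 \<le> t - b" using ae by eventually_elim auto
  ultimately have "(\<integral>t. t - b \<partial>m y) = 0" using integral_nonneg_AE[OF nn] by linarith
  then have "AE t in m y. t - b = 0" using integral_nonneg_eq_0_iff_AE[OF int nn] by simp
  with ae have "AE t in m y. False" by eventually_elim auto
  then have "emeasure (m y) (space (m y)) = 0" by (simp add: AE_iff_measurable[OF sets.top])
  then have "inner y y = 0" using measure_m[of UNIV y] by (simp add: E_UNIV measure_def)
  then show "E {b<..} x = blinfun_apply 0 x" by (simp add: y_def)
qed

lemma E_below: "E {..<a} = 0"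
proof (rule blinfun_eqI)
  fix x
  define y where "y = E {..<a} x"
  interpret finite_measure "m y" by (rule finite_m)
  have y: "E {..<a} y = y" unfolding y_def by (rule E_idem_apply) auto
  have ae: "AE t in m y. t \<in> {..<a}" by (rule AE_m_I) (auto simp: y)
  have tot: "(\<integral>t. a \<partial>m y) = a * inner y y" using measure_m[of UNIV y] by (simp add: E_UNIV)
  have int: "integrable (m y) (\<lambda>t. a - t)" using integrable_m by simp
  have "(\<integral>t. a - t \<partial>m y) = a * inner y y - inner y (A y)"
    using tot integral_m integrable_m by simp
  then have "(\<integral>t. a - t \<partial>m y) \<le> 0" using numerical_range[of y] by simp
  moreover have nn: "AE t in m y. 0 \<le> a - t" using ae by eventually_elim auto
  ultimately have "(\<integral>t. a - t \<partial>m y) = 0" using integral_nonneg_AE[OF nn] by linarith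
  then have "AE t in m y. a - t = 0" using integral_nonneg_eq_0_iff_AE[OF int nn] by simp
  with ae have "AE t in m y. False" by eventually_elim auto
  then have "emeasure (m y) (space (m y)) = 0" by (simp add: AE_iff_measurable[OF sets.top])
  then have "inner y y = 0" using measure_m[of UNIV y] by (simp add: E_UNIV measure_def)
  then show "E {..<a} x = blinfun_apply 0 x" by (simp add: y_def)
qed

lemma E_Icc: "a \<le> b \<Longrightarrow> E {a..b} = id_blinfun"
proof -
  assume ab: "a \<le> b"
  have "UNIV = ({..<a} \<union> {a..b}) \<union> {b<..}" using ab by auto
  then have "id_blinfun = E (({..<a} \<union> {a..b}) \<union> {b<..})" using E_UNIV by simp
  also have "\<dots> = E ({..<a} \<union> {a..b}) + E {b<..}" using ab by (intro E_Un) auto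
  also have "E ({..<a} \<union> {a..b}) = E {..<a} + E {a..b}" by (intro E_Un) auto
  finally show ?thesis by (simp add: E_above E_below)
qed

text \<open>
  The step function \<open>\<Sum>\<^sub>D \<xi> D 1\<^sub>D\<close> differs from \<open>t\<close> by at most the mesh, so the Riemann-Stieltjes sum \<open>R\<close> differs from \<open>A\<close> by at most
  that in norm.  The sum formed with \<open>\<xi>\<^sup>k\<close> is the operator power \<open>R\<^sup>k\<close>, because the projections are orthogonal and add up
  to the identity.
\<close>

lemma step_sum_approx:
  assumes ab: "a \<le> b" and P: "finite P" "partition_on {a..b} P"
    and mesh: "\<And>D. D \<in> P \<Longrightarrow> is_interval D \<and> diameter D < \<delta> \<and> \<xi> D \<in> D"
  shows "norm ((\<Sum>D\<in>P. \<xi> D *\<^sub>R E D) - A) \<le> \<delta>"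
    and "(\<Sum>D\<in>P. \<xi> D ^ k *\<^sub>R E D) = op_pow (\<Sum>D\<in>P. \<xi> D *\<^sub>R E D) k"
proof -
  have Pb: "P \<subseteq> sets borel" using mesh interval_borel by blast
  have disj: "disjoint P" and UP: "\<Union>P = {a..b}" and ne: "{} \<notin> P"
    using P(2) by (auto simp: partition_on_def)
  let ?R = "\<Sum>D\<in>P. \<xi> D *\<^sub>R E D"
  have "a \<in> \<Union>P" using UP ab by auto
  then obtain D0 where D0: "D0 \<in> P" by blast
  have bdd: "bounded D" if "D \<in> P" for D
    using that UP bounded_closed_interval[of a b] by (metis Sup_upper bounded_subset)
  have \<delta>: "0 \<le> \<delta>" using mesh[OF D0] diameter_ge_0[OF bdd[OF D0]] by linarith
  have R_sym: "inner (?R x) y = inner x (?R y)" for x y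
    using Pb E_sym by (simp add: blinfun.sum_left blinfun.scaleR_left inner_sum_left inner_sum_right subset_iff)
  show "norm (?R - A) \<le> \<delta>"
  proof (rule norm_symmetric_le[OF _ \<delta>])
    show "inner ((?R - A) x) y = inner x ((?R - A) y)" for x y
      using R_sym A_sym by (simp add: blinfun.diff_left inner_diff_left inner_diff_right)
    fix x
    interpret finite_measure "m x" by (rule finite_m)
    let ?f = "\<lambda>t. \<Sum>D\<in>P. \<xi> D * indicator D t"
    have int: "integrable (m x) (\<lambda>t. \<xi> D * indicator D t)" if "D \<in> P" for D
      using that Pb by (intro integrable_mult_right integrable_real_indicator) (auto simp: emeasure_m)
    have "inner x (?R x) = (\<Sum>D\<in>P. \<xi> D * measure (m x) D)"
      using Pb by (auto simp: blinfun.sum_left blinfun.scaleR_left inner_sum_right measure_m subset_iff intro!: sum.cong)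
    also have "\<dots> = (\<integral>t. ?f t \<partial>m x)"
      using int by (subst Bochner_Integration.integral_sum) (auto intro!: sum.cong)
    finally have "inner x ((?R - A) x) = (\<integral>t. ?f t - t \<partial>m x)"
      using int integrable_m integral_m
      by (subst Bochner_Integration.integral_diff) (auto simp: blinfun.diff_left inner_diff_right)
    also have "\<bar>\<dots>\<bar> \<le> (\<integral>t. \<delta> \<partial>m x)"
    proof (rule order_trans[OF integral_abs_bound integral_mono_AE])
      have "AE t in m x. t \<in> {a..b}" using E_Icc[OF ab] by (intro AE_m_I) auto
      then show "AE t in m x. \<bar>?f t - t\<bar> \<le> \<delta>"
      proof eventually_elim
        case (elim t)
        then obtain D where D: "D \<in> P" "t \<in> D" using UP by blast
        have "?f t = (\<Sum>D'\<in>P. if D' = D then \<xi> D else 0)"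
        proof (rule sum.cong[OF refl])
          fix D' assume "D' \<in> P"
          then show "\<xi> D' * indicator D' t = (if D' = D then \<xi> D else 0)"
            using D disj by (auto simp: indicator_def pairwise_def disjnt_def)
        qed
        then have "?f t = \<xi> D" using P(1) D(1) by simp
        moreover have "\<bar>\<xi> D - t\<bar> \<le> diameter D"
          using diameter_bounded_bound[OF bdd[OF D(1)], of "\<xi> D" t] mesh[OF D(1)] D(2) by (simp add: dist_real_def)
        ultimately show ?case using mesh[OF D(1)] by simp
      qed
    qed (use int integrable_m in auto)
    also have "\<dots> = \<delta> * (norm x)\<^sup>2"
      using measure_m[of UNIV x] by (simp add: E_UNIV power2_norm_eq_inner)
    finally show "\<bar>inner x ((?R - A) x)\<bar> \<le> \<delta> * (norm x)\<^sup>2" .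
  qed
  show "(\<Sum>D\<in>P. \<xi> D ^ k *\<^sub>R E D) = op_pow ?R k"
  proof (induction k)
    case 0
    then show ?case using E_Union[OF P(1) Pb disj] UP E_Icc[OF ab] by simp
  next
    case (Suc k)
    have EE: "E D o\<^sub>L E D' = (if D' = D then E D else 0)" if "D \<in> P" "D' \<in> P" for D D'
    proof (cases "D' = D")
      case True
      then show ?thesis using E_idem that Pb by auto
    next
      case False
      then have "D \<inter> D' = {}" using disj that by (auto simp: pairwise_def disjnt_def)
      then have "E D (E D' x) = 0" for x using E_orthogonal that Pb by blast
      then show ?thesis using False by (auto intro!: blinfun_eqI)
    qed
    have "op_pow ?R (Suc k) = (\<Sum>D\<in>P. \<Sum>D'\<in>P. (\<xi> D * \<xi> D' ^ k) *\<^sub>R (E D o\<^sub>L E D'))"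
      by (simp only: op_pow.simps Suc[symmetric] blinfun_comp.sum_left)
         (simp add: blinfun_comp.sum_right blinfun_comp.scaleR_left blinfun_comp.scaleR_right scaleR_sum_right
           mult.commute)
    also have "\<dots> = (\<Sum>D\<in>P. \<Sum>D'\<in>P. if D' = D then \<xi> D ^ Suc k *\<^sub>R E D else 0)"
      by (intro sum.cong refl) (auto simp: EE)
    finally show ?case using P(1) by simp
  qed
qed

text \<open>
  The sums are \<open>R\<^sup>k\<close> with \<open>R\<close> close to \<open>A\<close> in norm, and \<open>T \<mapsto> T\<^sup>k\<close> is norm continuous.
\<close>

lemma has_RS_integral_power:
  assumes ab: "a \<le> b"
  shows "has_RS_integral (\<lambda>\<alpha>. \<alpha> ^ k *\<^sub>R id_blinfun) E a b (op_pow A k)"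
  unfolding has_RS_integral_def
proof (intro allI impI)
  fix e :: real assume e: "e > 0"
  have "isCont (\<lambda>T. op_pow T k) A" using continuous_op_pow[where k = k and 'a = 'a] by (simp add: continuous_on_eq_continuous_at)
  then obtain d where d: "d > 0" and dd: "\<And>T. dist T A < d \<Longrightarrow> dist (op_pow T k) (op_pow A k) < e"
    using e unfolding continuous_at_eps_delta by blast
  show "\<exists>\<delta>>0. \<forall>P \<xi>. finite P \<and> partition_on {a..b} P \<and>
        (\<forall>\<Delta>\<in>P. is_interval \<Delta> \<and> diameter \<Delta> < \<delta> \<and> \<xi> \<Delta> \<in> \<Delta>) \<longrightarrow>
        norm ((\<Sum>\<Delta>\<in>P. \<xi> \<Delta> ^ k *\<^sub>R id_blinfun o\<^sub>L E \<Delta>) - op_pow A k) < e"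
  proof (intro exI[of _ "d / 2"] conjI allI impI)
    fix P and \<xi> :: "real set \<Rightarrow> real"
    assume P: "finite P \<and> partition_on {a..b} P \<and>
        (\<forall>\<Delta>\<in>P. is_interval \<Delta> \<and> diameter \<Delta> < d / 2 \<and> \<xi> \<Delta> \<in> \<Delta>)"
    have eq: "(\<Sum>\<Delta>\<in>P. \<xi> \<Delta> ^ k *\<^sub>R id_blinfun o\<^sub>L E \<Delta>) = op_pow (\<Sum>D\<in>P. \<xi> D *\<^sub>R E D) k"
      using step_sum_approx(2)[OF ab, of P "d / 2" \<xi> k] P by (simp add: blinfun_comp.scaleR_left)
    have "norm ((\<Sum>D\<in>P. \<xi> D *\<^sub>R E D) - A) \<le> d / 2"
      using step_sum_approx(1)[OF ab, of P "d / 2" \<xi>] P by blast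
    then have "dist (\<Sum>D\<in>P. \<xi> D *\<^sub>R E D) A < d" using d by (simp add: dist_norm)
    then show "norm ((\<Sum>\<Delta>\<in>P. \<xi> \<Delta> ^ k *\<^sub>R id_blinfun o\<^sub>L E \<Delta>) - op_pow A k) < e"
      using dd unfolding eq by (simp add: dist_norm)
  qed (use d in simp)
qed

end

section \<open>Numerical range and spectrum\<close>

text \<open>
  The Cauchy-Schwarz inequality for the form \<open>\<langle>x, T y\<rangle>\<close>, taken with \<open>y = T x\<close>, gives \<open>\<bar>T x\<bar>\<^sup>2 \<le> \<bar>T\<bar> \<langle>x, T x\<rangle>\<close>; and \<open>\<bar>x\<bar> \<le> \<bar>R\<bar> \<bar>T x\<bar>\<close>.
\<close>

lemma positive_invertible_lower_bound:
  fixes T R :: "'a::real_inner bop"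
  assumes sym: "\<And>x y. inner (T x) y = inner x (T y)" and pos: "\<And>x. 0 \<le> inner x (T x)"
    and inv: "R o\<^sub>L T = id_blinfun"
  shows "\<exists>c>0. \<forall>x. c * inner x x \<le> inner x (T x)"
proof -
  interpret form_space "UNIV :: 'a set" "\<lambda>x y. inner x (T y)"
  proof
    show "inner x (T y) = inner y (T x)" for x y using sym[of x y] by (simp add: inner_commute)
  qed (auto simp: inner_add_left pos)
  \<comment> \<open>The summand 1 keeps the denominator positive on the zero space.\<close>
  define c where "c = 1 / ((norm R)\<^sup>2 * norm T + 1)"
  have c: "c > 0" unfolding c_def by (intro divide_pos_pos add_nonneg_pos mult_nonneg_nonneg) auto
  have "c * inner x x \<le> inner x (T x)" for x
  proof -
    have "(inner (T x) (T x))\<^sup>2 \<le> inner x (T x) * inner (T x) (T (T x))"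
      using q_Cauchy_Schwarz[of x "T x"] sym[of x "T x"] by simp
    also have "\<dots> \<le> inner x (T x) * (norm T * inner (T x) (T x))"
    proof (rule mult_left_mono[OF _ pos])
      have "inner (T x) (T (T x)) \<le> norm (T x) * norm (T (T x))" by (rule norm_cauchy_schwarz)
      also have "\<dots> \<le> norm (T x) * (norm T * norm (T x))" by (intro mult_left_mono norm_blinfun) auto
      finally show "inner (T x) (T (T x)) \<le> norm T * inner (T x) (T x)"
        by (simp add: power2_norm_eq_inner[symmetric] power2_eq_square ac_simps)
    qed
    finally have *: "inner (T x) (T x) * inner (T x) (T x) \<le> (norm T * inner x (T x)) * inner (T x) (T x)"
      by (simp add: power2_eq_square ac_simps)
    have Tx: "(norm (T x))\<^sup>2 \<le> norm T * inner x (T x)"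
    proof (cases "T x = 0")
      case False
      then have "0 < inner (T x) (T x)" by simp
      then show ?thesis using * by (simp add: power2_norm_eq_inner)
    qed (simp add: pos)
    have "R (T x) = x" using inv by (metis blinfun_apply_blinfun_compose blinfun_apply_id_blinfun)
    then have "norm x \<le> norm R * norm (T x)" by (metis norm_blinfun)
    then have "(norm x)\<^sup>2 \<le> (norm R)\<^sup>2 * (norm (T x))\<^sup>2"
      by (metis norm_ge_zero power_mono power_mult_distrib)
    also have "\<dots> \<le> (norm R)\<^sup>2 * (norm T * inner x (T x))" using Tx by (intro mult_left_mono) auto
    also have "\<dots> \<le> ((norm R)\<^sup>2 * norm T + 1) * inner x (T x)" using pos[of x] by (simp add: algebra_simps)
    finally have "inner x x \<le> inner x (T x) / c" by (simp add: power2_norm_eq_inner c_def mult.commute)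
    then show ?thesis using c by (simp add: pos_le_divide_eq mult.commute)
  qed
  then show ?thesis using c by blast
qed

lemma scalar_op_of_real: "scalar_op (complex_of_real r) = r *\<^sub>R id_blinfun"
  by (rule blinfun_eqI) (simp add: scalar_op.rep_eq scaleC_of_real blinfun.scaleR_left)

text \<open>
  The supremum \<open>M\<close> of the numerical range belongs to the spectrum: otherwise the positive operator \<open>M - A\<close> is invertible,
  hence bounded below by some \<open>c > 0\<close>, and \<open>M - c\<close> is a smaller upper bound.
\<close>

lemma numerical_range_upper:
  fixes A :: "'a::chilbert_space bop"
  assumes A: "selfadjoint_op A" and spec: "op_spectrum A \<subseteq> complex_of_real ` {a..b}"
  shows "inner x (A x) \<le> b * inner x x"
proof (rule ccontr)
  assume "\<not> inner x (A x) \<le> b * inner x x"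
  then have x: "b * inner x x < inner x (A x)" by simp
  have sym: "inner (A x) y = inner x (A y)" for x y using A selfadjoint_op_iff_inner by blast
  define U where "U = {M. \<forall>y. inner y (A y) \<le> M * inner y y}"
  have xx: "0 < inner x x" using x by (cases "x = 0") auto
  have lb: "inner x (A x) / inner x x \<le> M" if "M \<in> U" for M
    using that xx by (auto simp: U_def divide_le_eq)
  have bdd: "bdd_below U" using lb by (intro bdd_belowI) auto
  have "norm A \<in> U"
  proof -
    have "inner y (A y) \<le> norm A * inner y y" for y
    proof -
      have "inner y (A y) \<le> norm y * norm (A y)" by (rule norm_cauchy_schwarz)
      also have "\<dots> \<le> norm y * (norm A * norm y)" by (intro mult_left_mono norm_blinfun) auto
      finally show ?thesis by (simp add: power2_norm_eq_inner[symmetric] power2_eq_square ac_simps)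
    qed
    then show ?thesis by (simp add: U_def)
  qed
  then have ne: "U \<noteq> {}" by blast
  define M where "M = Inf U"
  have MU: "inner y (A y) \<le> M * inner y y" for y
  proof (cases "y = 0")
    case False
    then have "inner y (A y) / inner y y \<le> K" if "K \<in> U" for K
      using that by (auto simp: U_def divide_le_eq)
    then have "inner y (A y) / inner y y \<le> M" unfolding M_def by (intro cInf_greatest ne)
    then show ?thesis using False by (simp add: divide_le_eq)
  qed simp
  have "b < inner x (A x) / inner x x" using x xx by (simp add: less_divide_eq)
  also have "\<dots> \<le> M" unfolding M_def using lb by (intro cInf_greatest ne)
  finally have "complex_of_real M \<notin> op_spectrum A" using spec by auto
  then obtain R where R: "R o\<^sub>L (A - scalar_op (complex_of_real M)) = id_blinfun"
    unfolding op_spectrum_def by blast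
  define T where "T = M *\<^sub>R id_blinfun - A"
  have T: "T y = M *\<^sub>R y - A y" for y by (simp add: T_def blinfun.diff_left blinfun.scaleR_left)
  have "(- R) o\<^sub>L T = id_blinfun"
    using R by (simp add: T_def scalar_op_of_real blinfun_comp.minus_left blinfun_comp.diff_right)
  then obtain c where c: "c > 0" "\<And>y. c * inner y y \<le> inner y (T y)"
    using positive_invertible_lower_bound[of T "- R"] MU sym
    by (auto simp: T inner_diff_left inner_diff_right)
  then have "inner y (A y) \<le> (M - c) * inner y y" for y
    using c(2)[of y] by (simp add: T inner_diff_right algebra_simps)
  then have "M - c \<in> U" by (simp add: U_def)
  then have "M \<le> M - c" unfolding M_def by (intro cInf_lower bdd)
  then show False using c(1) by simp
qed

lemma numerical_range_lower:
  fixes A :: "'a::chilbert_space bop"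
  assumes A: "selfadjoint_op A" and spec: "op_spectrum A \<subseteq> complex_of_real ` {a..b}"
  shows "a * inner x x \<le> inner x (A x)"
proof -
  have neg: "scalar_op (- z) = - (scalar_op z :: 'a bop)" for z
  proof (rule blinfun_eqI)
    fix v :: 'a
    have "(- z) *\<^sub>C v + z *\<^sub>C v = 0"
      using scaleC_of_real[of 0 v] by (simp flip: scaleC_add_left)
    then show "scalar_op (- z) v = (- scalar_op z) v"
      by (simp add: scalar_op.rep_eq blinfun.minus_left eq_neg_iff_add_eq_0)
  qed
  have sa: "selfadjoint_op (- A)"
    using A unfolding selfadjoint_op_iff_inner
    by (auto simp: clinear_op_def blinfun.minus_left linear_neg[OF linear_scaleC])
  have "op_spectrum (- A) \<subseteq> complex_of_real ` {-b..-a}"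
  proof
    fix z assume z: "z \<in> op_spectrum (- A)"
    have "- z \<in> op_spectrum A"
    proof (rule ccontr)
      assume "- z \<notin> op_spectrum A"
      then obtain R where R: "(A - scalar_op (- z)) o\<^sub>L R = id_blinfun" "R o\<^sub>L (A - scalar_op (- z)) = id_blinfun"
        unfolding op_spectrum_def by blast
      have eq: "- A - scalar_op z = - (A - scalar_op (- z))" by (simp add: neg)
      have "(- A - scalar_op z) o\<^sub>L (- R) = id_blinfun" "(- R) o\<^sub>L (- A - scalar_op z) = id_blinfun"
        unfolding eq using R by (simp_all only: blinfun_comp.minus_left blinfun_comp.minus_right minus_minus)
      then show False using z unfolding op_spectrum_def by blast
    qed
    then obtain r where r: "- z = complex_of_real r" "r \<in> {a..b}" using spec by blast
    have "z = - (- z)" by simp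
    also have "\<dots> = complex_of_real (- r)" unfolding r(1) by simp
    finally show "z \<in> complex_of_real ` {-b..-a}" using r(2) by (intro image_eqI) auto
  qed
  from numerical_range_upper[OF sa this, of x] show ?thesis by (simp add: blinfun.minus_left)
qed

section \<open>Riemann-Stieltjes integrals\<close>

definition fine_partition :: "real \<Rightarrow> real \<Rightarrow> real \<Rightarrow> real set set \<Rightarrow> (real set \<Rightarrow> real) \<Rightarrow> bool" where
  "fine_partition a b \<delta> P \<xi> \<longleftrightarrow> finite P \<and> partition_on {a..b} P \<and>
     (\<forall>\<Delta>\<in>P. is_interval \<Delta> \<and> diameter \<Delta> < \<delta> \<and> \<xi> \<Delta> \<in> \<Delta>)"

lemma fine_partition_mono: "fine_partition a b \<delta> P \<xi> \<Longrightarrow> \<delta> \<le> \<delta>' \<Longrightarrow> fine_partition a b \<delta>' P \<xi>"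
  unfolding fine_partition_def by force

text \<open>
  Cells of length \<open>\<delta>/2\<close>, so that their diameters are strictly less than \<open>\<delta>\<close>.
\<close>

lemma fine_partition_exists:
  assumes "0 < \<delta>"
  shows "\<exists>P \<xi>. fine_partition a b \<delta> P \<xi>"
proof -
  define cell where "cell k = {x \<in> {a..b}. \<lfloor>(x - a) / (\<delta> / 2)\<rfloor> = k}" for k :: int
  define N where "N = (\<lambda>x. \<lfloor>(x - a) / (\<delta> / 2)\<rfloor>) ` {a..b}"
  define P where "P = cell ` N"
  have "N \<subseteq> {0..\<lfloor>(b - a) / (\<delta> / 2)\<rfloor>}"
    unfolding N_def using assms by (auto intro!: floor_mono divide_right_mono simp: zero_le_floor)
  then have "finite P" unfolding P_def using finite_subset by blast
  moreover have "partition_on {a..b} P"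
    by (rule partition_onI) (auto simp: P_def N_def cell_def disjnt_def)
  moreover have "is_interval (cell k)" for k
    unfolding is_interval_1
  proof (intro ballI allI impI, elim conjE)
    fix x y z assume "x \<in> cell k" "y \<in> cell k" "x \<le> z" "z \<le> y"
    then have "\<lfloor>(x - a) / (\<delta> / 2)\<rfloor> \<le> \<lfloor>(z - a) / (\<delta> / 2)\<rfloor>" "\<lfloor>(z - a) / (\<delta> / 2)\<rfloor> \<le> \<lfloor>(y - a) / (\<delta> / 2)\<rfloor>"
      using assms by (auto intro!: floor_mono divide_right_mono)
    then show "z \<in> cell k" using \<open>x \<in> cell k\<close> \<open>y \<in> cell k\<close> \<open>x \<le> z\<close> \<open>z \<le> y\<close> by (auto simp: cell_def)
  qed
  moreover have "diameter (cell k) < \<delta>" for k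
  proof -
    have "norm (x - y) \<le> \<delta> / 2" if "x \<in> cell k" "y \<in> cell k" for x y
    proof -
      have "\<bar>(x - a) / (\<delta> / 2) - (y - a) / (\<delta> / 2)\<bar> \<le> 1"
        using that unfolding cell_def by (simp add: abs_le_iff) linarith
      moreover have "(x - a) / (\<delta> / 2) - (y - a) / (\<delta> / 2) = (x - y) / (\<delta> / 2)"
        by (simp add: diff_divide_distrib[symmetric])
      ultimately have "\<bar>x - y\<bar> / (\<delta> / 2) \<le> 1"
        using assms by (simp only: abs_divide)
      then show ?thesis using assms by (simp add: divide_le_eq)
    qed
    then have "diameter (cell k) \<le> \<delta> / 2" using assms by (intro diameter_le) auto
    then show ?thesis using assms by simp
  qed
  moreover have "(SOME x. x \<in> D) \<in> D" if "D \<in> P" for D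
  proof -
    have "D \<noteq> {}" using that by (auto simp: P_def N_def cell_def)
    then show ?thesis by (rule some_in_eq[THEN iffD2])
  qed
  ultimately have "fine_partition a b \<delta> P (\<lambda>D. SOME x. x \<in> D)"
    unfolding fine_partition_def by (auto simp: P_def)
  then show ?thesis by blast
qed

lemma has_RS_integral_fine:
  "has_RS_integral T W a b I \<longleftrightarrow>
    (\<forall>e>0. \<exists>\<delta>>0. \<forall>P \<xi>. fine_partition a b \<delta> P \<xi> \<longrightarrow> norm ((\<Sum>D\<in>P. T (\<xi> D) o\<^sub>L W D) - I) < e)"
  unfolding has_RS_integral_def fine_partition_def ..

lemma has_RS_integral_unique:
  assumes "has_RS_integral T W a b I" "has_RS_integral T W a b J"
  shows "I = J"
proof (rule ccontr)
  assume "I \<noteq> J"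
  then have e: "norm (I - J) / 2 > 0" by simp
  obtain d where d: "d > 0" "\<And>P \<xi>. fine_partition a b d P \<xi> \<Longrightarrow> norm ((\<Sum>D\<in>P. T (\<xi> D) o\<^sub>L W D) - I) < norm (I - J) / 2"
    using assms(1) e unfolding has_RS_integral_fine by blast
  obtain d' where d': "d' > 0" "\<And>P \<xi>. fine_partition a b d' P \<xi> \<Longrightarrow> norm ((\<Sum>D\<in>P. T (\<xi> D) o\<^sub>L W D) - J) < norm (I - J) / 2"
    using assms(2) e unfolding has_RS_integral_fine by blast
  obtain P \<xi> where P: "fine_partition a b (min d d') P \<xi>"
    using fine_partition_exists[of "min d d'" a b] d(1) d'(1) by (metis min_less_iff_conj)
  let ?S = "\<Sum>D\<in>P. T (\<xi> D) o\<^sub>L W D"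
  have "norm (?S - I) < norm (I - J) / 2" "norm (?S - J) < norm (I - J) / 2"
    using d(2) d'(2) fine_partition_mono[OF P] by auto
  moreover have "norm (I - J) \<le> norm (?S - I) + norm (?S - J)"
    using norm_triangle_ineq4[of "?S - J" "?S - I"] by simp
  ultimately show False by linarith
qed

text \<open>
  The hypothesis \<open>eq\<close> covers additivity in the integrand as well as in the integrator.
\<close>

lemma has_RS_integral_add:
  assumes 1: "has_RS_integral T1 W1 a b I1" and 2: "has_RS_integral T2 W2 a b I2"
    and eq: "\<And>x D. T x o\<^sub>L W D = (T1 x o\<^sub>L W1 D) + (T2 x o\<^sub>L W2 D)"
  shows "has_RS_integral T W a b (I1 + I2)"
  unfolding has_RS_integral_fine
proof (intro allI impI)
  fix e :: real assume "e > 0"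
  then have e: "e / 2 > 0" by simp
  obtain d where d: "d > 0" "\<And>P \<xi>. fine_partition a b d P \<xi> \<Longrightarrow> norm ((\<Sum>D\<in>P. T1 (\<xi> D) o\<^sub>L W1 D) - I1) < e / 2"
    using 1 e unfolding has_RS_integral_fine by blast
  obtain d' where d': "d' > 0" "\<And>P \<xi>. fine_partition a b d' P \<xi> \<Longrightarrow> norm ((\<Sum>D\<in>P. T2 (\<xi> D) o\<^sub>L W2 D) - I2) < e / 2"
    using 2 e unfolding has_RS_integral_fine by blast
  show "\<exists>\<delta>>0. \<forall>P \<xi>. fine_partition a b \<delta> P \<xi> \<longrightarrow> norm ((\<Sum>D\<in>P. T (\<xi> D) o\<^sub>L W D) - (I1 + I2)) < e"
  proof (intro exI[of _ "min d d'"] conjI allI impI)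
    fix P \<xi> assume P: "fine_partition a b (min d d') P \<xi>"
    have "(\<Sum>D\<in>P. T (\<xi> D) o\<^sub>L W D) - (I1 + I2)
      = ((\<Sum>D\<in>P. T1 (\<xi> D) o\<^sub>L W1 D) - I1) + ((\<Sum>D\<in>P. T2 (\<xi> D) o\<^sub>L W2 D) - I2)"
      by (simp add: eq sum.distrib)
    also have "norm \<dots> < e / 2 + e / 2"
      using d(2) d'(2) fine_partition_mono[OF P] by (intro order_le_less_trans[OF norm_triangle_ineq] add_strict_mono) auto
    finally show "norm ((\<Sum>D\<in>P. T (\<xi> D) o\<^sub>L W D) - (I1 + I2)) < e" by simp
  qed (use d d' in simp)
qed

lemma has_RS_integral_compose:
  assumes 1: "has_RS_integral T W a b I"
  shows "has_RS_integral (\<lambda>x. C o\<^sub>L T x) W a b (C o\<^sub>L I)"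
  unfolding has_RS_integral_fine
proof (intro allI impI)
  fix e :: real assume "e > 0"
  then have e: "e / (norm C + 1) > 0" by (intro divide_pos_pos add_nonneg_pos) auto
  obtain d where d: "d > 0" "\<And>P \<xi>. fine_partition a b d P \<xi> \<Longrightarrow> norm ((\<Sum>D\<in>P. T (\<xi> D) o\<^sub>L W D) - I) < e / (norm C + 1)"
    using 1 e unfolding has_RS_integral_fine by blast
  show "\<exists>\<delta>>0. \<forall>P \<xi>. fine_partition a b \<delta> P \<xi> \<longrightarrow> norm ((\<Sum>D\<in>P. (C o\<^sub>L T (\<xi> D)) o\<^sub>L W D) - (C o\<^sub>L I)) < e"
  proof (intro exI[of _ d] conjI allI impI)
    fix P \<xi> assume P: "fine_partition a b d P \<xi>"
    have "(\<Sum>D\<in>P. (C o\<^sub>L T (\<xi> D)) o\<^sub>L W D) - (C o\<^sub>L I) = C o\<^sub>L ((\<Sum>D\<in>P. T (\<xi> D) o\<^sub>L W D) - I)"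
      by (simp add: blinfun_compose_assoc blinfun_comp.sum_right blinfun_comp.diff_right)
    also have "norm \<dots> \<le> norm C * norm ((\<Sum>D\<in>P. T (\<xi> D) o\<^sub>L W D) - I)" by (rule norm_blinfun_compose)
    also have "\<dots> \<le> (norm C + 1) * norm ((\<Sum>D\<in>P. T (\<xi> D) o\<^sub>L W D) - I)" by (intro mult_right_mono) auto
    also have "\<dots> < (norm C + 1) * (e / (norm C + 1))"
      using d(2)[OF P] by (intro mult_strict_left_mono add_nonneg_pos) auto
    also have "\<dots> = e" using norm_ge_zero[of C] by (simp add: add_nonneg_eq_0_iff)
    finally show "norm ((\<Sum>D\<in>P. (C o\<^sub>L T (\<xi> D)) o\<^sub>L W D) - (C o\<^sub>L I)) < e" .
  qed (use d in simp)
qed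

lemma has_RS_integral_zero: "has_RS_integral (\<lambda>_. 0) W a b 0"
  unfolding has_RS_integral_fine by (auto intro!: exI[of _ 1])

lemma has_RS_integral_sum:
  assumes "finite K" "\<And>k. k \<in> K \<Longrightarrow> has_RS_integral (T k) W a b (I k)"
  shows "has_RS_integral (\<lambda>x. \<Sum>k\<in>K. T k x) W a b (\<Sum>k\<in>K. I k)"
  using assms
proof (induction K rule: finite_induct)
  case (insert k K)
  have "has_RS_integral (\<lambda>x. \<Sum>k\<in>insert k K. T k x) W a b (I k + (\<Sum>k\<in>K. I k))"
    by (rule has_RS_integral_add[of "T k" W _ _ _ "\<lambda>x. \<Sum>k\<in>K. T k x" W])
       (use insert in \<open>auto simp: blinfun_comp.add_left\<close>)
  then show ?case using insert by simp
qed (simp add: has_RS_integral_zero)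

lemma has_op_integral_unique: "has_op_integral a b A B F I \<Longrightarrow> op_integral a b A B F = I"
  unfolding op_integral_def has_op_integral_def using has_RS_integral_unique by blast

definition spectrum_in :: "'a::chilbert_space bop \<Rightarrow> real \<Rightarrow> real \<Rightarrow> bool" where
  "spectrum_in A a b \<longleftrightarrow> selfadjoint_op A \<and> op_spectrum A \<subseteq> complex_of_real ` {a..b}"

lemma spectral_spectral_measure:
  assumes "spectrum_in A a b"
  shows "spectral A (spectral_measure A) a b"
proof
  have A: "selfadjoint_op A" "op_spectrum A \<subseteq> complex_of_real ` {a..b}"
    using assms by (auto simp: spectrum_in_def)
  show "selfadjoint_op A" by fact
  show "is_spectral_measure A (spectral_measure A)"
    unfolding spectral_measure_def using someI_ex[OF spectral_measure_exists[OF A(1)]] .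
  show "a * inner x x \<le> inner x (A x)" "inner x (A x) \<le> b * inner x x" for x
    using numerical_range_lower[OF A] numerical_range_upper[OF A] by auto
qed

text \<open>
  Subtracting the constant \<open>a\<^sup>k\<close> does not change the integral, as both spectral measures have total mass 1.
\<close>

lemma has_RS_integral_power_diff:
  assumes ab: "a \<le> b" and A: "spectrum_in A a b" and B: "spectrum_in B a b"
  shows "has_RS_integral (\<lambda>\<alpha>. (\<alpha> ^ k - a ^ k) *\<^sub>R C)
     (\<lambda>\<Delta>. spectral_measure B \<Delta> - spectral_measure A \<Delta>) a b (C o\<^sub>L (op_pow B k - op_pow A k))"
proof -
  let ?W = "\<lambda>\<Delta>. spectral_measure B \<Delta> - spectral_measure A \<Delta>"
  note rA = spectral.has_RS_integral_power[OF spectral_spectral_measure[OF A] ab]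
  note rB = spectral.has_RS_integral_power[OF spectral_spectral_measure[OF B] ab]
  have pw: "has_RS_integral (\<lambda>\<alpha>. \<alpha> ^ k *\<^sub>R id_blinfun) ?W a b (op_pow B k + ((-1) *\<^sub>R id_blinfun o\<^sub>L op_pow A k))" for k
    by (rule has_RS_integral_add[OF rB has_RS_integral_compose[OF rA]])
       (simp add: blinfun_comp.scaleR_left blinfun_comp.diff_right blinfun_comp.minus_left scaleR_diff_right)
  have "has_RS_integral (\<lambda>\<alpha>. (\<alpha> ^ k - a ^ k) *\<^sub>R id_blinfun) ?W a b
     ((op_pow B k + ((-1) *\<^sub>R id_blinfun o\<^sub>L op_pow A k)) +
       ((- (a ^ k)) *\<^sub>R id_blinfun o\<^sub>L (op_pow B 0 + ((-1) *\<^sub>R id_blinfun o\<^sub>L op_pow A 0))))"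
    by (rule has_RS_integral_add[OF pw has_RS_integral_compose[OF pw]])
       (simp add: blinfun_comp.scaleR_left blinfun_comp.diff_left blinfun_comp.minus_left scaleR_diff_left)
  from has_RS_integral_compose[OF this, of C] show ?thesis
    by (simp add: blinfun_comp.scaleR_left blinfun_comp.scaleR_right blinfun_comp.diff_right
        blinfun_comp.minus_left blinfun_comp.minus_right)
qed

lemma integral_power_scaleR:
  fixes C :: "'b::banach"
  assumes "a \<le> (x::real)"
  shows "((\<lambda>t. t ^ k *\<^sub>R C) has_integral ((x ^ Suc k - a ^ Suc k) / real (Suc k)) *\<^sub>R C) {a..x}"
proof -
  have "((\<lambda>t::real. t ^ k) has_integral (x ^ Suc k / real (Suc k) - a ^ Suc k / real (Suc k))) {a..x}"
  proof (rule fundamental_theorem_of_calculus[OF assms])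
    show "((\<lambda>s. s ^ Suc k / real (Suc k)) has_vector_derivative s ^ k) (at s within {a..x})" for s :: real
      using DERIV_cdivide[OF DERIV_pow[of "Suc k" s "{a..x}"], of "real (Suc k)"]
      by (simp add: has_real_derivative_iff_has_vector_derivative del: of_nat_Suc power_Suc)
  qed
  from has_integral_scaleR_left[OF this, of C] show ?thesis by (simp add: diff_divide_distrib)
qed

text \<open>
  Termwise, \<open>x\<^sup>k C\<close> has the primitive \<open>(\<alpha>\<^sup>k\<^sup>+\<^sup>1 - a\<^sup>k\<^sup>+\<^sup>1) C / (k + 1)\<close>, whose integral against \<open>E\<^sub>B - E\<^sub>A\<close> is
  \<open>C (B\<^sup>k\<^sup>+\<^sup>1 - A\<^sup>k\<^sup>+\<^sup>1) / (k + 1)\<close>.  The index set is arbitrary so that the bidegrees of a polynomial in two variables can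
  serve as indices.
\<close>

theorem has_op_integral_polynomial:
  fixes A B :: "'a::chilbert_space bop"
  assumes ab: "a \<le> b" and A: "spectrum_in A a b" and B: "spectrum_in B a b" and K: "finite K"
    and F: "\<And>x. F x = (\<Sum>k\<in>K. x ^ e k *\<^sub>R C k)"
  shows "has_op_integral a b A B F
    (\<Sum>k\<in>K. (1 / real (Suc (e k))) *\<^sub>R (C k o\<^sub>L (op_pow B (Suc (e k)) - op_pow A (Suc (e k)))))"
proof -
  have int: "(F has_integral (\<Sum>k\<in>K. ((x ^ Suc (e k) - a ^ Suc (e k)) / real (Suc (e k))) *\<^sub>R C k)) {a..x}"
    if "a \<le> x" for x
    unfolding F by (intro has_integral_sum K integral_power_scaleR that)
  let ?W = "\<lambda>\<Delta>. spectral_measure B \<Delta> - spectral_measure A \<Delta>"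
  have "has_RS_integral (\<lambda>x. \<Sum>k\<in>K. (x ^ Suc (e k) - a ^ Suc (e k)) *\<^sub>R ((1 / real (Suc (e k))) *\<^sub>R C k)) ?W a b
    (\<Sum>k\<in>K. ((1 / real (Suc (e k))) *\<^sub>R C k) o\<^sub>L (op_pow B (Suc (e k)) - op_pow A (Suc (e k))))"
    by (intro has_RS_integral_sum K has_RS_integral_power_diff[OF ab A B])
  then have RS: "has_RS_integral (\<lambda>x. \<Sum>k\<in>K. ((x ^ Suc (e k) - a ^ Suc (e k)) / real (Suc (e k))) *\<^sub>R C k) ?W a b
    (\<Sum>k\<in>K. (1 / real (Suc (e k))) *\<^sub>R (C k o\<^sub>L (op_pow B (Suc (e k)) - op_pow A (Suc (e k)))))" (is "has_RS_integral ?G _ _ _ ?I")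
    by (simp add: blinfun_comp.scaleR_left del: of_nat_Suc op_pow.simps power_Suc)
  have "has_RS_integral (\<lambda>\<alpha>. integral {a..\<alpha>} F) ?W a b ?I"
    unfolding has_RS_integral_fine
  proof (intro allI impI)
    fix \<epsilon> :: real assume "\<epsilon> > 0"
    then obtain \<delta> where \<delta>: "\<delta> > 0"
      "\<And>P \<xi>. fine_partition a b \<delta> P \<xi> \<Longrightarrow> norm ((\<Sum>D\<in>P. ?G (\<xi> D) o\<^sub>L ?W D) - ?I) < \<epsilon>"
      using RS unfolding has_RS_integral_fine by blast
    show "\<exists>\<delta>>0. \<forall>P \<xi>. fine_partition a b \<delta> P \<xi> \<longrightarrow>
       norm ((\<Sum>D\<in>P. integral {a..\<xi> D} F o\<^sub>L ?W D) - ?I) < \<epsilon>"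
    proof (intro exI[of _ \<delta>] conjI allI impI \<delta>(1))
      fix P \<xi> assume P: "fine_partition a b \<delta> P \<xi>"
      have "integral {a..\<xi> D} F = ?G (\<xi> D)" if "D \<in> P" for D
      proof -
        have "\<xi> D \<in> \<Union>P" using that P unfolding fine_partition_def by blast
        then have "a \<le> \<xi> D" using P unfolding fine_partition_def partition_on_def by auto
        then show ?thesis by (intro integral_unique int)
      qed
      then have "(\<Sum>D\<in>P. integral {a..\<xi> D} F o\<^sub>L ?W D) = (\<Sum>D\<in>P. ?G (\<xi> D) o\<^sub>L ?W D)"
        by (intro sum.cong refl) simp
      then show "norm ((\<Sum>D\<in>P. integral {a..\<xi> D} F o\<^sub>L ?W D) - ?I) < \<epsilon>"
        using \<delta>(2)[OF P] by simp
    qed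
  qed
  then show ?thesis
    unfolding has_op_integral_def using int[OF ab] has_integral_integrable by blast
qed

definition poly_degrees :: "nat \<Rightarrow> (nat \<times> nat) set" where
  "poly_degrees n = {(i, j). i + j \<le> n}"

lemma finite_poly_degrees: "finite (poly_degrees n)"
  by (rule finite_subset[of _ "{..n} \<times> {..n}"]) (auto simp: poly_degrees_def)

lemma op_pow_scaleR_id: "op_pow (x *\<^sub>R id_blinfun) k = x ^ k *\<^sub>R id_blinfun"
  by (induction k) (simp_all add: blinfun_comp.scaleR_left blinfun_comp.scaleR_right)

lemma op_poly2_left_eq:
  "op_poly2_left n c x C = (\<Sum>k\<in>poly_degrees n. x ^ fst k *\<^sub>R (scalar_op (c (fst k) (snd k)) o\<^sub>L op_pow C (snd k)))"
  unfolding op_poly2_left_def op_poly2_def poly_degrees_def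
  by (simp add: case_prod_unfold op_pow_scaleR_id blinfun_comp.scaleR_left blinfun_comp.scaleR_right)

lemma op_poly2_right_eq:
  "op_poly2_right n c C y = (\<Sum>k\<in>poly_degrees n. y ^ snd k *\<^sub>R (scalar_op (c (fst k) (snd k)) o\<^sub>L op_pow C (fst k)))"
  unfolding op_poly2_right_def op_poly2_def poly_degrees_def
  by (simp add: case_prod_unfold op_pow_scaleR_id blinfun_comp.scaleR_left blinfun_comp.scaleR_right)

section \<open>Orthonormal bases\<close>

lemma orthonormal_sum_norm:
  fixes B :: "'a::chilbert_space set"
  assumes B: "is_onb B" and F: "finite F" "F \<subseteq> B"
  shows "cinner (\<Sum>e\<in>F. c e *\<^sub>C e) (\<Sum>e\<in>F. d e *\<^sub>C e) = (\<Sum>e\<in>F. cnj (c e) * d e)"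
proof -
  have "cinner (\<Sum>e\<in>F. c e *\<^sub>C e) (\<Sum>e\<in>F. d e *\<^sub>C e)
    = (\<Sum>e\<in>F. \<Sum>f\<in>F. cnj (c e) * d f * (if e = f then 1 else 0))"
    unfolding cinner_sum_left cinner_sum_right
    using B F by (intro sum.cong refl) (auto simp: cinner_scaleC_left cinner_scaleC_right is_onb_def subset_iff)
  also have "\<dots> = (\<Sum>e\<in>F. cnj (c e) * d e)"
    using F(1) by (intro sum.cong refl) (simp add: if_distrib cong: if_cong)
  finally show ?thesis .
qed

lemma Bessel:
  fixes B :: "'a::chilbert_space set"
  assumes B: "is_onb B" and F: "finite F" "F \<subseteq> B"
  shows "(\<Sum>e\<in>F. (cmod (cinner e x))\<^sup>2) \<le> (norm x)\<^sup>2"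
proof -
  define u where "u = (\<Sum>e\<in>F. cinner e x *\<^sub>C e)"
  define s where "s = (\<Sum>e\<in>F. (cmod (cinner e x))\<^sup>2)"
  have uu: "cinner u u = complex_of_real s"
    unfolding u_def s_def orthonormal_sum_norm[OF assms]
    by (simp add: complex_norm_square mult.commute del: of_real_power)
  have ux: "cinner u x = complex_of_real s"
    unfolding u_def s_def cinner_sum_left
    by (simp add: cinner_scaleC_left complex_norm_square mult.commute del: of_real_power)
  have xu: "cinner x u = complex_of_real s" using ux cinner_commute[of x u] by simp
  have "cinner (x - u) (x - u) = cinner x x - complex_of_real s"
    by (simp add: cinner_diff_left cinner_diff_right uu ux xu)
  from arg_cong[OF this, of Re] have "(norm (x - u))\<^sup>2 = (norm x)\<^sup>2 - s"
    by (simp add: Re_cinner power2_norm_eq_inner)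
  then show ?thesis using zero_le_power2[of "norm (x - u)"] unfolding s_def by linarith
qed

lemma summable_on_norm_le:
  fixes f :: "'b \<Rightarrow> complex" and g :: "'b \<Rightarrow> real"
  assumes "g summable_on A" "\<And>x. cmod (f x) \<le> g x"
  shows "f summable_on A"
  by (rule abs_summable_summable, rule summable_on_comparison_test[OF assms(1)]) (simp_all add: assms(2))

lemma Bessel_summable:
  fixes B :: "'a::chilbert_space set"
  assumes B: "is_onb B"
  shows "(\<lambda>e. (cmod (cinner e x))\<^sup>2) summable_on B" "infsum (\<lambda>e. (cmod (cinner e x))\<^sup>2) B \<le> (norm x)\<^sup>2"
proof -
  show s: "(\<lambda>e. (cmod (cinner e x))\<^sup>2) summable_on B"
    using Bessel[OF B] by (intro nonneg_bdd_above_summable_on) (auto intro!: bdd_aboveI[of _ "(norm x)\<^sup>2"])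
  show "infsum (\<lambda>e. (cmod (cinner e x))\<^sup>2) B \<le> (norm x)\<^sup>2"
    by (rule infsum_le_finite_sums[OF s]) (use Bessel[OF B] in auto)
qed

lemma cmod_cinner_commute: "cmod (cinner x y) = cmod (cinner y (x :: 'a::chilbert_space))"
  by (subst cinner_commute) simp

lemma mult_cmod_le: "cmod (u * v) \<le> ((cmod u)\<^sup>2 + (cmod v)\<^sup>2) / 2"
  using sum_squares_bound[of "cmod u" "cmod v"] by (simp add: norm_mult)

text \<open>
  By Bessel's inequality the series converges to a bounded functional of \<open>y\<close>.  The vector representing it has the same
  Fourier coefficients as \<open>x\<close>, and a basis separates vectors.
\<close>

theorem Parseval:
  fixes B :: "'a::chilbert_space set"
  assumes B: "is_onb B"
  shows "((\<lambda>e. cinner x e * cinner e y) has_sum cinner x y) B"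
proof -
  define t where "t x y e = cinner x e * cinner e y" for x y e :: 'a
  \<comment> \<open>The dominating series comes from \<open>\<bar>u v\<bar> \<le> (\<bar>u\<bar>\<^sup>2 + \<bar>v\<bar>\<^sup>2) / 2\<close>.\<close>
  define g where "g x y e = ((cmod (cinner e x))\<^sup>2 + (cmod (cinner e y))\<^sup>2) / 2" for x y e :: 'a
  have g_sum: "g x y summable_on B" and g_le: "infsum (g x y) B \<le> ((norm x)\<^sup>2 + (norm y)\<^sup>2) / 2" for x y
  proof -
    have eq: "g x y = (\<lambda>e. (cmod (cinner e x))\<^sup>2 / 2 + (cmod (cinner e y))\<^sup>2 / 2)"
      by (simp add: g_def fun_eq_iff add_divide_distrib)
    have s: "(\<lambda>e. (cmod (cinner e z))\<^sup>2 / 2) summable_on B" for z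
      using summable_on_cmult_left[OF Bessel_summable(1)[OF B], of z "1/2"] by simp
    show "g x y summable_on B" unfolding eq by (intro summable_on_add s)
    have i: "infsum (\<lambda>e. (cmod (cinner e z))\<^sup>2 / 2) B \<le> (norm z)\<^sup>2 / 2" for z
      using infsum_cmult_left'[of "\<lambda>e. (cmod (cinner e z))\<^sup>2" "1/2" B] Bessel_summable(2)[OF B, of z] by simp
    show "infsum (g x y) B \<le> ((norm x)\<^sup>2 + (norm y)\<^sup>2) / 2"
      unfolding eq infsum_add[OF s s] using i[of x] i[of y] by simp
  qed
  have tg: "cmod (t x y e) \<le> g x y e" for x y e
    unfolding t_def g_def using mult_cmod_le[of "cinner x e" "cinner e y"] by (simp add: cmod_cinner_commute[of x])
  have t_sum: "t x y summable_on B" for x y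
    by (rule summable_on_norm_le[OF g_sum tg])
  define f where "f x y = infsum (t x y) B" for x y
  have f: "(t x y has_sum f x y) B" for x y unfolding f_def by (rule has_sum_infsum[OF t_sum])
  have f_le: "cmod (f x y) \<le> ((norm x)\<^sup>2 + (norm y)\<^sup>2) / 2" for x y
    using norm_infsum_le[OF f has_sum_infsum[OF g_sum] tg] g_le[of x y] by (meson order_trans)
  have f_add: "f x (y + z) = f x y + f x z" for x y z
  proof -
    have "t x (y + z) = (\<lambda>e. t x y e + t x z e)" by (simp add: t_def fun_eq_iff cinner_add_right algebra_simps)
    then show ?thesis unfolding f_def using infsum_add[OF t_sum t_sum, of x y x z] by simp
  qed
  have f_scale: "f x (c *\<^sub>C y) = c * f x y" for x c y
  proof -
    have "t x (c *\<^sub>C y) = (\<lambda>e. c * t x y e)" by (simp add: t_def fun_eq_iff cinner_scaleC_right)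
    then show ?thesis unfolding f_def using infsum_cmult_right[of c "t x y"] t_sum by simp
  qed
  have f_basis: "f x e = cinner x e" if "e \<in> B" for x e
  proof -
    have "(t x e has_sum (\<Sum>e'\<in>{e}. t x e e')) {e}" by (rule has_sum_finite) simp
    moreover have "(t x e has_sum t x e e) {e} \<longleftrightarrow> (t x e has_sum t x e e) B"
      by (rule has_sum_cong_neutral) (use that B in \<open>auto simp: t_def is_onb_def\<close>)
    ultimately have "(t x e has_sum t x e e) B" by simp
    moreover have "t x e e = cinner x e" using that B by (simp add: t_def is_onb_def)
    ultimately show ?thesis using f has_sum_unique by metis
  qed
  have "bounded_linear (\<lambda>y. Re (f x y))" for x
  proof (rule bounded_linear_intro)
    show "Re (f x (y + z)) = Re (f x y) + Re (f x z)" for y z by (simp add: f_add)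
    show "Re (f x (r *\<^sub>R y)) = r *\<^sub>R Re (f x y)" for r y
      using f_scale[of x "complex_of_real r" y] by (simp add: scaleC_of_real)
    show "norm (Re (f x y)) \<le> norm y * (((norm x)\<^sup>2 + 1) / 2)" for y
    proof (cases "y = 0")
      case True
      then show ?thesis using f_scale[of x 0 0] by (simp add: linear_0[OF linear_scaleC])
    next
      case False
      define v where "v = (1 / norm y) *\<^sub>R y"
      have "y = complex_of_real (norm y) *\<^sub>C v" using False by (simp add: v_def scaleC_of_real)
      then have "f x y = complex_of_real (norm y) * f x v" using f_scale by metis
      then have "cmod (f x y) = norm y * cmod (f x v)" by (simp add: norm_mult)
      moreover have "cmod (f x v) \<le> ((norm x)\<^sup>2 + 1) / 2" using f_le[of x v] False by (simp add: v_def)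
      ultimately have "cmod (f x y) \<le> norm y * (((norm x)\<^sup>2 + 1) / 2)"
        by (simp only:) (intro mult_left_mono, simp_all)
      then show ?thesis using abs_Re_le_cmod[of "f x y"] by simp
    qed
  qed
  then obtain v where v: "\<And>y. Re (f x y) = inner v y" using riesz_representation by metis
  have fv: "f x y = cinner v y" for y
  proof (rule complex_eqI)
    show "Re (f x y) = Re (cinner v y)" by (simp add: v Re_cinner)
    have "Im (f x y) = Re (f x ((- \<i>) *\<^sub>C y))" by (simp add: f_scale)
    also have "\<dots> = Im (cinner v y)" by (simp add: v Re_cinner[symmetric] cinner_scaleC_right)
    finally show "Im (f x y) = Im (cinner v y)" .
  qed
  have "cinner e (v - x) = 0" if "e \<in> B" for e
    using f_basis[OF that, of x] fv[of e]
    by (simp add: cinner_diff_right cinner_commute[of e])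
  then have "v = x" using B unfolding is_onb_def by (metis eq_iff_diff_eq_0)
  then show ?thesis using f[of x y] fv unfolding t_def by simp
qed

lemma Parseval_norm:
  fixes B :: "'a::chilbert_space set"
  assumes "is_onb B"
  shows "((\<lambda>e. (cmod (cinner e x))\<^sup>2) has_sum (norm x)\<^sup>2) B"
proof -
  have "(\<lambda>e. cinner x e * cinner e x) = (\<lambda>e. complex_of_real ((cmod (cinner e x))\<^sup>2))"
    by (simp add: fun_eq_iff complex_norm_square cinner_commute[of x] mult.commute del: of_real_power)
  from has_sum_Re[OF Parseval[OF assms, of x x, unfolded this]] show ?thesis
    by (simp add: Re_cinner power2_norm_eq_inner)
qed

section \<open>Hilbert-Schmidt operators\<close>

lemma cinner_eqI_inner:
  assumes "clinear_op A" "\<And>x y. inner x (T y) = inner (A x) (y :: 'a::chilbert_space)"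
  shows "cinner x (T y) = cinner (blinfun_apply A x) y"
proof (rule complex_eqI)
  have "\<i> *\<^sub>C A x = A (\<i> *\<^sub>C x)" using assms(1) by (simp add: clinear_op_def)
  then show "Im (cinner x (T y)) = Im (cinner (A x) y)" by (simp add: Im_cinner assms(2))
qed (simp add: Re_cinner assms(2))

lemma cinner_adj_right: "clinear_op A \<Longrightarrow> cinner x (adj A y) = cinner (A x) (y :: 'a::chilbert_space)"
  by (rule cinner_eqI_inner) (simp_all add: inner_adj_right)

lemma cinner_adj_left: "clinear_op A \<Longrightarrow> cinner (adj A x) y = cinner x (A (y :: 'a::chilbert_space))"
  by (metis cinner_adj_right cinner_commute)

lemma cinner_right_eqI:
  fixes u v :: "'a::chilbert_space"
  assumes "\<And>x. cinner x u = cinner x v"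
  shows "u = v"
  by (rule inner_right_eqI) (metis Re_cinner assms)

lemma clinear_adj: "clinear_op A \<Longrightarrow> clinear_op (adj (A :: 'a::chilbert_space bop))"
  unfolding clinear_op_def[of "adj A"]
  by (intro allI cinner_right_eqI) (simp add: cinner_adj_right cinner_scaleC_right)

lemma clinear_compose: "clinear_op A \<Longrightarrow> clinear_op B \<Longrightarrow> clinear_op (A o\<^sub>L B)"
  by (simp add: clinear_op_def)

lemma clinear_add: "clinear_op A \<Longrightarrow> clinear_op B \<Longrightarrow> clinear_op (A + B)"
  by (simp add: clinear_op_def blinfun.add_left scaleC_add_right)

lemma clinear_diff: "clinear_op A \<Longrightarrow> clinear_op B \<Longrightarrow> clinear_op (A - B)"
  by (simp add: clinear_op_def blinfun.diff_left linear_diff[OF linear_scaleC])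

lemma clinear_scaleR: "clinear_op A \<Longrightarrow> clinear_op (r *\<^sub>R A)"
  by (simp add: clinear_op_def blinfun.scaleR_left linear_scale[OF linear_scaleC])

lemma clinear_zero: "clinear_op 0"
  by (simp add: clinear_op_def linear_0[OF linear_scaleC])

lemma clinear_id: "clinear_op id_blinfun"
  by (simp add: clinear_op_def)

lemma clinear_sum: "(\<And>i. i \<in> I \<Longrightarrow> clinear_op (f i)) \<Longrightarrow> clinear_op (\<Sum>i\<in>I. f i)"
  by (induction I rule: infinite_finite_induct) (simp_all add: clinear_zero clinear_add)

lemma clinear_scalar_op: "clinear_op (scalar_op c)"
  by (simp add: clinear_op_def scalar_op.rep_eq scaleC_scaleC mult.commute)

text \<open>
  The Hilbert-Schmidt class is attached to a basis \<open>B\<close>; independence of \<open>B\<close> follows below from the comparison with the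
  adjoint.
\<close>

definition HS :: "'a::chilbert_space set \<Rightarrow> 'a bop set" where
  "HS B = {X. clinear_op X \<and> (\<lambda>e. (norm (X e))\<^sup>2) summable_on B}"

definition hs :: "'a::chilbert_space set \<Rightarrow> 'a bop \<Rightarrow> 'a bop \<Rightarrow> complex" where
  "hs B X Y = infsum (\<lambda>e. cinner (X e) (Y e)) B"

lemma HS_D: "X \<in> HS B \<Longrightarrow> clinear_op X" "X \<in> HS B \<Longrightarrow> (\<lambda>e. (norm (X e))\<^sup>2) summable_on B"
  by (auto simp: HS_def)

lemma cmod_cinner_le: "cmod (cinner x y) \<le> ((norm x)\<^sup>2 + (norm (y :: 'a::chilbert_space))\<^sup>2) / 2"
proof (cases "cinner x y = 0")
  case False
  define z where "z = cnj (cinner x y) / cmod (cinner x y)"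
  have nz: "cmod z = 1" using False by (simp add: z_def norm_divide)
  have "cinner x (z *\<^sub>C y) = complex_of_real (cmod (cinner x y))"
    using False by (simp add: cinner_scaleC_right z_def complex_norm_square[symmetric] power2_eq_square field_simps)
  then have "cmod (cinner x y) = inner x (z *\<^sub>C y)" by (metis Re_cinner Re_complex_of_real)
  also have "\<dots> \<le> norm x * norm y" using norm_cauchy_schwarz[of x "z *\<^sub>C y"] by (simp add: norm_scaleC nz)
  also have "\<dots> \<le> ((norm x)\<^sup>2 + (norm y)\<^sup>2) / 2" using sum_squares_bound[of "norm x" "norm y"] by simp
  finally show ?thesis .
qed simp

lemma square_sum_summable:
  fixes f g :: "'b \<Rightarrow> 'c::real_normed_vector"
  assumes "(\<lambda>e. (norm (f e))\<^sup>2) summable_on B" "(\<lambda>e. (norm (g e))\<^sup>2) summable_on B"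
  shows "(\<lambda>e. ((norm (f e))\<^sup>2 + (norm (g e))\<^sup>2) / 2) summable_on B"
  using summable_on_cmult_left[OF summable_on_add[OF assms], of "1/2"] by simp

lemma hs_summable:
  assumes "X \<in> HS B" "Y \<in> HS B"
  shows "(\<lambda>e. cinner (X e) (Y e)) summable_on B"
  by (rule summable_on_norm_le[OF square_sum_summable[OF HS_D(2)[OF assms(1)] HS_D(2)[OF assms(2)]] cmod_cinner_le])

lemma hs_has_sum:
  assumes "X \<in> HS B" "Y \<in> HS B"
  shows "((\<lambda>e. cinner (X e) (Y e)) has_sum hs B X Y) B"
  unfolding hs_def by (rule has_sum_infsum[OF hs_summable[OF assms]])

lemma HS_compose_left:
  assumes X: "X \<in> HS B" and A: "clinear_op A"
  shows "A o\<^sub>L X \<in> HS B"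
proof -
  have "(\<lambda>e. (norm A)\<^sup>2 * (norm (X e))\<^sup>2) summable_on B" by (intro summable_on_cmult_right HS_D X)
  moreover have "(norm ((A o\<^sub>L X) e))\<^sup>2 \<le> (norm A)\<^sup>2 * (norm (X e))\<^sup>2" for e
    using norm_blinfun[of A "X e"] by (simp add: power_mono flip: power_mult_distrib)
  ultimately show ?thesis
    unfolding HS_def using clinear_compose[OF A HS_D(1)[OF X]] summable_on_comparison_test by fastforce
qed

lemma HS_add:
  assumes X: "X \<in> HS B" and Y: "Y \<in> HS B"
  shows "X + Y \<in> HS B"
proof -
  have "(\<lambda>e. 2 * ((norm (X e))\<^sup>2 + (norm (Y e))\<^sup>2)) summable_on B"
    by (intro summable_on_cmult_right summable_on_add HS_D X Y)
  moreover have "(norm ((X + Y) e))\<^sup>2 \<le> 2 * ((norm (X e))\<^sup>2 + (norm (Y e))\<^sup>2)" for e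
  proof -
    have "0 \<le> (norm (X e - Y e))\<^sup>2" by simp
    then show ?thesis
      by (simp add: blinfun.add_left power2_norm_eq_inner algebra_simps inner_commute)
  qed
  ultimately show ?thesis
    unfolding HS_def using clinear_add[OF HS_D(1)[OF X] HS_D(1)[OF Y]] summable_on_comparison_test by fastforce
qed

lemma HS_scaleR:
  assumes X: "X \<in> HS B"
  shows "c *\<^sub>R X \<in> HS B"
proof -
  have "c *\<^sub>R X = (c *\<^sub>R id_blinfun) o\<^sub>L X" by (simp add: blinfun_comp.scaleR_left)
  then show ?thesis using HS_compose_left[OF X clinear_scaleR[OF clinear_id]] by simp
qed

lemma HS_zero: "0 \<in> HS B"
  by (simp add: HS_def clinear_zero)

lemma subspace_HS: "subspace (HS B)"
  unfolding subspace_def using HS_zero HS_add HS_scaleR by blast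

text \<open>
  The entries \<open>\<langle>f, X e\<rangle>\<close> with \<open>e \<in> B\<close> and \<open>f \<in> C\<close> are square summable; summing first over \<open>f\<close> or first over
  \<open>e\<close> compares \<open>X\<close> on \<open>B\<close> with its adjoint on \<open>C\<close>.
\<close>

lemma HS_entries:
  assumes C: "is_onb C" and X: "X \<in> HS B"
  shows "(\<lambda>(e, f). (cmod (cinner f (X e)))\<^sup>2) summable_on B \<times> C"
  by (rule summable_on_SigmaI[where g = "\<lambda>e. (norm (X e))\<^sup>2"])
     (use Parseval_norm[OF C] HS_D(2)[OF X] in auto)

lemma HS_adj:
  assumes B: "is_onb B" and C: "is_onb C" and X: "X \<in> HS B"
  shows "adj X \<in> HS C" "infsum (\<lambda>f. (norm (adj X f))\<^sup>2) C = infsum (\<lambda>e. (norm (X e))\<^sup>2) B"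
proof -
  note cl = HS_D(1)[OF X]
  obtain s where s: "((\<lambda>(e, f). (cmod (cinner f (X e)))\<^sup>2) has_sum s) (B \<times> C)"
    using HS_entries[OF C X] unfolding summable_on_def by blast
  have 1: "((\<lambda>e. (norm (X e))\<^sup>2) has_sum s) B"
    by (rule has_sum_SigmaD[OF s]) (use Parseval_norm[OF C] in simp)
  have eq: "cmod (cinner f (X e)) = cmod (cinner e (adj X f))" for e f
    by (simp add: cinner_adj_right[OF cl] cmod_cinner_commute[of f])
  have "((\<lambda>(f, e). (cmod (cinner e (adj X f)))\<^sup>2) has_sum s) (C \<times> B)"
    using s[THEN has_sum_swap[THEN iffD1]] by (simp add: eq)
  then have 2: "((\<lambda>f. (norm (adj X f))\<^sup>2) has_sum s) C"
    by (rule has_sum_SigmaD) (use Parseval_norm[OF B] in simp)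
  show "adj X \<in> HS C" unfolding HS_def using clinear_adj[OF cl] 2 summable_on_def by blast
  show "infsum (\<lambda>f. (norm (adj X f))\<^sup>2) C = infsum (\<lambda>e. (norm (X e))\<^sup>2) B"
    using 1 2 infsumI by metis
qed

text \<open>
  Expanding in the basis, both sides are the double sum of \<open>\<langle>X e, f\<rangle> \<langle>f, Y e\<rangle>\<close>, summed in the two possible orders.  In terms
  of traces this is \<open>Tr (X\<^sup>* Y) = Tr (Y X\<^sup>*)\<close>.
\<close>

lemma hs_adj:
  assumes B: "is_onb B" and X: "X \<in> HS B" and Y: "Y \<in> HS B"
  shows "hs B X Y = hs B (adj Y) (adj X)"
proof -
  define F where "F = (\<lambda>(e, f). cinner (X e) f * cinner f (Y e))"
  have "(\<lambda>p. ((cmod (cinner (snd p) (X (fst p))))\<^sup>2 + (cmod (cinner (snd p) (Y (fst p))))\<^sup>2) / 2) summable_on B \<times> B"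
    using HS_entries[OF B X] HS_entries[OF B Y] by (intro square_sum_summable) (simp_all add: case_prod_unfold)
  moreover have "cmod (F p) \<le> ((cmod (cinner (snd p) (X (fst p))))\<^sup>2 + (cmod (cinner (snd p) (Y (fst p))))\<^sup>2) / 2" for p
    using mult_cmod_le[of "cinner (X (fst p)) (snd p)" "cinner (snd p) (Y (fst p))"]
    by (simp add: F_def case_prod_unfold cmod_cinner_commute[of "X (fst p)"])
  ultimately have "F summable_on B \<times> B"
    by (rule summable_on_norm_le)
  then obtain s where s: "(F has_sum s) (B \<times> B)" unfolding summable_on_def by blast
  have "((\<lambda>e. cinner (X e) (Y e)) has_sum s) B"
    by (rule has_sum_SigmaD[OF s]) (use Parseval[OF B] in \<open>simp add: F_def\<close>)
  then have 1: "hs B X Y = s" unfolding hs_def by (rule infsumI)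
  have "((\<lambda>(f, e). cinner (adj Y f) e * cinner e (adj X f)) has_sum s) (B \<times> B)"
    using s[THEN has_sum_swap[THEN iffD1]]
    by (simp add: F_def cinner_adj_right[OF HS_D(1)[OF X]] cinner_adj_left[OF HS_D(1)[OF Y]] mult.commute)
  then have "((\<lambda>f. cinner (adj Y f) (adj X f)) has_sum s) B"
    by (rule has_sum_SigmaD) (use Parseval[OF B] in simp)
  then have "hs B (adj Y) (adj X) = s" unfolding hs_def by (rule infsumI)
  then show ?thesis using 1 by simp
qed

lemma HS_compose_right:
  assumes B: "is_onb B" and X: "X \<in> HS B" and A: "clinear_op A"
  shows "X o\<^sub>L A \<in> HS B"
  using HS_adj(1)[OF B B HS_compose_left[OF HS_adj(1)[OF B B X] clinear_adj[OF A]]]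
  by (simp add: adj_compose adj_adj)

lemma adj_selfadjoint: "selfadjoint_op A \<Longrightarrow> adj A = A"
  by (rule adj_unique) (simp add: selfadjoint_op_iff_inner)

text \<open>
  The adjoint passes from the basis in the definition to the given one; a self-adjoint operator is its own adjoint.
\<close>

lemma hilbert_schmidt_HS:
  assumes B: "is_onb B" and X: "hilbert_schmidt X" "selfadjoint_op X"
  shows "X \<in> HS B"
proof -
  obtain C where C: "is_onb C" "X \<in> HS C" using X(1) unfolding hilbert_schmidt_def HS_def by blast
  show ?thesis using HS_adj(1)[OF C(1) B C(2)] adj_selfadjoint[OF X(2)] by simp
qed

lemma hs_commute_cnj: "hs B Y X = cnj (hs B X Y)"
  unfolding hs_def by (subst infsum_cnj[symmetric]) (simp flip: cinner_commute)

lemma hs_add_left: "X \<in> HS B \<Longrightarrow> Y \<in> HS B \<Longrightarrow> Z \<in> HS B \<Longrightarrow> hs B (X + Y) Z = hs B X Z + hs B Y Z"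
  unfolding hs_def by (subst infsum_add[symmetric, OF hs_summable hs_summable])
    (simp_all add: blinfun.add_left cinner_add_left)

lemma hs_scaleR_left: "hs B (c *\<^sub>R X) Z = of_real c * hs B X Z"
  unfolding hs_def by (simp add: blinfun.scaleR_left cinner_scaleR_left infsum_cmult_right')

lemma hs_selfadjoint_real:
  assumes B: "is_onb B" and "X \<in> HS B" "Y \<in> HS B" "selfadjoint_op X" "selfadjoint_op Y"
  shows "hs B X Y = complex_of_real (Re (hs B X Y))"
proof -
  have "hs B X Y = hs B Y X" using hs_adj[OF assms(1-3)] assms(4,5) by (simp add: adj_selfadjoint)
  then have "hs B X Y = cnj (hs B X Y)" using hs_commute_cnj[of B Y X] by simp
  then show ?thesis by (metis complex_is_Real_iff Reals_cnj_iff of_real_Re)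
qed

section \<open>Multiplication operators on the Hilbert-Schmidt class\<close>

lemma form_space_HS:
  "form_space (HS B) (\<lambda>X Y. Re (hs B X Y))"
proof
  fix X Y Z :: "'a bop" and c :: real
  show "subspace (HS B)" by (rule subspace_HS)
  show "Re (hs B (X + Y) Z) = Re (hs B X Z) + Re (hs B Y Z)" if "X \<in> HS B" "Y \<in> HS B" "Z \<in> HS B"
    using that by (simp add: hs_add_left)
  show "Re (hs B (c *\<^sub>R X) Z) = c * Re (hs B X Z)" by (simp add: hs_scaleR_left)
  show "Re (hs B X Y) = Re (hs B Y X)" using hs_commute_cnj[of B X Y] by simp
  show "0 \<le> Re (hs B X X)" if "X \<in> HS B"
    using has_sum_Re[OF hs_has_sum[OF that that]]
    by (rule has_sum_nonneg) (simp add: Re_cinner)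
qed

lemma hs_left_bounds:
  assumes X: "X \<in> HS B" and A: "clinear_op A"
    and bd: "\<And>x. a * inner x x \<le> inner x (A x)" "\<And>x. inner x (A x) \<le> b * inner x x"
  shows "a * Re (hs B X X) \<le> Re (hs B X (A o\<^sub>L X))" "Re (hs B X (A o\<^sub>L X)) \<le> b * Re (hs B X X)"
proof -
  note s = has_sum_Re[OF hs_has_sum[OF X X]]
  note sA = has_sum_Re[OF hs_has_sum[OF X HS_compose_left[OF X A]]]
  show "a * Re (hs B X X) \<le> Re (hs B X (A o\<^sub>L X))"
    by (rule has_sum_mono[OF has_sum_cmult_right[OF s] sA]) (simp add: Re_cinner bd)
  show "Re (hs B X (A o\<^sub>L X)) \<le> b * Re (hs B X X)"
    by (rule has_sum_mono[OF sA has_sum_cmult_right[OF s]]) (simp add: Re_cinner bd)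
qed

lemma between_left:
  assumes A: "selfadjoint_op A"
    and bd: "\<And>x. a * inner x x \<le> inner x (A x)" "\<And>x. inner x (A x) \<le> b * inner x x"
  shows "form_space.between (HS B) (\<lambda>X Y. Re (hs B X Y)) a b (\<lambda>X. A o\<^sub>L X)"
proof -
  interpret form_space "HS B" "\<lambda>X Y. Re (hs B X Y)" by (rule form_space_HS)
  have cl: "clinear_op A" using A selfadjoint_op_def by blast
  have "hs B (A o\<^sub>L X) Y = hs B X (A o\<^sub>L Y)" for X Y
    using A by (simp add: hs_def selfadjoint_op_def)
  then show ?thesis
    unfolding between_def symop_def
    using HS_compose_left[OF _ cl] hs_left_bounds[OF _ cl bd]
    by (auto intro: bounded_linear.linear[OF blinfun_comp.bounded_linear_right])
qed

text \<open>
  Passing to adjoints turns multiplication from the right into multiplication from the left.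
\<close>

lemma between_right:
  assumes B: "is_onb B" and A: "selfadjoint_op A"
    and bd: "\<And>x. a * inner x x \<le> inner x (A x)" "\<And>x. inner x (A x) \<le> b * inner x x"
  shows "form_space.between (HS B) (\<lambda>X Y. Re (hs B X Y)) a b (\<lambda>X. X o\<^sub>L A)"
proof -
  interpret form_space "HS B" "\<lambda>X Y. Re (hs B X Y)" by (rule form_space_HS)
  have cl: "clinear_op A" using A selfadjoint_op_def by blast
  have swap: "hs B X (Y o\<^sub>L A) = hs B (A o\<^sub>L adj Y) (adj X)" if "X \<in> HS B" "Y \<in> HS B" for X Y
    using hs_adj[OF B that(1) HS_compose_right[OF B that(2) cl]] by (simp add: adj_compose adj_selfadjoint[OF A])
  have sym: "hs B (X o\<^sub>L A) Y = hs B X (Y o\<^sub>L A)" if "X \<in> HS B" "Y \<in> HS B" for X Y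
  proof -
    have "hs B (X o\<^sub>L A) Y = cnj (hs B Y (X o\<^sub>L A))" by (rule hs_commute_cnj)
    also have "\<dots> = cnj (hs B (A o\<^sub>L adj X) (adj Y))" using swap that by simp
    also have "\<dots> = hs B (adj Y) (A o\<^sub>L adj X)" by (rule hs_commute_cnj[symmetric])
    also have "\<dots> = hs B (A o\<^sub>L adj Y) (adj X)" using A by (simp add: hs_def selfadjoint_op_def)
    also have "\<dots> = hs B X (Y o\<^sub>L A)" using swap that by simp
    finally show ?thesis .
  qed
  have "a * Re (hs B X X) \<le> Re (hs B X (X o\<^sub>L A)) \<and> Re (hs B X (X o\<^sub>L A)) \<le> b * Re (hs B X X)"
    if X: "X \<in> HS B" for X
  proof -
    note X' = HS_adj(1)[OF B B X]
    have "hs B X X = hs B (adj X) (adj X)" by (rule hs_adj[OF B X X])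
    moreover have "Re (hs B X (X o\<^sub>L A)) = Re (hs B (adj X) (A o\<^sub>L adj X))"
      unfolding swap[OF X X] using q_commute[OF HS_compose_left[OF X' cl] X'] .
    ultimately show ?thesis using hs_left_bounds[OF X' cl bd] by simp
  qed
  then show ?thesis
    unfolding between_def symop_def
    using HS_compose_right[OF B _ cl] sym
    by (auto intro: bounded_linear.linear[OF blinfun_comp.bounded_linear_left])
qed

section \<open>Square roots and absolute values\<close>

context symmetric_operator
begin

lemma norm_op_eval_le:
  assumes "\<And>t. t \<in> {lo..hi} \<Longrightarrow> \<bar>poly p t\<bar> \<le> e"
  shows "norm (op_eval A p) \<le> e"
proof (rule norm_symmetric_le)
  show "inner (op_eval A p x) y = inner x (op_eval A p y)" for x y by (rule sym_eval)
  show "0 \<le> e" using assms[of lo] lo_hi by simp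
  fix x
  have tot: "(\<integral>t. e \<partial>vector_measure x) = e * (norm x)\<^sup>2"
    using mass_total[of x] by (simp add: mass_def space_vector_measure)
  have "\<bar>inner x (op_eval A p x)\<bar> \<le> (\<integral>t. \<bar>poly p t\<bar> \<partial>vector_measure x)"
    unfolding integral_poly[symmetric] by (rule integral_abs_bound)
  also have "\<dots> \<le> (\<integral>t. e \<partial>vector_measure x)"
    using poly_integrable[of x p] assms
    by (intro integral_mono) (auto simp: space_vector_measure finite_measure.integrable_const[OF vector_measure(1)])
  finally show "\<bar>inner x (op_eval A p x)\<bar> \<le> e * (norm x)\<^sup>2" unfolding tot .
qed

lemma inner_op_eval_ge:
  assumes "\<And>t. t \<in> {lo..hi} \<Longrightarrow> e \<le> poly p t"
  shows "e * (norm x)\<^sup>2 \<le> inner x (op_eval A p x)"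
proof -
  have "(\<integral>t. e \<partial>vector_measure x) \<le> (\<integral>t. poly p t \<partial>vector_measure x)"
    using poly_integrable[of x p] assms
    by (intro integral_mono) (auto simp: space_vector_measure finite_measure.integrable_const[OF vector_measure(1)])
  moreover have "(\<integral>t. e \<partial>vector_measure x) = e * (norm x)\<^sup>2"
    using mass_total[of x] by (simp add: mass_def space_vector_measure)
  ultimately show ?thesis unfolding integral_poly by linarith
qed

end

lemma op_eval_diff: "op_eval A (p - q) = op_eval A p - op_eval A q"
  using op_eval_add[of A p "smult (-1) q"] op_eval_smult[of A "-1" q] by simp

lemma clinear_op_eval: "clinear_op A \<Longrightarrow> clinear_op (op_eval A p)"
  by (induction p) (simp_all add: clinear_zero clinear_add clinear_scaleR clinear_id clinear_compose)

lemma positive_opD: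
  assumes "positive_op A"
  shows "clinear_op A" "inner (A x) y = inner x (A y)" "0 \<le> inner x (A x)"
  using assms by (auto simp: positive_op_def selfadjoint_op_iff_inner Re_cinner)

lemma positive_opI:
  assumes "clinear_op A" "\<And>x y. inner (A x) y = inner x (A y)" "\<And>x. 0 \<le> inner x (A x)"
  shows "positive_op A"
  using assms by (auto simp: positive_op_def selfadjoint_op_iff_inner Re_cinner)

lemma positive_op_symmetric_operator:
  assumes P: "positive_op P"
  shows "symmetric_operator P 0 (norm P + 1)"
proof
  show "0 < norm P + 1" using norm_ge_zero[of P] by linarith
  show "inner (P x) y = inner x (P y)" for x y by (rule positive_opD(2)[OF P])
  show "0 * inner x x \<le> inner x (P x)" for x using positive_opD(3)[OF P] by simp
  fix x
  have "inner x (P x) \<le> norm x * norm (P x)" by (rule norm_cauchy_schwarz)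
  also have "\<dots> \<le> norm x * (norm P * norm x)" by (intro mult_left_mono norm_blinfun) auto
  also have "\<dots> = norm P * inner x x" by (simp add: power2_norm_eq_inner[symmetric] power2_eq_square)
  also have "\<dots> \<le> (norm P + 1) * inner x x" by (intro mult_right_mono) auto
  finally show "inner x (P x) \<le> (norm P + 1) * inner x x" .
qed

text \<open>
  If polynomials \<open>p\<^sub>n\<close> approximate the square root uniformly on \<open>[0,r]\<close>, then \<open>p\<^sub>n(A)\<close> is a Cauchy sequence in norm, and its
  limit inherits its properties from them; \<open>p\<^sub>n(A)\<^sup>2\<close> tends to \<open>A\<close> as \<open>p\<^sub>n(t)\<^sup>2 - t = (p\<^sub>n(t) - \<surd>t) (p\<^sub>n(t) + \<surd>t)\<close>.
\<close>

theorem positive_square_root: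
  fixes A :: "'a::chilbert_space bop"
  assumes A: "positive_op A"
  shows "\<exists>P. positive_op P \<and> P o\<^sub>L P = A"
proof -
  define r where "r = norm A + 1"
  interpret symmetric_operator A 0 r unfolding r_def by (rule positive_op_symmetric_operator[OF A])
  have r: "r > 0" using lo_hi .
  have "\<exists>p. \<forall>t\<in>{0..r}. \<bar>sqrt t - poly p t\<bar> \<le> 1 / (real n + 1)" for n
  proof -
    have "continuous_on {0..r} sqrt" by (intro continuous_intros)
    moreover have "0 < 1 / (real n + 1)" by simp
    ultimately obtain g where g: "real_polynomial_function g" "\<And>t. t \<in> {0..r} \<Longrightarrow> \<bar>sqrt t - g t\<bar> < 1 / (real n + 1)"
      using Stone_Weierstrass_real_polynomial_function[of "{0..r}" sqrt "1 / (real n + 1)"] by blast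
    obtain a k where k: "g = (\<lambda>x. \<Sum>i\<le>k. a i * x ^ i)" using g(1) real_polynomial_function_iff_sum by blast
    have "poly (\<Sum>i\<le>k. monom (a i) i) = g" by (simp add: k poly_sum poly_monom fun_eq_iff)
    then show ?thesis using g(2) by (intro exI[of _ "\<Sum>i\<le>k. monom (a i) i"]) (auto intro: less_imp_le)
  qed
  then obtain p where p: "\<And>n t. t \<in> {0..r} \<Longrightarrow> \<bar>sqrt t - poly (p n) t\<bar> \<le> 1 / (real n + 1)" by metis
  define T where "T n = op_eval A (p n)" for n
  have lim0: "(\<lambda>n. 1 / (real n + 1)) \<longlonglongrightarrow> 0"
    using LIMSEQ_inverse_real_of_nat by (simp add: inverse_eq_divide add.commute)
  have TT: "norm (T m - T n) \<le> 1 / (real m + 1) + 1 / (real n + 1)" for m n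
    unfolding T_def op_eval_diff[symmetric]
  proof (rule norm_op_eval_le)
    fix t assume "t \<in> {0..r}"
    then show "\<bar>poly (p m - p n) t\<bar> \<le> 1 / (real m + 1) + 1 / (real n + 1)"
      using p[of t m] p[of t n] by simp
  qed
  have "Cauchy T"
  proof (rule metric_CauchyI)
    fix e :: real assume e: "e > 0"
    obtain N where N: "\<And>n. n \<ge> N \<Longrightarrow> \<bar>1 / (real n + 1)\<bar> < e / 2"
      using LIMSEQ_D[OF lim0, of "e / 2"] e by auto
    have "dist (T m) (T n) < e" if "m \<ge> N" "n \<ge> N" for m n
      using TT[of m n] N[OF that(1)] N[OF that(2)] unfolding dist_norm by linarith
    then show "\<exists>M. \<forall>m\<ge>M. \<forall>n\<ge>M. dist (T m) (T n) < e" by blast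
  qed
  then obtain P where P: "T \<longlonglongrightarrow> P" using Cauchy_convergent_iff convergent_def by blast
  have Px: "(\<lambda>n. T n x) \<longlonglongrightarrow> P x" for x by (intro tendsto_intros P)
  have "P o\<^sub>L P = A"
  proof -
    have "(\<lambda>n. T n o\<^sub>L T n) \<longlonglongrightarrow> (P o\<^sub>L P)" by (rule blinfun_comp.tendsto[OF P P])
    moreover have "(\<lambda>n. T n o\<^sub>L T n) \<longlonglongrightarrow> A"
    proof (rule Lim_transform_bound[THEN LIM_zero_cancel])
      have "(\<lambda>n. (1 / (real n + 1)) * (2 * sqrt r + 1)) \<longlonglongrightarrow> 0 * (2 * sqrt r + 1)"
        by (intro tendsto_mult lim0 tendsto_const)
      then show "(\<lambda>n. (1 / (real n + 1)) * (2 * sqrt r + 1)) \<longlonglongrightarrow> 0" by simp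
      show "\<forall>\<^sub>F n in sequentially. norm ((T n o\<^sub>L T n) - A) \<le> norm ((1 / (real n + 1)) * (2 * sqrt r + 1))"
      proof (rule always_eventually, rule allI)
        fix n
        have "norm (op_eval A (p n * p n - [:0, 1:])) \<le> (1 / (real n + 1)) * (2 * sqrt r + 1)"
        proof (rule norm_op_eval_le)
          fix t assume t: "t \<in> {0..r}"
          have s: "0 \<le> sqrt t" "sqrt t \<le> sqrt r" using t by auto
          have one: "1 / (real n + 1) \<le> 1" by simp
          have "\<bar>poly (p n * p n - [:0, 1:]) t\<bar> = \<bar>poly (p n) t * poly (p n) t - sqrt t * sqrt t\<bar>"
            using t by simp
          also have "\<dots> = \<bar>poly (p n) t - sqrt t\<bar> * \<bar>poly (p n) t + sqrt t\<bar>"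
            by (simp add: abs_mult[symmetric] algebra_simps)
          also have "\<dots> \<le> (1 / (real n + 1)) * (2 * sqrt r + 1)"
          proof (rule mult_mono)
            show "\<bar>poly (p n) t - sqrt t\<bar> \<le> 1 / (real n + 1)" using p[OF t, of n] by (simp add: abs_minus_commute)
            show "\<bar>poly (p n) t + sqrt t\<bar> \<le> 2 * sqrt r + 1" using p[OF t, of n] s one by linarith
          qed auto
          finally show "\<bar>poly (p n * p n - [:0, 1:]) t\<bar> \<le> (1 / (real n + 1)) * (2 * sqrt r + 1)" .
        qed
        moreover have "op_eval A (p n * p n - [:0, 1:]) = (T n o\<^sub>L T n) - A"
          by (simp add: T_def op_eval_diff op_eval_mult)
        ultimately show "norm ((T n o\<^sub>L T n) - A) \<le> norm ((1 / (real n + 1)) * (2 * sqrt r + 1))"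
          by (metis abs_ge_self order_trans real_norm_def)
      qed
    qed
    ultimately show ?thesis by (rule LIMSEQ_unique)
  qed
  moreover have "positive_op P"
  proof (rule positive_opI)
    show "inner (P x) y = inner x (P y)" for x y
    proof (rule LIMSEQ_unique)
      show "(\<lambda>n. inner (T n x) y) \<longlonglongrightarrow> inner (P x) y" by (intro tendsto_intros Px)
      show "(\<lambda>n. inner (T n x) y) \<longlonglongrightarrow> inner x (P y)"
      proof -
        have "inner (T n x) y = inner x (T n y)" for n by (simp add: T_def sym_eval)
        then show ?thesis by (simp only:) (intro tendsto_intros Px)
      qed
    qed
    show "clinear_op P"
      unfolding clinear_op_def
    proof (intro allI)
      fix z x
      have "T n (z *\<^sub>C x) = z *\<^sub>C T n x" for n
        using clinear_op_eval[OF positive_opD(1)[OF A]] unfolding T_def clinear_op_def by blast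
      then have "(\<lambda>n. T n (z *\<^sub>C x)) \<longlonglongrightarrow> z *\<^sub>C P x"
        by (simp add: bounded_linear.tendsto[OF bounded_linear_scaleC Px])
      then show "P (z *\<^sub>C x) = z *\<^sub>C P x" using Px LIMSEQ_unique by blast
    qed
    fix x
    have "- (1 / (real n + 1)) * (norm x)\<^sup>2 \<le> inner x (T n x)" for n
      unfolding T_def
    proof (rule inner_op_eval_ge)
      fix t assume t: "t \<in> {0..r}"
      then have "0 \<le> sqrt t" by simp
      then show "- (1 / (real n + 1)) \<le> poly (p n) t" using p[OF t, of n] by linarith
    qed
    moreover have "(\<lambda>n. - (1 / (real n + 1)) * (norm x)\<^sup>2) \<longlonglongrightarrow> - 0 * (norm x)\<^sup>2"
      by (intro tendsto_intros lim0)
    moreover have "(\<lambda>n. inner x (T n x)) \<longlonglongrightarrow> inner x (P x)" by (intro tendsto_intros Px)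
    ultimately show "0 \<le> inner x (P x)"
      using LIMSEQ_le[of "\<lambda>n. - (1 / (real n + 1)) * (norm x)\<^sup>2" 0 "\<lambda>n. inner x (T n x)"] by auto
  qed
  ultimately show ?thesis by blast
qed

lemma abs_op_exists:
  assumes D: "clinear_op D"
  shows "\<exists>P. is_abs_op P D"
proof -
  have "positive_op (adj D o\<^sub>L D)"
    by (rule positive_opI) (simp_all add: clinear_compose clinear_adj D inner_adj_left inner_adj_right)
  then obtain P where P: "positive_op P" "P o\<^sub>L P = adj D o\<^sub>L D" using positive_square_root by blast
  have "cinner (P x) (P y) = cinner (D x) (D y)" for x y
  proof -
    have "cinner (P x) (P y) = cinner x ((P o\<^sub>L P) y)"
      using P(1) by (simp add: positive_op_def selfadjoint_op_def)
    also have "\<dots> = cinner (D x) (D y)" by (simp add: P(2) cinner_adj_right[OF D])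
    finally show ?thesis .
  qed
  then show ?thesis using P(1) unfolding is_abs_op_def by blast
qed

section \<open>Products of Hilbert-Schmidt operators\<close>

text \<open>
  Multiply \<open>(n + 1) (1 - u)\<^sup>n \<le> 1 + (1 - u) + \<cdots> + (1 - u)\<^sup>n\<close> by \<open>u\<close> and sum the geometric series.
\<close>

lemma power_bound:
  fixes u :: real
  assumes "0 \<le> u" "u \<le> 1"
  shows "u * (1 - u) ^ n \<le> 1 / (real n + 1)"
proof -
  have "real (Suc n) * (1 - u) ^ n \<le> (\<Sum>k<Suc n. (1 - u) ^ k)"
  proof -
    have "(\<Sum>k<Suc n. (1 - u) ^ n) \<le> (\<Sum>k<Suc n. (1 - u) ^ k)"
      using assms by (intro sum_mono power_decreasing) auto
    then show ?thesis by simp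
  qed
  then have "u * (real (Suc n) * (1 - u) ^ n) \<le> u * (\<Sum>k<Suc n. (1 - u) ^ k)"
    using assms by (intro mult_left_mono) auto
  also have "\<dots> = 1 - (1 - u) ^ Suc n" using one_diff_power_eq[of "1 - u" "Suc n"] by simp
  also have "\<dots> \<le> 1" using assms by simp
  finally show ?thesis by (simp add: field_simps)
qed

lemma contraction_adj:
  fixes W :: "'a::{real_inner,banach} bop"
  assumes "\<And>x. norm (W x) \<le> norm x"
  shows "norm (adj W x) \<le> norm x"
proof -
  have "norm (adj W x) * norm (adj W x) = inner (W (adj W x)) x"
    by (simp add: inner_adj_right[symmetric] power2_norm_eq_inner[symmetric] power2_eq_square)
  also have "\<dots> \<le> norm (W (adj W x)) * norm x" by (rule norm_cauchy_schwarz)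
  also have "\<dots> \<le> norm (adj W x) * norm x" using assms by (intro mult_right_mono) auto
  finally show ?thesis by (cases "adj W x = 0") auto
qed

text \<open>
  Summability of \<open>\<langle>e, \<bar>D\<bar> e\<rangle>\<close> will be read off from \<open>\<bar>D\<bar> = U\<^sup>* D\<close> with the polar factor \<open>U\<close> of \<open>D\<close>.  A substitute for \<open>U\<close>
  suffices.  The operators \<open>1 - (1 - P/M)\<^sup>n = P G\<close>, with \<open>G\<close> a polynomial in \<open>P = \<bar>D\<bar>\<close>, approximate the identity on
  the range of \<open>P\<close>, and \<open>W = D G\<close> is a contraction because \<open>\<bar>D G x\<bar> = \<bar>P G x\<bar>\<close>.  Then \<open>W\<^sup>* D\<close> equals
  \<open>G P\<^sup>2 = P - P (1 - P/M)\<^sup>n\<close>, whose last term has norm at most \<open>M / (n + 1)\<close>.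
\<close>

lemma abs_op_approximate_polar:
  assumes P: "is_abs_op P D" and D: "clinear_op D"
  shows "\<exists>W. clinear_op W \<and> (\<forall>x. norm (W x) \<le> norm x) \<and>
    (\<forall>x. inner x (P x) \<le> Re (cinner (W x) (D x)) + (norm P + 1) / (real n + 1) * (norm x)\<^sup>2)"
proof -
  define M where "M = norm P + 1"
  have pos: "positive_op P" and PD: "cinner (P x) (P y) = cinner (D x) (D y)" for x y
    using P by (auto simp: is_abs_op_def)
  interpret symmetric_operator P 0 M unfolding M_def by (rule positive_op_symmetric_operator[OF pos])
  have M: "M > 0" using lo_hi .
  define s where "s = [:1, - 1 / M:]"
  have s: "poly s t = 1 - t / M" for t by (simp add: s_def)
  define g where "g = smult (1 / M) (\<Sum>k<n. s ^ k)"
  have g: "[:0, 1:] * g = 1 - s ^ n"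
  proof (rule poly_eq_poly_eq_iff[THEN iffD1], rule ext)
    fix t
    have "t / M * (\<Sum>k<n. (1 - t / M) ^ k) = 1 - (1 - t / M) ^ n"
      using one_diff_power_eq[of "1 - t / M" n] by simp
    then show "poly ([:0, 1:] * g) t = poly (1 - s ^ n) t"
      by (simp add: g_def poly_sum s poly_power)
  qed
  define G where "G = op_eval P g"
  define Y where "Y = op_eval P (1 - s ^ n)"
  have PG: "P (G x) = Y x" for x
  proof -
    have "Y = op_eval P [:0, 1:] o\<^sub>L G" by (simp only: Y_def G_def g[symmetric] op_eval_mult)
    then show ?thesis by simp
  qed
  have unit: "t / M \<in> {0..1}" if "t \<in> {0..M}" for t using that M by simp
  have nY: "norm (Y x) \<le> norm x" for x
  proof -
    have "norm Y \<le> 1"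
      unfolding Y_def
    proof (rule norm_op_eval_le)
      fix t assume "t \<in> {0..M}"
      then have "0 \<le> (1 - t / M) ^ n" "(1 - t / M) ^ n \<le> 1" using unit[of t] by (auto intro: power_le_one)
      then show "\<bar>poly (1 - s ^ n) t\<bar> \<le> 1" by (simp add: s poly_power)
    qed
    then show ?thesis using norm_blinfun[of Y x] mult_right_mono[of "norm Y" 1 "norm x"] by simp
  qed
  have clG: "clinear_op G" unfolding G_def by (rule clinear_op_eval[OF positive_opD(1)[OF pos]])
  define W where "W = D o\<^sub>L G"
  have "norm (W x) \<le> norm x" for x
  proof -
    have "inner (W x) (W x) = inner (Y x) (Y x)"
      using PD[of "G x" "G x"] by (simp add: W_def PG Re_cinner[symmetric])
    then have "norm (W x) = norm (Y x)" by (simp add: norm_eq_sqrt_inner)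
    then show ?thesis using nY by simp
  qed
  moreover have "inner x (P x) \<le> Re (cinner (W x) (D x)) + M / (real n + 1) * (norm x)\<^sup>2" for x
  proof -
    have "Re (cinner (W x) (D x)) = inner (Y x) (P x)"
      using PD[of "G x" x] by (simp add: W_def PG Re_cinner[symmetric])
    also have "\<dots> = inner x (op_eval P ((1 - s ^ n) * [:0, 1:]) x)"
      unfolding Y_def sym_eval by (simp only: op_eval_mult blinfun_apply_blinfun_compose) simp
    finally have WD: "Re (cinner (W x) (D x)) = inner x (op_eval P ((1 - s ^ n) * [:0, 1:]) x)" .
    have "inner x (P x) - Re (cinner (W x) (D x)) = inner x (op_eval P (s ^ n * [:0, 1:]) x)"
    proof -
      have "op_eval P ((1 - s ^ n) * [:0, 1:]) = op_eval P [:0, 1:] - op_eval P (s ^ n * [:0, 1:])"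
        unfolding op_eval_diff[symmetric] by (simp add: algebra_simps)
      then show ?thesis
        unfolding WD by (simp add: blinfun.diff_left inner_diff_right)
    qed
    also have "\<dots> \<le> norm x * norm (op_eval P (s ^ n * [:0, 1:]) x)" by (rule norm_cauchy_schwarz)
    also have "\<dots> \<le> norm x * (M / (real n + 1) * norm x)"
    proof (intro mult_left_mono order_trans[OF norm_blinfun] mult_right_mono norm_op_eval_le)
      fix t assume t: "t \<in> {0..M}"
      then have u: "0 \<le> t / M" "t / M \<le> 1" using unit[OF t] by auto
      have eq: "poly (s ^ n * [:0, 1:]) t = M * (t / M * (1 - t / M) ^ n)" using M by (simp add: s poly_power)
      have nn: "0 \<le> t / M * (1 - t / M) ^ n" using u by (intro mult_nonneg_nonneg zero_le_power) auto
      have "\<bar>poly (s ^ n * [:0, 1:]) t\<bar> = M * (t / M * (1 - t / M) ^ n)"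
        unfolding eq by (rule abs_of_nonneg[OF mult_nonneg_nonneg[OF less_imp_le[OF M] nn]])
      also have "\<dots> \<le> M * (1 / (real n + 1))"
        using M power_bound[OF u, of n] by (intro mult_left_mono) auto
      finally show "\<bar>poly (s ^ n * [:0, 1:]) t\<bar> \<le> M / (real n + 1)" by simp
    qed auto
    finally show ?thesis by (simp add: power2_eq_square algebra_simps)
  qed
  ultimately show ?thesis
    using clinear_compose[OF D clG] unfolding M_def W_def by blast
qed

text \<open>
  With \<open>W\<close> in place of the polar factor, \<open>\<langle>W e, X Y e\<rangle> = \<langle>X\<^sup>* W e, Y e\<rangle>\<close>, and \<open>X\<^sup>* W\<close> has at most the Hilbert-Schmidt norm of \<open>X\<close>.
  For a fixed finite part of the basis the error tends to 0 with growing \<open>n\<close>, so the partial sums of \<open>\<langle>e, \<bar>D\<bar> e\<rangle>\<close> have a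
  common bound.
\<close>

theorem trace_class_sum_products:
  fixes X Y :: "'i \<Rightarrow> 'a::chilbert_space bop"
  assumes B: "is_onb B" and K: "finite K" and X: "\<And>k. k \<in> K \<Longrightarrow> X k \<in> HS B" and Y: "\<And>k. k \<in> K \<Longrightarrow> Y k \<in> HS B"
  shows "trace_class (\<Sum>k\<in>K. X k o\<^sub>L Y k)"
proof -
  define D where "D = (\<Sum>k\<in>K. X k o\<^sub>L Y k)"
  have D: "clinear_op D" unfolding D_def using X Y by (intro clinear_sum clinear_compose HS_D)
  obtain P where P: "is_abs_op P D" using abs_op_exists[OF D] by blast
  define S where "S Z = infsum (\<lambda>e. (norm (blinfun_apply Z e))\<^sup>2) B" for Z :: "'a bop"
  define C where "C = (\<Sum>k\<in>K. (S (X k) + S (Y k)) / 2)"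
  have pos: "positive_op P" using P by (simp add: is_abs_op_def)
  have bound: "(\<Sum>e\<in>F. inner e (P e)) \<le> C" if F: "finite F" "F \<subseteq> B" for F
  proof -
    have ne: "norm e = 1" if "e \<in> F" for e
    proof -
      have "cinner e e = 1" using that F B by (auto simp: is_onb_def)
      then have "(norm e)\<^sup>2 = 1" using cinner_self[of e] by (metis of_real_eq_1_iff)
      then show ?thesis by (simp add: power2_eq_1_iff) (smt (verit) norm_ge_zero)
    qed
    have step: "(\<Sum>e\<in>F. inner e (P e)) \<le> C + real (card F) * ((norm P + 1) / (real n + 1))" for n
    proof -
      obtain W where W: "clinear_op W" "\<And>x. norm (W x) \<le> norm x"
        "\<And>x. inner x (P x) \<le> Re (cinner (W x) (D x)) + (norm P + 1) / (real n + 1) * (norm x)\<^sup>2"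
        using abs_op_approximate_polar[OF P D, of n] by blast
      have "(\<Sum>e\<in>F. inner e (P e)) \<le> (\<Sum>e\<in>F. Re (cinner (W e) (D e)) + (norm P + 1) / (real n + 1))"
        using W(3) ne by (intro sum_mono) (metis mult.right_neutral power_one)
      also have "\<dots> = (\<Sum>e\<in>F. Re (cinner (W e) (D e))) + real (card F) * ((norm P + 1) / (real n + 1))"
        by (simp add: sum.distrib)
      also have "(\<Sum>e\<in>F. Re (cinner (W e) (D e))) = (\<Sum>e\<in>F. \<Sum>k\<in>K. Re (cinner (adj (X k) (W e)) (Y k e)))"
        by (intro sum.cong refl, simp add: D_def blinfun.sum_left cinner_sum_right, intro sum.cong refl)
           (simp add: cinner_adj_left[OF HS_D(1)[OF X]])
      also have "\<dots> = (\<Sum>k\<in>K. \<Sum>e\<in>F. Re (cinner (adj (X k) (W e)) (Y k e)))" by (rule sum.swap)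
      also have "\<dots> \<le> C"
        unfolding C_def
      proof (rule sum_mono)
        fix k assume k: "k \<in> K"
        define Z where "Z = adj (X k) o\<^sub>L W"
        have aW: "adj W o\<^sub>L X k \<in> HS B" by (rule HS_compose_left[OF X[OF k] clinear_adj[OF W(1)]])
        have Z_adj: "Z = adj (adj W o\<^sub>L X k)" by (simp add: Z_def adj_compose adj_adj)
        have Z: "Z \<in> HS B" unfolding Z_adj by (rule HS_adj(1)[OF B B aW])
        have "S Z = S (adj W o\<^sub>L X k)" unfolding S_def Z_adj by (rule HS_adj(2)[OF B B aW])
        also have "\<dots> \<le> S (X k)"
          unfolding S_def
          using contraction_adj[OF W(2)]
          by (intro infsum_mono HS_D(2)[OF aW] HS_D(2)[OF X[OF k]]) (auto intro: power_mono)
        finally have SZ: "S Z \<le> S (X k)" .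
        have fin: "(\<Sum>e\<in>F. (norm (blinfun_apply T e))\<^sup>2) \<le> S T" if "T \<in> HS B" for T
          unfolding S_def using HS_D(2)[OF that] F by (intro finite_sum_le_infsum) auto
        have "(\<Sum>e\<in>F. Re (cinner (adj (X k) (W e)) (Y k e))) \<le> (\<Sum>e\<in>F. ((norm (Z e))\<^sup>2 + (norm (Y k e))\<^sup>2) / 2)"
          using cmod_cinner_le by (intro sum_mono order_trans[OF complex_Re_le_cmod]) (simp add: Z_def)
        also have "\<dots> = ((\<Sum>e\<in>F. (norm (Z e))\<^sup>2) + (\<Sum>e\<in>F. (norm (Y k e))\<^sup>2)) / 2"
          by (simp add: sum_divide_distrib[symmetric] sum.distrib)
        also have "\<dots> \<le> (S (X k) + S (Y k)) / 2"
          using fin[OF Z] fin[OF Y[OF k]] SZ by simp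
        finally show "(\<Sum>e\<in>F. Re (cinner (adj (X k) (W e)) (Y k e))) \<le> (S (X k) + S (Y k)) / 2" .
      qed
      finally show ?thesis by simp
    qed
    have "(\<lambda>n. 1 / (real n + 1)) \<longlonglongrightarrow> 0"
      using LIMSEQ_inverse_real_of_nat by (simp add: inverse_eq_divide add.commute)
    then have "(\<lambda>n. C + real (card F) * ((norm P + 1) * (1 / (real n + 1)))) \<longlonglongrightarrow> C + real (card F) * ((norm P + 1) * 0)"
      by (intro tendsto_intros)
    then show ?thesis using step by (intro LIMSEQ_le_const) auto
  qed
  have "(\<lambda>e. inner e (P e)) summable_on B"
    using bound positive_opD(3)[OF pos]
    by (intro nonneg_bdd_above_summable_on) (auto intro!: bdd_aboveI[of _ C])
  then have sum: "(\<lambda>e. complex_of_real (inner e (P e))) summable_on B"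
    by (rule summable_on_bounded_linear[OF bounded_linear_of_real])
  have "cinner e (P e) = complex_of_real (inner e (P e))" for e
  proof (rule complex_eqI)
    have "cinner e (P e) = cinner (P e) e" using pos by (simp add: positive_op_def selfadjoint_op_def)
    also have "\<dots> = cnj (cinner e (P e))" by (rule cinner_commute)
    finally have "Im (cinner e (P e)) = Im (cnj (cinner e (P e)))" by simp
    then show "Im (cinner e (P e)) = Im (complex_of_real (inner e (P e)))" by simp
  qed (simp add: Re_cinner)
  then have "(\<lambda>e. cinner e (P e)) summable_on B" using sum by simp
  then show ?thesis unfolding trace_class_def D_def[symmetric] using D P B by blast
qed

text \<open>In the basis chosen by the definition of the trace, the formula holds term by term.\<close>

lemma op_trace_sum_products:
  fixes X Y :: "'i \<Rightarrow> 'a::chilbert_space bop"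
  assumes B: "B = (SOME B. is_onb B)" and K: "finite K"
    and X: "\<And>k. k \<in> K \<Longrightarrow> X k \<in> HS B" "\<And>k. k \<in> K \<Longrightarrow> selfadjoint_op (X k)"
    and Y: "\<And>k. k \<in> K \<Longrightarrow> Y k \<in> HS B"
  shows "op_trace (\<Sum>k\<in>K. scalar_op (c k) o\<^sub>L (X k o\<^sub>L Y k)) = (\<Sum>k\<in>K. c k * hs B (X k) (Y k))"
proof -
  have "((\<lambda>e. \<Sum>k\<in>K. c k * cinner (X k e) (Y k e)) has_sum (\<Sum>k\<in>K. c k * hs B (X k) (Y k))) B"
    using K X(1) Y
  proof (induction K rule: finite_induct)
    case (insert k K)
    then show ?case by (simp add: has_sum_add has_sum_cmult_right hs_has_sum)
  qed simp
  moreover have "cinner e ((\<Sum>k\<in>K. scalar_op (c k) o\<^sub>L (X k o\<^sub>L Y k)) e) = (\<Sum>k\<in>K. c k * cinner (X k e) (Y k e))" for e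
    using X(2) by (auto simp: blinfun.sum_left cinner_sum_right scalar_op.rep_eq cinner_scaleC_right selfadjoint_op_def
        intro!: sum.cong)
  ultimately show ?thesis unfolding op_trace_def B[symmetric] by (simp add: infsumI)
qed

section \<open>Signed and complex measures\<close>

text \<open>
  Convergence of the series for arbitrary disjoint sequences forces \<open>\<sigma>\<close> to be bounded, so its upper variation is a finite
  measure.
\<close>

locale signed_measure =
  fixes M :: "'b measure" and \<sigma> :: "'b set \<Rightarrow> real"
  assumes sums: "range F \<subseteq> sets M \<Longrightarrow> disjoint_family F \<Longrightarrow> (\<lambda>n::nat. \<sigma> (F n)) sums \<sigma> (\<Union>n. F n)"
begin

lemma empty: "\<sigma> {} = 0"
proof -
  have "(\<lambda>n::nat. \<sigma> {}) sums \<sigma> (\<Union>n::nat. {})"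
    by (rule sums[of "\<lambda>_. {}"]) (auto simp: disjoint_family_on_def)
  then have "(\<lambda>n::nat. \<sigma> {}) \<longlonglongrightarrow> 0" using sums_summable summable_LIMSEQ_zero by blast
  then show ?thesis by (simp add: LIMSEQ_const_iff)
qed

lemma Un:
  assumes "S \<in> sets M" "T \<in> sets M" "S \<inter> T = {}"
  shows "\<sigma> (S \<union> T) = \<sigma> S + \<sigma> T"
proof -
  define F where "F n = (if n = 0 then S else if n = 1 then T else {})" for n :: nat
  have "(\<lambda>n. \<sigma> (F n)) sums \<sigma> (\<Union>n. F n)"
    by (rule sums) (use assms in \<open>auto simp: F_def disjoint_family_on_def\<close>)
  moreover have "(\<Union>n. F n) = S \<union> T"
    unfolding F_def by (auto split: if_splits intro: exI[of _ "0::nat"] exI[of _ "1::nat"])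
  moreover have "(\<lambda>n. \<sigma> (F n)) sums (\<Sum>n\<in>{0,1}. \<sigma> (F n))"
    by (rule sums_finite) (auto simp: F_def empty)
  ultimately show ?thesis using sums_unique2 by (fastforce simp: F_def)
qed

lemma Diff: "S \<in> sets M \<Longrightarrow> T \<in> sets M \<Longrightarrow> S \<subseteq> T \<Longrightarrow> \<sigma> (T - S) = \<sigma> T - \<sigma> S"
  using Un[of S "T - S"] by (simp add: Un_absorb1)

definition unbounded_on :: "'b set \<Rightarrow> bool" where
  "unbounded_on E \<longleftrightarrow> E \<in> sets M \<and> (\<forall>C. \<exists>U\<in>sets M. U \<subseteq> E \<and> C < \<bar>\<sigma> U\<bar>)"

text \<open>
  A subset \<open>U\<close> of \<open>E\<close> with \<open>\<bar>\<sigma> U\<bar> > 1 + \<bar>\<sigma> E\<bar>\<close> has a complement in \<open>E\<close> with \<open>\<bar>\<sigma> (E - U)\<bar> > 1\<close>, and \<open>\<sigma>\<close> is unbounded on one of the two.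
\<close>

lemma unbounded_split:
  assumes E: "unbounded_on E"
  shows "\<exists>A\<in>sets M. A \<subseteq> E \<and> 1 < \<bar>\<sigma> A\<bar> \<and> unbounded_on (E - A)"
proof -
  have Em: "E \<in> sets M" using E by (simp add: unbounded_on_def)
  obtain U where U: "U \<in> sets M" "U \<subseteq> E" "1 + \<bar>\<sigma> E\<bar> < \<bar>\<sigma> U\<bar>"
    using E unfolding unbounded_on_def by blast
  have big: "1 < \<bar>\<sigma> U\<bar>" "1 < \<bar>\<sigma> (E - U)\<bar>" using U Diff[OF U(1) Em U(2)] by linarith+
  have "unbounded_on U \<or> unbounded_on (E - U)"
  proof (rule ccontr)
    assume "\<not> ?thesis"
    then obtain C C' where C: "\<And>V. V \<in> sets M \<Longrightarrow> V \<subseteq> U \<Longrightarrow> \<bar>\<sigma> V\<bar> \<le> C"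
      "\<And>V. V \<in> sets M \<Longrightarrow> V \<subseteq> E - U \<Longrightarrow> \<bar>\<sigma> V\<bar> \<le> C'"
      using U(1) Em unfolding unbounded_on_def by (meson not_less sets.Diff)
    obtain V where V: "V \<in> sets M" "V \<subseteq> E" "C + C' < \<bar>\<sigma> V\<bar>" using E unfolding unbounded_on_def by blast
    have "\<sigma> ((V \<inter> U) \<union> (V - U)) = \<sigma> (V \<inter> U) + \<sigma> (V - U)" using U V by (intro Un) auto
    then have "\<sigma> V = \<sigma> (V \<inter> U) + \<sigma> (V - U)" by (simp add: Int_Diff_Un)
    moreover have "\<bar>\<sigma> (V \<inter> U)\<bar> \<le> C" "\<bar>\<sigma> (V - U)\<bar> \<le> C'" using U V by (auto intro!: C)
    ultimately show False using V(3) by linarith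
  qed
  then show ?thesis
  proof
    assume "unbounded_on U"
    moreover have "E - (E - U) = U" using U(2) by auto
    ultimately show ?thesis using U big Em by (intro bexI[of _ "E - U"]) auto
  next
    assume "unbounded_on (E - U)"
    then show ?thesis using U big by (intro bexI[of _ U]) auto
  qed
qed

text \<open>
  If \<open>\<sigma>\<close> were unbounded, one could split off disjoint sets \<open>A\<close> with \<open>\<bar>\<sigma> A\<bar> > 1\<close> indefinitely, against the convergence of the
  series of their values.
\<close>

lemma bounded: "\<exists>C. \<forall>U\<in>sets M. \<bar>\<sigma> U\<bar> \<le> C"
proof (rule ccontr)
  assume "\<not> ?thesis"
  then have top: "unbounded_on (space M)"
    unfolding unbounded_on_def by (metis not_le sets.sets_into_space sets.top)
  obtain piece where piece: "\<And>E. unbounded_on E \<Longrightarrow> piece E \<in> sets M \<and> piece E \<subseteq> E \<and> 1 < \<bar>\<sigma> (piece E)\<bar> \<and> unbounded_on (E - piece E)"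
    using unbounded_split by metis
  define E where "E n = rec_nat (space M) (\<lambda>_ E. E - piece E) n" for n
  have E0: "E 0 = space M" and ES: "\<And>n. E (Suc n) = E n - piece (E n)" by (simp_all add: E_def)
  have un: "unbounded_on (E n)" for n by (induction n) (use top piece in \<open>auto simp: E0 ES\<close>)
  have "decseq E" by (rule decseq_SucI) (auto simp: ES)
  then have mono: "E n \<subseteq> E (Suc m)" if "m < n" for m n using that by (auto simp: decseq_def dest: Suc_leI)
  define A where "A n = piece (E n)" for n
  have disj: "A m \<inter> A n = {}" if "m < n" for m n
    using mono[OF that] piece[OF un, of n] by (auto simp: A_def ES)
  have "disjoint_family A"
    unfolding disjoint_family_on_def using disj by (metis Int_commute nat_neq_iff)
  moreover have "range A \<subseteq> sets M" using piece[OF un] by (auto simp: A_def)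
  ultimately have "(\<lambda>n. \<sigma> (A n)) sums \<sigma> (\<Union>n. A n)" by (intro sums)
  then have "(\<lambda>n. \<sigma> (A n)) \<longlonglongrightarrow> 0" using sums_summable summable_LIMSEQ_zero by blast
  then obtain n where "\<bar>\<sigma> (A n)\<bar> < 1" using LIMSEQ_D[of _ 0 1] by fastforce
  then show False using piece[OF un, of n] by (simp add: A_def)
qed

text \<open>
  Values in the extended nonnegative reals cut off negative \<open>\<sigma> U\<close>; as \<open>U = {}\<close> is admitted, the supremum is the same.
\<close>

definition up :: "'b set \<Rightarrow> ennreal" where
  "up S = (SUP U\<in>{U \<in> sets M. U \<subseteq> S}. ennreal (\<sigma> U))"

lemma up_upper: "U \<in> sets M \<Longrightarrow> U \<subseteq> S \<Longrightarrow> ennreal (\<sigma> U) \<le> up S"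
  unfolding up_def by (intro SUP_upper) auto

lemma up_least: "(\<And>U. U \<in> sets M \<Longrightarrow> U \<subseteq> S \<Longrightarrow> ennreal (\<sigma> U) \<le> c) \<Longrightarrow> up S \<le> c"
  unfolding up_def by (intro SUP_least) auto

lemma up_mono: "S \<subseteq> T \<Longrightarrow> up S \<le> up T"
  by (intro up_least up_upper) auto

lemma up_finite: "up S < \<infinity>"
proof -
  obtain C where C: "\<And>U. U \<in> sets M \<Longrightarrow> \<bar>\<sigma> U\<bar> \<le> C" using bounded by blast
  have "up S \<le> ennreal C" by (intro up_least ennreal_leI) (meson C abs_le_D1)
  then show ?thesis using ennreal_less_top by (metis infinity_ennreal_def le_less_trans)
qed

lemma up_superadditive:
  assumes "S \<inter> T = {}"
  shows "up S + up T \<le> up (S \<union> T)"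
proof -
  have ne: "{U \<in> sets M. U \<subseteq> R} \<noteq> {}" for R by auto
  have *: "ennreal (\<sigma> U) + ennreal (\<sigma> V) \<le> up (S \<union> T)"
    if UV: "U \<in> sets M" "U \<subseteq> S" "V \<in> sets M" "V \<subseteq> T" for U V
  proof -
    consider "\<sigma> U \<le> 0" | "\<sigma> V \<le> 0" | "0 \<le> \<sigma> U" "0 \<le> \<sigma> V" by linarith
    then show ?thesis
    proof cases
      case 1
      then show ?thesis using up_upper[OF UV(3), of "S \<union> T"] UV by (simp add: ennreal_neg le_supI2)
    next
      case 2
      then show ?thesis using up_upper[OF UV(1), of "S \<union> T"] UV by (simp add: ennreal_neg le_supI1)
    next
      case 3
      then have "ennreal (\<sigma> U) + ennreal (\<sigma> V) = ennreal (\<sigma> (U \<union> V))"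
        using UV assms by (subst Un) (auto simp: ennreal_plus)
      also have "\<dots> \<le> up (S \<union> T)" using UV by (intro up_upper) auto
      finally show ?thesis .
    qed
  qed
  have 1: "ennreal (\<sigma> U) + up T \<le> up (S \<union> T)" if "U \<in> sets M" "U \<subseteq> S" for U
    unfolding up_def[of T] ennreal_SUP_add_right[OF ne] using * that by (intro SUP_least) auto
  have "up S + up T = (SUP U\<in>{U \<in> sets M. U \<subseteq> S}. up T + ennreal (\<sigma> U))"
    unfolding up_def[of S] add.commute[of _ "up T"] by (rule ennreal_SUP_add_right[OF ne])
  also have "\<dots> \<le> up (S \<union> T)" using 1 by (intro SUP_least) (auto simp: add.commute)
  finally show ?thesis .
qed

lemma up_countably_additive: "countably_additive (sets M) up"
proof (rule countably_additiveI)
  fix F :: "nat \<Rightarrow> 'b set" assume F: "range F \<subseteq> sets M" "disjoint_family F"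
  have part: "(\<Sum>k<n. up (F k)) \<le> up (\<Union>k<n. F k)" for n
  proof (induction n)
    case (Suc n)
    have "(\<Union>k<n. F k) \<inter> F n = {}"
      using F(2) unfolding disjoint_family_on_def by (auto simp: disjoint_iff) (metis UNIV_I disjoint_iff less_irrefl)
    then have 1: "up (\<Union>k<n. F k) + up (F n) \<le> up ((\<Union>k<n. F k) \<union> F n)" by (rule up_superadditive)
    have 2: "(\<Sum>k<Suc n. up (F k)) \<le> up (\<Union>k<n. F k) + up (F n)"
      using add_right_mono[OF Suc] by simp
    have 3: "(\<Union>k<n. F k) \<union> F n = (\<Union>k<Suc n. F k)" by (simp add: lessThan_Suc Un_commute)
    show ?case using order_trans[OF 2 1] unfolding 3 .
  qed simp
  show "(\<Sum>n. up (F n)) = up (\<Union>n. F n)"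
  proof (rule antisym)
    show "(\<Sum>n. up (F n)) \<le> up (\<Union>n. F n)"
      by (rule suminf_le_const) (auto intro!: order_trans[OF part up_mono])
    show "up (\<Union>n. F n) \<le> (\<Sum>n. up (F n))"
    proof (rule up_least)
      fix U assume U: "U \<in> sets M" "U \<subseteq> (\<Union>n. F n)"
      have "(\<lambda>n. \<sigma> (U \<inter> F n)) sums \<sigma> (\<Union>n. U \<inter> F n)"
        using F U by (intro sums) (auto simp: disjoint_family_on_def)
      moreover have "(\<Union>n. U \<inter> F n) = U" using U(2) by auto
      ultimately have "(\<lambda>n. \<Sum>k<n. \<sigma> (U \<inter> F k)) \<longlonglongrightarrow> \<sigma> U" by (simp add: sums_def)
      then have lim: "(\<lambda>n. ennreal (\<Sum>k<n. \<sigma> (U \<inter> F k))) \<longlonglongrightarrow> ennreal (\<sigma> U)" by (rule tendsto_ennrealI)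
      have "ennreal (\<Sum>k<n. \<sigma> (U \<inter> F k)) \<le> (\<Sum>n. up (F n))" for n
      proof -
        have "ennreal (\<Sum>k<n. \<sigma> (U \<inter> F k)) \<le> ennreal (\<Sum>k<n. max 0 (\<sigma> (U \<inter> F k)))"
          by (intro ennreal_leI sum_mono) simp
        also have "\<dots> = (\<Sum>k<n. ennreal (max 0 (\<sigma> (U \<inter> F k))))" by (intro sum_ennreal[symmetric]) simp
        also have "\<dots> \<le> (\<Sum>k<n. up (F k))"
          using U F by (intro sum_mono) (auto simp: ennreal_max_0' intro!: up_upper)
        also have "\<dots> \<le> (\<Sum>n. up (F n))" by (rule sum_le_suminf) auto
        finally show ?thesis .
      qed
      then show "ennreal (\<sigma> U) \<le> (\<Sum>n. up (F n))" by (intro LIMSEQ_le_const2[OF lim]) auto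
    qed
  qed
qed

lemma sets_upper [simp]: "sets (upper_variation M \<sigma>) = sets M"
  and space_upper [simp]: "space (upper_variation M \<sigma>) = space M"
  unfolding upper_variation_def by (simp_all add: sets.space_closed sets.sigma_sets_eq)

lemma emeasure_upper: "S \<in> sets M \<Longrightarrow> emeasure (upper_variation M \<sigma>) S = up S"
  unfolding upper_variation_def up_def[symmetric]
proof (rule emeasure_measure_of_sigma)
  show "positive (sets M) up"
    unfolding positive_def up_def using empty by (auto simp: SUP_constant intro!: antisym SUP_least)
qed (auto intro: up_countably_additive sets.sigma_algebra_axioms)

lemma finite_upper: "finite_measure (upper_variation M \<sigma>)"
  using up_finite[of "space M"] by (intro finite_measureI) (simp add: emeasure_upper)

end

lemma signed_measure_uminus:
  assumes "signed_measure M \<sigma>"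
  shows "signed_measure M (\<lambda>S. - \<sigma> S)"
  using signed_measure.sums[OF assms] by unfold_locales (auto intro: sums_minus)

text \<open>
  \<open>\<sigma>\<^sup>+(S) = sup \<sigma>(U) = sup (\<sigma>(S) - \<sigma>(S - U)) = \<sigma>(S) + \<sigma>\<^sup>-(S)\<close>, the suprema being over \<open>U \<subseteq> S\<close>.
\<close>

theorem Jordan_decomposition:
  assumes \<sigma>: "signed_measure M \<sigma>" and S: "S \<in> sets M"
  shows "\<sigma> S = measure (upper_variation M \<sigma>) S - measure (upper_variation M (\<lambda>S. - \<sigma> S)) S"
proof -
  have le: "measure (upper_variation M \<tau>) S \<le> \<tau> S + measure (upper_variation M (\<lambda>S. - \<tau> S)) S"
    if \<tau>: "signed_measure M \<tau>" for \<tau>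
  proof -
    interpret p: signed_measure M \<tau> by fact
    interpret n: signed_measure M "\<lambda>S. - \<tau> S" by (rule signed_measure_uminus[OF \<tau>])
    let ?p = "measure (upper_variation M \<tau>) S" and ?n = "measure (upper_variation M (\<lambda>S. - \<tau> S)) S"
    have en: "n.up S = ennreal ?n"
      using n.emeasure_upper[OF S] finite_measure.emeasure_eq_measure[OF n.finite_upper] by metis
    have ep: "p.up S = ennreal ?p"
      using p.emeasure_upper[OF S] finite_measure.emeasure_eq_measure[OF p.finite_upper] by metis
    have bound: "\<tau> U \<le> \<tau> S + ?n" if U: "U \<in> sets M" "U \<subseteq> S" for U
    proof -
      have "ennreal (- \<tau> (S - U)) \<le> ennreal ?n" unfolding en[symmetric] using S U by (intro n.up_upper) auto
      then have "- \<tau> (S - U) \<le> ?n"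
        using measure_nonneg[of "upper_variation M (\<lambda>S. - \<tau> S)" S] by (auto simp: ennreal_le_iff2)
      then show ?thesis using p.Diff[OF U(1) S U(2)] by linarith
    qed
    have nn: "0 \<le> \<tau> S + ?n" using bound[of "{}"] p.empty by simp
    have "p.up S \<le> ennreal (\<tau> S + ?n)" using bound by (intro p.up_least ennreal_leI)
    then show ?thesis using nn unfolding ep by (simp add: ennreal_le_iff)
  qed
  show ?thesis
    using le[OF \<sigma>] le[OF signed_measure_uminus[OF \<sigma>]] by simp
qed

lemma complex_measure_signed:
  assumes "complex_measure M \<mu>"
  shows "signed_measure M (\<lambda>S. Re (\<mu> S))" "signed_measure M (\<lambda>S. Im (\<mu> S))"
  using assms unfolding complex_measure_def
  by (unfold_locales; (intro sums_Re sums_Im; blast))+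

text \<open>
  A finite signed combination of measures which vanishes on all sets annihilates bounded functions: approximate the
  function by its truncations to multiples of \<open>1/N\<close>.
\<close>

theorem integral_combination_zero:
  fixes m :: "'i \<Rightarrow> 'b measure" and f :: "'b \<Rightarrow> real"
  assumes I: "finite I" and fin: "\<And>i. i \<in> I \<Longrightarrow> finite_measure (m i)" and sets: "\<And>i. i \<in> I \<Longrightarrow> sets (m i) = sets M"
    and zero: "\<And>S. S \<in> sets M \<Longrightarrow> (\<Sum>i\<in>I. r i * measure (m i) S) = 0"
    and f: "f \<in> borel_measurable M" and bd: "\<And>x. x \<in> space M \<Longrightarrow> \<bar>f x\<bar> \<le> B"
  shows "(\<Sum>i\<in>I. r i * (\<integral>x. f x \<partial>m i)) = 0"
proof -
  have space: "space (m i) = space M" if "i \<in> I" for i using sets_eq_imp_space_eq[OF sets[OF that]] .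
  define C where "C = (\<Sum>i\<in>I. \<bar>r i\<bar> * measure (m i) (space M))"
  have step: "\<bar>\<Sum>i\<in>I. r i * (\<integral>x. f x \<partial>m i)\<bar> \<le> C * (1 / real (Suc N))" for N
  proof -
    define n where "n = real (Suc N)"
    have n: "n > 0" by (simp add: n_def)
    define A where "A k = {x \<in> space M. \<lfloor>n * f x\<rfloor> = k}" for k :: int
    define K where "K = {\<lfloor>- n * B\<rfloor>..\<lfloor>n * B\<rfloor>}"
    have A: "A k \<in> sets M" for k unfolding A_def using f by measurable
    define g where "g x = (\<Sum>k\<in>K. of_int k / n * indicator (A k) x)" for x
    have g_eq: "g x = of_int \<lfloor>n * f x\<rfloor> / n" if x: "x \<in> space M" for x
    proof -
      have "- n * B \<le> n * f x" "n * f x \<le> n * B" 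
        using bd[OF x] n mult_left_mono[of "- B" "f x" n] mult_left_mono[of "f x" B n] by (auto simp: abs_le_iff)
      then have "\<lfloor>n * f x\<rfloor> \<in> K" unfolding K_def by (auto intro: floor_mono)
      moreover have "g x = (\<Sum>k\<in>K. if k = \<lfloor>n * f x\<rfloor> then of_int k / n else 0)"
        unfolding g_def using x by (intro sum.cong) (auto simp: A_def indicator_def)
      ultimately show ?thesis by (simp add: K_def)
    qed
    have close: "\<bar>f x - g x\<bar> \<le> 1 / n" if "x \<in> space M" for x
    proof -
      have "of_int \<lfloor>n * f x\<rfloor> \<le> n * f x" "n * f x \<le> of_int \<lfloor>n * f x\<rfloor> + 1" by linarith+
      then have "\<bar>n * f x - of_int \<lfloor>n * f x\<rfloor>\<bar> \<le> 1" by linarith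
      moreover have "f x - g x = (n * f x - of_int \<lfloor>n * f x\<rfloor>) / n" using n by (simp add: g_eq[OF that] diff_divide_distrib)
      ultimately show ?thesis using n by (simp add: abs_divide divide_right_mono)
    qed
    have int_A: "integrable (m i) (\<lambda>x. of_int k / n * indicator (A k) x)" if "i \<in> I" for i k
      using A sets[OF that] finite_measure.emeasure_finite[OF fin[OF that]]
      by (intro integrable_mult_right integrable_real_indicator) (auto simp: less_top)
    have int_f: "integrable (m i) f" if "i \<in> I" for i
      using f bd space[OF that] sets[OF that] measurable_cong_sets[OF sets[OF that] refl]
      by (intro finite_measure.integrable_const_bound[OF fin[OF that], of _ B]) auto
    have int_g: "(\<integral>x. g x \<partial>m i) = (\<Sum>k\<in>K. of_int k / n * measure (m i) (A k))" if "i \<in> I" for i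
    proof -
      have "A k \<subseteq> space M" for k by (auto simp: A_def)
      then show ?thesis
        unfolding g_def using that
        by (subst Bochner_Integration.integral_sum[OF int_A]) (auto simp: space Int_absorb2 intro!: sum.cong)
    qed
    have "(\<Sum>i\<in>I. r i * (\<integral>x. g x \<partial>m i)) = (\<Sum>k\<in>K. of_int k / n * (\<Sum>i\<in>I. r i * measure (m i) (A k)))"
      by (simp add: int_g sum_distrib_left sum.swap[of _ K I] ac_simps)
    also have "\<dots> = 0" by (simp add: zero A)
    finally have "\<bar>\<Sum>i\<in>I. r i * (\<integral>x. f x \<partial>m i)\<bar> = \<bar>\<Sum>i\<in>I. r i * ((\<integral>x. f x \<partial>m i) - (\<integral>x. g x \<partial>m i))\<bar>"
      by (simp add: right_diff_distrib sum_subtractf)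
    also have "\<dots> \<le> (\<Sum>i\<in>I. \<bar>r i\<bar> * (measure (m i) (space M) * (1 / n)))"
    proof (rule order_trans[OF sum_abs sum_mono])
      fix i assume i: "i \<in> I"
      interpret finite_measure "m i" by (rule fin[OF i])
      have ig: "integrable (m i) g" unfolding g_def using i by (intro Bochner_Integration.integrable_sum int_A)
      have "\<bar>(\<integral>x. f x \<partial>m i) - (\<integral>x. g x \<partial>m i)\<bar> = \<bar>\<integral>x. f x - g x \<partial>m i\<bar>" using int_f[OF i] ig by simp
      also have "\<dots> \<le> (\<integral>x. \<bar>f x - g x\<bar> \<partial>m i)" by (rule integral_abs_bound)
      also have "\<dots> \<le> (\<integral>x. 1 / n \<partial>m i)" using int_f[OF i] ig close space[OF i] by (intro integral_mono) auto
      also have "\<dots> = measure (m i) (space M) * (1 / n)" using space[OF i] by simp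
      finally show "\<bar>r i * ((\<integral>x. f x \<partial>m i) - (\<integral>x. g x \<partial>m i))\<bar> \<le> \<bar>r i\<bar> * (measure (m i) (space M) * (1 / n))"
        unfolding abs_mult by (intro mult_left_mono) auto
    qed
    also have "\<dots> = C * (1 / n)" by (simp add: C_def sum_divide_distrib)
    finally show ?thesis by (simp add: n_def)
  qed
  have "(\<lambda>N. C * (1 / real (Suc N))) \<longlonglongrightarrow> C * 0"
    using LIMSEQ_inverse_real_of_nat by (intro tendsto_intros) (simp add: inverse_eq_divide)
  then have "\<bar>\<Sum>i\<in>I. r i * (\<integral>x. f x \<partial>m i)\<bar> \<le> C * 0" using step by (intro LIMSEQ_le_const) auto
  then show ?thesis by simp
qed

section \<open>Polarization of the averaged moments\<close>

lemma (in form_space) symop_funpow: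
  assumes "symop T"
  shows "symop (T ^^ n)"
proof (induction n)
  case 0
  have "T ^^ 0 = (\<lambda>x. x)" by (rule ext) simp
  then show ?case by (simp only: symop_id)
next
  case (Suc n)
  have "symop (\<lambda>x. T ((T ^^ n) x))" by (rule symop_comp[OF assms Suc]) (simp add: funpow_swap1)
  moreover have "T ^^ Suc n = (\<lambda>x. T ((T ^^ n) x))" by (rule ext) simp
  ultimately show ?case by (simp only:)
qed

context commuting_quadruple
begin

definition monomial_op :: "nat \<Rightarrow> nat \<Rightarrow> nat \<Rightarrow> nat \<Rightarrow> 'a \<Rightarrow> 'a" where
  "monomial_op p p' r r' x = (L1 ^^ p) ((R1 ^^ p') ((L2 ^^ r) ((R2 ^^ r') x)))"

lemmas commute_pow = funpow_commute[of L1 R1, OF comm(1)] funpow_commute[of L1 L2, OF comm(2)]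
  funpow_commute[of L1 R2, OF comm(3)] funpow_commute[of R1 L2, OF comm(4)]
  funpow_commute[of R1 R2, OF comm(5)] funpow_commute[of L2 R2, OF comm(6)]

lemma symop_monomial_op: "symop (monomial_op p p' r r')"
proof -
  have 1: "symop (\<lambda>x. (L2 ^^ r) ((R2 ^^ r') x))"
    by (rule symop_comp[OF symop_funpow[OF symops(3)] symop_funpow[OF symops(4)]]) (rule commute_pow(6))
  have 2: "symop (\<lambda>x. (R1 ^^ p') ((L2 ^^ r) ((R2 ^^ r') x)))"
    by (rule symop_comp[OF symop_funpow[OF symops(2)] 1]) (simp only: commute_pow(4,5))
  show ?thesis
    unfolding monomial_op_def[abs_def]
    by (rule symop_comp[OF symop_funpow[OF symops(1)] 2]) (simp only: commute_pow(1-3))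
qed

lemma q_monomial_op:
  assumes "X \<in> V" "Y \<in> V"
  shows "q Y (monomial_op p p' r r' X) = q ((L2 ^^ r) ((R2 ^^ r') Y)) ((L1 ^^ p) ((R1 ^^ p') X))"
proof -
  note s = symopD[OF symop_funpow[OF symops(1)]] symopD[OF symop_funpow[OF symops(2)]]
    symopD[OF symop_funpow[OF symops(3)]] symopD[OF symop_funpow[OF symops(4)]]
  have "monomial_op p p' r r' X = (L2 ^^ r) ((R2 ^^ r') ((L1 ^^ p) ((R1 ^^ p') X)))"
    by (simp only: monomial_op_def commute_pow)
  moreover have "q Y ((L2 ^^ r) ((R2 ^^ r') Z)) = q ((L2 ^^ r) ((R2 ^^ r') Y)) Z" if "Z \<in> V" for Z
    using that assms s by (simp add: commute_pow(6))
  ultimately show ?thesis using s assms by simp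
qed

text \<open>
  For symmetric \<open>T\<close> one has \<open>4 q Y (T X) = q (X + Y) (T (X + Y)) - q (X - Y) (T (X - Y))\<close>, so the positive measures for the
  vectors \<open>X + Y\<close> and \<open>X - Y\<close> give the moments for the pair.
\<close>

theorem bilinear_moment_measures:
  assumes X: "X \<in> V" and Y: "Y \<in> V"
  shows "\<exists>\<nu>1 \<nu>2. finite_measure \<nu>1 \<and> sets \<nu>1 = sets (borel_square a b) \<and>
     finite_measure \<nu>2 \<and> sets \<nu>2 = sets (borel_square a b) \<and>
     (\<forall>i j. real (Suc i) * real (Suc j) *
        ((\<integral>p. fst p ^ i * snd p ^ j \<partial>\<nu>1) - (\<integral>p. fst p ^ i * snd p ^ j \<partial>\<nu>2)) / 4
      = q (\<Sum>r\<le>j. (L2 ^^ r) ((R2 ^^ (j - r)) Y)) (\<Sum>p\<le>i. (L1 ^^ p) ((R1 ^^ (i - p)) X)))"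
proof -
  obtain \<nu>1 where \<nu>1: "finite_measure \<nu>1" "sets \<nu>1 = sets (borel_square a b)"
    and m1: "\<And>i j. real (Suc i) * real (Suc j) * (\<integral>p. fst p ^ i * snd p ^ j \<partial>\<nu>1)
        = (\<Sum>p\<le>i. \<Sum>r\<le>j. q (X + Y) (monomial_op p (i - p) r (j - r) (X + Y)))"
    using averaged_moment_measure[of "X + Y"] X Y unfolding monomial_op_def by auto
  obtain \<nu>2 where \<nu>2: "finite_measure \<nu>2" "sets \<nu>2 = sets (borel_square a b)"
    and m2: "\<And>i j. real (Suc i) * real (Suc j) * (\<integral>p. fst p ^ i * snd p ^ j \<partial>\<nu>2)
        = (\<Sum>p\<le>i. \<Sum>r\<le>j. q (X - Y) (monomial_op p (i - p) r (j - r) (X - Y)))"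
    using averaged_moment_measure[of "X - Y"] X Y unfolding monomial_op_def by auto
  have "real (Suc i) * real (Suc j) * ((\<integral>p. fst p ^ i * snd p ^ j \<partial>\<nu>1) - (\<integral>p. fst p ^ i * snd p ^ j \<partial>\<nu>2)) / 4
      = q (\<Sum>r\<le>j. (L2 ^^ r) ((R2 ^^ (j - r)) Y)) (\<Sum>p\<le>i. (L1 ^^ p) ((R1 ^^ (i - p)) X))" for i j
  proof -
    have pol: "q (X + Y) (T (X + Y)) - q (X - Y) (T (X - Y)) = 4 * q Y (T X)" if T: "symop T" for T
    proof -
      have "q X (T Y) = q Y (T X)" using symopD[OF T] X Y q_commute[of "T X" Y] by simp
      then show ?thesis
        using symopD[OF T] X Y by (simp add: q_add q_add_right q_diff q_diff_right)
    qed
    have fV: "(T ^^ n) Z \<in> V" if "symop T" "Z \<in> V" for T n Z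
      using symopD(2)[OF symop_funpow[OF that(1)] that(2)] .
    have inV: "(L1 ^^ p) ((R1 ^^ p') X) \<in> V" "(L2 ^^ p) ((R2 ^^ p') Y) \<in> V" for p p'
      using X Y symops by (auto intro!: fV)
    have "real (Suc i) * real (Suc j) * ((\<integral>p. fst p ^ i * snd p ^ j \<partial>\<nu>1) - (\<integral>p. fst p ^ i * snd p ^ j \<partial>\<nu>2))
       = (\<Sum>p\<le>i. \<Sum>r\<le>j. 4 * q Y (monomial_op p (i - p) r (j - r) X))"
      unfolding right_diff_distrib m1 m2 sum_subtractf[symmetric]
      by (intro sum.cong refl pol symop_monomial_op)
    also have "\<dots> = 4 * (\<Sum>p\<le>i. \<Sum>r\<le>j. q ((L2 ^^ r) ((R2 ^^ (j - r)) Y)) ((L1 ^^ p) ((R1 ^^ (i - p)) X)))"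
      by (simp add: sum_distrib_left q_monomial_op X Y)
    also have "(\<Sum>p\<le>i. \<Sum>r\<le>j. q ((L2 ^^ r) ((R2 ^^ (j - r)) Y)) ((L1 ^^ p) ((R1 ^^ (i - p)) X)))
       = q (\<Sum>r\<le>j. (L2 ^^ r) ((R2 ^^ (j - r)) Y)) (\<Sum>p\<le>i. (L1 ^^ p) ((R1 ^^ (i - p)) X))"
    proof -
      let ?S = "\<Sum>r\<le>j. (L2 ^^ r) ((R2 ^^ (j - r)) Y)"
      have S: "?S \<in> V" by (intro subspace_sum[OF subspace_V] inV)
      have "(\<Sum>r\<le>j. q ((L2 ^^ r) ((R2 ^^ (j - r)) Y)) Z) = q ?S Z" if "Z \<in> V" for Z
      proof -
        have "(\<Sum>r\<le>j. q ((L2 ^^ r) ((R2 ^^ (j - r)) Y)) Z) = (\<Sum>r\<le>j. q Z ((L2 ^^ r) ((R2 ^^ (j - r)) Y)))"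
          using that inV by (intro sum.cong refl q_commute)
        also have "\<dots> = q Z ?S" using that inV by (intro q_sum_right[symmetric])
        also have "\<dots> = q ?S Z" using that S by (rule q_commute)
        finally show ?thesis .
      qed
      then have "(\<Sum>p\<le>i. \<Sum>r\<le>j. q ((L2 ^^ r) ((R2 ^^ (j - r)) Y)) ((L1 ^^ p) ((R1 ^^ (i - p)) X)))
        = (\<Sum>p\<le>i. q ?S ((L1 ^^ p) ((R1 ^^ (i - p)) X)))" using inV by simp
      also have "\<dots> = q ?S (\<Sum>p\<le>i. (L1 ^^ p) ((R1 ^^ (i - p)) X))" using S inV by (intro q_sum_right[symmetric])
      finally show ?thesis .
    qed
    finally show ?thesis by simp
  qed
  then show ?thesis using \<nu>1 \<nu>2 by blast
qed

end

section \<open>Traces of products of differences of powers\<close>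

lemma op_pow_diff_telescope:
  "(\<Sum>p\<le>n. op_pow A p o\<^sub>L ((A - C) o\<^sub>L op_pow C (n - p))) = op_pow A (Suc n) - op_pow C (Suc n)"
proof (induction n)
  case 0
  then show ?case by simp
next
  case (Suc n)
  have "(\<Sum>p\<le>Suc n. op_pow A p o\<^sub>L ((A - C) o\<^sub>L op_pow C (Suc n - p)))
     = ((A - C) o\<^sub>L op_pow C (Suc n)) + (A o\<^sub>L (\<Sum>p\<le>n. op_pow A p o\<^sub>L ((A - C) o\<^sub>L op_pow C (n - p))))"
    by (simp only: sum.atMost_Suc_shift) (simp add: blinfun_comp.sum_right blinfun_compose_assoc)
  then show ?case unfolding Suc by (simp add: blinfun_comp.diff_left blinfun_comp.diff_right)
qed

lemma funpow_left: "((\<lambda>X. A o\<^sub>L X) ^^ n) X = op_pow A n o\<^sub>L X"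
  by (induction n) (simp_all add: blinfun_compose_assoc)

lemma op_pow_Suc_right: "op_pow A (Suc n) = op_pow A n o\<^sub>L A"
  by (rule blinfun_eqI) (simp add: op_pow_commute)

lemma funpow_right: "((\<lambda>X. X o\<^sub>L A) ^^ n) X = X o\<^sub>L op_pow A n"
  by (induction n) (simp_all add: blinfun_compose_assoc op_pow_Suc_right[simplified])

lemma selfadjoint_op_pow: "selfadjoint_op A \<Longrightarrow> selfadjoint_op (op_pow A n)"
proof (induction n)
  case 0
  then show ?case by (simp add: selfadjoint_op_def clinear_id)
next
  case (Suc n)
  then show ?case
    unfolding op_pow_Suc_right
    by (auto simp: selfadjoint_op_def clinear_op_def) (metis op_pow_commute)
qed

lemma selfadjoint_op_diff: "selfadjoint_op A \<Longrightarrow> selfadjoint_op B \<Longrightarrow> selfadjoint_op (A - B)"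
  by (auto simp: selfadjoint_op_def clinear_diff blinfun.diff_left cinner_diff_left cinner_diff_right)

lemma HS_power_diff:
  assumes B: "is_onb B" and A: "selfadjoint_op A" and C: "selfadjoint_op C" and AC: "A - C \<in> HS B"
  shows "op_pow A n - op_pow C n \<in> HS B"
proof (cases n)
  case 0
  then show ?thesis by (simp add: HS_zero)
next
  case (Suc k)
  have cl: "clinear_op (op_pow A p)" "clinear_op (op_pow C p)" for p
    using selfadjoint_op_pow[OF A] selfadjoint_op_pow[OF C] by (auto simp: selfadjoint_op_def)
  show ?thesis
    unfolding Suc op_pow_diff_telescope[symmetric]
    by (intro subspace_sum[OF subspace_HS] HS_compose_left HS_compose_right B AC cl)
qed

text \<open>
  The basis is a parameter: the form on the Hilbert-Schmidt class is computed in it, and so is the trace.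
\<close>

locale commuting_pairs =
  fixes H1 H2 H10 H20 :: "'a::chilbert_space bop" and a b :: real and B :: "'a set"
  assumes ab: "a \<le> b" and B: "is_onb B"
    and H: "spectrum_in H1 a b" "spectrum_in H2 a b" "spectrum_in H10 a b" "spectrum_in H20 a b"
    and comm: "H10 o\<^sub>L H20 = H20 o\<^sub>L H10" "H1 o\<^sub>L H2 = H2 o\<^sub>L H1"
    and HS: "H1 - H10 \<in> HS B" "H2 - H20 \<in> HS B"
begin

definition P :: "nat \<Rightarrow> 'a bop" where "P i = op_pow H1 i - op_pow H10 i"
definition Q :: "nat \<Rightarrow> 'a bop" where "Q j = op_pow H2 j - op_pow H20 j"
definition trace_PQ :: "nat \<Rightarrow> nat \<Rightarrow> real" where "trace_PQ i j = Re (hs B (Q j) (P i))"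

lemma selfadjoint: "selfadjoint_op H1" "selfadjoint_op H2" "selfadjoint_op H10" "selfadjoint_op H20"
  using H by (auto simp: spectrum_in_def)

lemma range_bounds:
  assumes "spectrum_in A a b"
  shows "a * inner x x \<le> inner x (A x)" "inner x (A x) \<le> b * inner x x"
  using assms numerical_range_lower numerical_range_upper by (auto simp: spectrum_in_def)

lemma P_HS: "P i \<in> HS B" and Q_HS: "Q i \<in> HS B"
  unfolding P_def Q_def by (intro HS_power_diff B selfadjoint HS)+

lemma P_selfadjoint: "selfadjoint_op (P i)" and Q_selfadjoint: "selfadjoint_op (Q i)"
  unfolding P_def Q_def by (intro selfadjoint_op_diff selfadjoint_op_pow selfadjoint)+

lemma hs_QP: "hs B (Q j) (P i) = complex_of_real (trace_PQ i j)"
  unfolding trace_PQ_def by (rule hs_selfadjoint_real[OF B Q_HS P_HS Q_selfadjoint P_selfadjoint])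

lemma hs_PQ: "hs B (P i) (Q j) = complex_of_real (trace_PQ i j)"
  using hs_adj[OF B P_HS Q_HS, of i j] by (simp add: adj_selfadjoint P_selfadjoint Q_selfadjoint hs_QP)

lemma trace_PQ_0: "trace_PQ 0 j = 0" "trace_PQ i 0 = 0"
  by (simp_all add: trace_PQ_def P_def Q_def hs_def)

text \<open>
  By telescoping, \<open>P (i + 1)\<close> and \<open>Q (j + 1)\<close> are the sums of \<open>H\<^sub>1\<^sup>p V\<^sub>1 (H\<^sub>1\<^sup>0)\<^sup>i\<^sup>-\<^sup>p\<close> and \<open>H\<^sub>2\<^sup>r V\<^sub>2 (H\<^sub>2\<^sup>0)\<^sup>j\<^sup>-\<^sup>r\<close>.  Left and right
  multiplications always commute with each other; the hypotheses on the two pairs supply the two remaining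
  commutation relations.
\<close>

theorem trace_moment_measures:
  "\<exists>\<nu>1 \<nu>2. finite_measure \<nu>1 \<and> sets \<nu>1 = sets (borel_square a b) \<and>
     finite_measure \<nu>2 \<and> sets \<nu>2 = sets (borel_square a b) \<and>
     (\<forall>i j. trace_PQ (Suc i) (Suc j) = real (Suc i) * real (Suc j) *
        ((\<integral>p. fst p ^ i * snd p ^ j \<partial>\<nu>1) - (\<integral>p. fst p ^ i * snd p ^ j \<partial>\<nu>2)) / 4)"
proof (cases "a < b")
  case True
  interpret quad: commuting_quadruple "HS B" "\<lambda>X Y. Re (hs B X Y)" "\<lambda>X. H1 o\<^sub>L X" "\<lambda>X. X o\<^sub>L H10"
    "\<lambda>X. H2 o\<^sub>L X" "\<lambda>X. X o\<^sub>L H20" a b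
  proof (intro commuting_quadruple.intro form_space_HS commuting_quadruple_axioms.intro True)
    note left = between_left[where a = a and b = b and B = B] and right = between_right[OF B, where a = a and b = b]
    show "form_space.between (HS B) (\<lambda>X Y. Re (hs B X Y)) a b (\<lambda>X. H1 o\<^sub>L X)"
      by (rule left[OF selfadjoint(1) range_bounds[OF H(1)]])
    show "form_space.between (HS B) (\<lambda>X Y. Re (hs B X Y)) a b (\<lambda>X. H2 o\<^sub>L X)"
      by (rule left[OF selfadjoint(2) range_bounds[OF H(2)]])
    show "form_space.between (HS B) (\<lambda>X Y. Re (hs B X Y)) a b (\<lambda>X. X o\<^sub>L H10)"
      by (rule right[OF selfadjoint(3) range_bounds[OF H(3)]])
    show "form_space.between (HS B) (\<lambda>X Y. Re (hs B X Y)) a b (\<lambda>X. X o\<^sub>L H20)"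
      by (rule right[OF selfadjoint(4) range_bounds[OF H(4)]])
    show "H1 o\<^sub>L (X o\<^sub>L H10) = (H1 o\<^sub>L X) o\<^sub>L H10" for X by (simp add: blinfun_compose_assoc)
    show "H1 o\<^sub>L (H2 o\<^sub>L X) = H2 o\<^sub>L (H1 o\<^sub>L X)" for X by (simp add: comm(2) flip: blinfun_compose_assoc)
    show "H1 o\<^sub>L (X o\<^sub>L H20) = (H1 o\<^sub>L X) o\<^sub>L H20" for X by (simp add: blinfun_compose_assoc)
    show "(H2 o\<^sub>L X) o\<^sub>L H10 = H2 o\<^sub>L (X o\<^sub>L H10)" for X by (simp add: blinfun_compose_assoc)
    show "(X o\<^sub>L H20) o\<^sub>L H10 = (X o\<^sub>L H10) o\<^sub>L H20" for X by (simp add: comm(1) blinfun_compose_assoc)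
    show "H2 o\<^sub>L (X o\<^sub>L H20) = (H2 o\<^sub>L X) o\<^sub>L H20" for X by (simp add: blinfun_compose_assoc)
  qed
  have P: "(\<Sum>p\<le>i. ((\<lambda>X. H1 o\<^sub>L X) ^^ p) (((\<lambda>X. X o\<^sub>L H10) ^^ (i - p)) (H1 - H10))) = P (Suc i)" for i
    unfolding funpow_left funpow_right P_def by (rule op_pow_diff_telescope)
  have Q: "(\<Sum>r\<le>j. ((\<lambda>X. H2 o\<^sub>L X) ^^ r) (((\<lambda>X. X o\<^sub>L H20) ^^ (j - r)) (H2 - H20))) = Q (Suc j)" for j
    unfolding funpow_left funpow_right Q_def by (rule op_pow_diff_telescope)
  have "trace_PQ (Suc i) (Suc j) = Re (hs B (Q (Suc j)) (P (Suc i)))" for i j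
    by (simp add: trace_PQ_def)
  then show ?thesis
    using quad.bilinear_moment_measures[OF HS] unfolding P Q by (simp only: eq_commute)
next
  case False
  then have eq: "a = b" using ab by simp
  \<comment> \<open>If the interval is a point then all operators are scalar and both differences vanish.\<close>
  have scalar: "A = a *\<^sub>R id_blinfun" if "spectrum_in A a b" for A
  proof -
    have sa: "inner (A x) y = inner x (A y)" for x y
      using that selfadjoint_op_iff_inner by (auto simp: spectrum_in_def)
    have "inner x (A x) = a * inner x x" for x using range_bounds[OF that, of x] eq by simp
    then have "norm (A - a *\<^sub>R id_blinfun) \<le> 0"
      by (intro norm_symmetric_le)
         (simp_all add: sa blinfun.diff_left blinfun.scaleR_left inner_diff_left inner_diff_right)
    then show ?thesis by simp
  qed
  have "H1 = H10" by (rule trans[OF scalar[OF H(1)] scalar[OF H(3), symmetric]])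
  then have "P i = 0" for i unfolding P_def by simp
  then have "trace_PQ i j = 0" for i j by (simp add: trace_PQ_def hs_def)
  then show ?thesis
    by (intro exI[of _ "null_measure (borel_square a b)"]) (auto intro!: finite_measureI)
qed

end

section \<open>Integrals of polynomials against a complex measure\<close>

definition complex_moment :: "real \<Rightarrow> real \<Rightarrow> ((real \<times> real) set \<Rightarrow> complex) \<Rightarrow> nat \<Rightarrow> nat \<Rightarrow> complex" where
  "complex_moment a b \<mu> i j = complex_integral (borel_square a b) \<mu> (\<lambda>p. complex_of_real (fst p ^ i * snd p ^ j))"

locale complex_measure_square =
  fixes a b :: real and \<mu> :: "(real \<times> real) set \<Rightarrow> complex"
  assumes \<mu>: "complex_measure (borel_square a b) \<mu>"
begin

sublocale re: signed_measure "borel_square a b" "\<lambda>S. Re (\<mu> S)" by (rule complex_measure_signed(1)[OF \<mu>])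
sublocale re_neg: signed_measure "borel_square a b" "\<lambda>S. - Re (\<mu> S)"
  by (rule signed_measure_uminus[OF complex_measure_signed(1)[OF \<mu>]])
sublocale im: signed_measure "borel_square a b" "\<lambda>S. Im (\<mu> S)" by (rule complex_measure_signed(2)[OF \<mu>])
sublocale im_neg: signed_measure "borel_square a b" "\<lambda>S. - Im (\<mu> S)"
  by (rule signed_measure_uminus[OF complex_measure_signed(2)[OF \<mu>]])

lemmas integrable_parts =
  continuous_integrable_square[OF re.finite_upper re.sets_upper]
  continuous_integrable_square[OF re_neg.finite_upper re_neg.sets_upper]
  continuous_integrable_square[OF im.finite_upper im.sets_upper]
  continuous_integrable_square[OF im_neg.finite_upper im_neg.sets_upper]

lemma complex_integral_add:
  assumes "continuous_on UNIV f" "continuous_on UNIV g"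
  shows "complex_integral (borel_square a b) \<mu> (\<lambda>p. f p + g p)
    = complex_integral (borel_square a b) \<mu> f + complex_integral (borel_square a b) \<mu> g"
  using assms integrable_parts[where 'b = complex]
  by (simp add: complex_integral_def algebra_simps)

lemma complex_integral_cmult:
  "complex_integral (borel_square a b) \<mu> (\<lambda>p. c * f p) = c * complex_integral (borel_square a b) \<mu> f"
  by (simp add: complex_integral_def algebra_simps)

lemma complex_integral_sum:
  assumes "finite K" "\<And>k. k \<in> K \<Longrightarrow> continuous_on UNIV (f k)"
  shows "complex_integral (borel_square a b) \<mu> (\<lambda>p. \<Sum>k\<in>K. c k * f k p)
    = (\<Sum>k\<in>K. c k * complex_integral (borel_square a b) \<mu> (f k))"
  using assms
proof (induction K rule: finite_induct)
  case empty
  then show ?case by (simp add: complex_integral_def)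
next
  case (insert k K)
  have "continuous_on UNIV (\<lambda>p. c k * f k p)" "continuous_on UNIV (\<lambda>p. \<Sum>k\<in>K. c k * f k p)"
    using insert by (auto intro!: continuous_intros)
  then show ?case using insert by (simp add: complex_integral_add complex_integral_cmult)
qed

lemma complex_integral_monomials:
  assumes "finite K"
  shows "complex_integral (borel_square a b) \<mu> (\<lambda>p. \<Sum>k\<in>K. c k * complex_of_real (fst p ^ e k * snd p ^ f k))
    = (\<Sum>k\<in>K. c k * complex_moment a b \<mu> (e k) (f k))"
  unfolding complex_moment_def
  by (rule complex_integral_sum[OF assms]) (intro continuous_intros)

lemma complex_integral_of_real:
  fixes g :: "real \<times> real \<Rightarrow> real"
  shows "complex_integral (borel_square a b) \<mu> (\<lambda>p. complex_of_real (g p))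
    = Complex ((\<integral>p. g p \<partial>upper_variation (borel_square a b) (\<lambda>S. Re (\<mu> S)))
         - (\<integral>p. g p \<partial>upper_variation (borel_square a b) (\<lambda>S. - Re (\<mu> S))))
       ((\<integral>p. g p \<partial>upper_variation (borel_square a b) (\<lambda>S. Im (\<mu> S)))
         - (\<integral>p. g p \<partial>upper_variation (borel_square a b) (\<lambda>S. - Im (\<mu> S))))"
  by (simp add: complex_integral_def Complex_eq)

end

text \<open>
  Polynomials on the plane as lists of coefficients with exponents; repeated exponents are harmless and make products
  easy to form.
\<close>

lemma real_polynomial_function_pair:
  fixes g :: "real \<times> real \<Rightarrow> real"
  assumes "real_polynomial_function g"
  shows "\<exists>L :: (real \<times> nat \<times> nat) list. g = (\<lambda>p. \<Sum>(c, i, j)\<leftarrow>L. c * (fst p ^ i * snd p ^ j))"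
  using assms
proof (induction rule: real_polynomial_function.induct)
  case (linear f)
  then interpret bounded_linear f .
  have F: "f p = f (1, 0) * fst p + f (0, 1) * snd p" for p
  proof -
    have "p = fst p *\<^sub>R (1, 0) + snd p *\<^sub>R (0, 1)" by (simp add: prod_eq_iff)
    then have "f p = f (fst p *\<^sub>R (1, 0) + snd p *\<^sub>R (0, 1))" by simp
    then show ?thesis by (simp only: add scaleR) (simp add: mult.commute)
  qed
  have "f = (\<lambda>p. \<Sum>(c, i, j)\<leftarrow>[(f (1, 0), 1, 0), (f (0, 1), 0, 1)]. c * (fst p ^ i * snd p ^ j))"
    by (rule ext, subst F) simp
  then show ?case by (rule exI)
next
  case (const c)
  then show ?case by (intro exI[of _ "[(c, 0, 0)]"]) (simp add: fun_eq_iff)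
next
  case (add f g)
  then obtain L L' where "f = (\<lambda>p. \<Sum>(c, i, j)\<leftarrow>L. c * (fst p ^ i * snd p ^ j))"
    "g = (\<lambda>p. \<Sum>(c, i, j)\<leftarrow>L'. c * (fst p ^ i * snd p ^ j))" by blast
  then show ?case by (intro exI[of _ "L @ L'"]) (simp add: fun_eq_iff)
next
  case (mult f g)
  then obtain L L' where L: "f = (\<lambda>p. \<Sum>(c, i, j)\<leftarrow>L. c * (fst p ^ i * snd p ^ j))"
    "g = (\<lambda>p. \<Sum>(c, i, j)\<leftarrow>L'. c * (fst p ^ i * snd p ^ j))" by blast
  have one: "(\<Sum>(d, k, l)\<leftarrow>map (\<lambda>(d, k, l). (c * d, i + k, j + l)) M. d * (x ^ k * y ^ l))
    = c * (x ^ i * y ^ j) * (\<Sum>(d, k, l)\<leftarrow>M. d * (x ^ k * y ^ l))" for c x y :: real and i j and M :: "(real \<times> nat \<times> nat) list"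
    by (induction M) (auto simp: algebra_simps power_add)
  have "(\<Sum>(d, k, l)\<leftarrow>concat (map (\<lambda>(c, i, j). map (\<lambda>(d, k, l). (c * d, i + k, j + l)) L') M). d * (x ^ k * y ^ l))
    = (\<Sum>(c, i, j)\<leftarrow>M. c * (x ^ i * y ^ j)) * (\<Sum>(d, k, l)\<leftarrow>L'. d * (x ^ k * y ^ l))" for x y :: real and M
  proof (induction M)
    case (Cons m M)
    obtain c i j where m: "m = (c, i, j)" by (cases m)
    show ?case using Cons one[where c = c and i = i and j = j and M = L' and x = x and y = y] by (simp add: m distrib_right)
  qed simp
  then show ?case
    by (intro exI[of _ "concat (map (\<lambda>(c, i, j). map (\<lambda>(d, k, l). (c * d, i + k, j + l)) L') L)"])
       (simp only: L)
qed

text \<open>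
  Equality of the real parts, say, is the vanishing of a signed combination of four finite measures, the upper and lower
  variations on both sides; all its moments are zero.
\<close>

theorem complex_measure_eqI:
  assumes \<mu>: "complex_measure (borel_square a b) \<mu>" and \<mu>': "complex_measure (borel_square a b) \<mu>'"
    and eq: "\<And>i j. complex_moment a b \<mu> i j = complex_moment a b \<mu>' i j"
  shows "\<mu> = \<mu>'"
proof
  fix S
  interpret m: complex_measure_square a b \<mu> by unfold_locales (rule \<mu>)
  interpret m': complex_measure_square a b \<mu>' by unfold_locales (rule \<mu>')
  let ?N = "borel_square a b"
  have poly_eq: "complex_integral ?N \<mu> (\<lambda>p. complex_of_real (g p)) = complex_integral ?N \<mu>' (\<lambda>p. complex_of_real (g p))"
    if g: "real_polynomial_function g" for g
  proof -
    obtain L :: "(real \<times> nat \<times> nat) list" where L: "g = (\<lambda>p. \<Sum>(c, i, j)\<leftarrow>L. c * (fst p ^ i * snd p ^ j))"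
      using real_polynomial_function_pair[OF g] by blast
    have "(\<lambda>p. complex_of_real (g p)) = (\<lambda>p. \<Sum>k\<in>{0..<length L}. complex_of_real (fst (L ! k)) *
        complex_of_real (fst p ^ fst (snd (L ! k)) * snd p ^ snd (snd (L ! k))))"
      unfolding L by (simp add: sum_list_sum_nth case_prod_unfold fun_eq_iff)
    then show ?thesis
      by (simp only: m.complex_integral_monomials[OF finite_atLeastLessThan]
          m'.complex_integral_monomials[OF finite_atLeastLessThan] eq)
  qed
  have compare: "measure n1 S - measure n2 S = measure n3 S - measure n4 S"
    if fin: "finite_measure n1" "finite_measure n2" "finite_measure n3" "finite_measure n4"
      and sets: "sets n1 = sets ?N" "sets n2 = sets ?N" "sets n3 = sets ?N" "sets n4 = sets ?N"
      and int: "\<And>g. real_polynomial_function g \<Longrightarrow> (\<integral>p. g p \<partial>n1) - (\<integral>p. g p \<partial>n2) = (\<integral>p. g p \<partial>n3) - (\<integral>p. g p \<partial>n4)"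
      and S: "S \<in> sets ?N"
    for n1 n2 n3 n4 :: "(real \<times> real) measure"
  proof -
    let ?K = "{a..b} \<times> {a..b}"
    obtain T where T: "T \<in> sets borel" "S = ?K \<inter> T"
      using S unfolding borel_square_def sets_restrict_space by auto
    define n where "n k = (if k = 0 then n1 else if k = 1 then n2 else if k = 2 then n3 else n4)" for k :: nat
    define f where "f k = (\<lambda>p :: real \<times> real. if k = 0 \<or> k = 3 then 1 else -1 :: real)" for k :: nat
    have sum4: "(\<Sum>k\<in>{0, 1, 2, 3::nat}. h k) = h 0 + h 1 + h 2 + h 3" for h :: "nat \<Rightarrow> real" by simp
    have "(\<Sum>k\<in>{0, 1, 2, 3}. \<integral>p. indicator T p * f k p \<partial>n k) = 0"
    proof (rule moment_uniqueness[where K = ?K and B = "\<lambda>_. 1"])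
      show "finite_measure (n k)" for k using fin by (simp add: n_def)
      show "sets (n k) = sets (restrict_space borel ?K)" for k using sets by (simp add: n_def borel_square_def)
      show "(\<Sum>k\<in>{0, 1, 2, 3}. \<integral>p. g p * f k p \<partial>n k) = 0" if "real_polynomial_function g" for g
        using int[OF that] unfolding sum4 by (simp add: n_def f_def)
      show "f k \<in> borel_measurable (n k)" "\<bar>f k p\<bar> \<le> 1" for k p by (simp_all add: f_def)
      show "compact ?K" by (intro compact_Times compact_Icc)
    qed (simp_all add: T)
    moreover have "(\<integral>p. indicator T p \<partial>n k) = measure (n k) S" for k
    proof -
      have "sets (n k) = sets ?N" using sets by (simp add: n_def)
      then have "space (n k) = space ?N" by (rule sets_eq_imp_space_eq)
      also have "\<dots> = ?K" by (simp add: borel_square_def space_restrict_space)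
      finally show ?thesis using T by (simp add: Int_commute)
    qed
    ultimately have "measure (n 0) S - measure (n 1) S - measure (n 2) S + measure (n 3) S = 0"
      unfolding sum4 by (simp add: f_def)
    then show ?thesis by (simp add: n_def)
  qed
  show "\<mu> S = \<mu>' S"
  proof (cases "S \<in> sets ?N")
    case False
    then show ?thesis using \<mu> \<mu>' by (simp add: complex_measure_def)
  next
    case True
    have "Re (\<mu> S) = Re (\<mu>' S)"
      unfolding Jordan_decomposition[OF m.re.signed_measure_axioms True] Jordan_decomposition[OF m'.re.signed_measure_axioms True]
    proof (rule compare[OF m.re.finite_upper m.re_neg.finite_upper m'.re.finite_upper m'.re_neg.finite_upper _ _ _ _ _ True])
      show "integral\<^sup>L (upper_variation ?N (\<lambda>S. Re (\<mu> S))) g - integral\<^sup>L (upper_variation ?N (\<lambda>S. - Re (\<mu> S))) g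
        = integral\<^sup>L (upper_variation ?N (\<lambda>S. Re (\<mu>' S))) g - integral\<^sup>L (upper_variation ?N (\<lambda>S. - Re (\<mu>' S))) g"
        if "real_polynomial_function g" for g
        using poly_eq[OF that] unfolding m.complex_integral_of_real m'.complex_integral_of_real by simp
    qed simp_all
    moreover have "Im (\<mu> S) = Im (\<mu>' S)"
      unfolding Jordan_decomposition[OF m.im.signed_measure_axioms True] Jordan_decomposition[OF m'.im.signed_measure_axioms True]
    proof (rule compare[OF m.im.finite_upper m.im_neg.finite_upper m'.im.finite_upper m'.im_neg.finite_upper _ _ _ _ _ True])
      show "integral\<^sup>L (upper_variation ?N (\<lambda>S. Im (\<mu> S))) g - integral\<^sup>L (upper_variation ?N (\<lambda>S. - Im (\<mu> S))) g
        = integral\<^sup>L (upper_variation ?N (\<lambda>S. Im (\<mu>' S))) g - integral\<^sup>L (upper_variation ?N (\<lambda>S. - Im (\<mu>' S))) g"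
        if "real_polynomial_function g" for g
        using poly_eq[OF that] unfolding m.complex_integral_of_real m'.complex_integral_of_real by simp
    qed simp_all
    ultimately show ?thesis by (rule complex_eqI)
  qed
qed

text \<open>
  The integral is defined by the Jordan decomposition of \<open>\<mu> = (\<nu>\<^sub>1 - \<nu>\<^sub>2) / 4\<close>, whose parts need not be \<open>\<nu>\<^sub>1 / 4\<close> and \<open>\<nu>\<^sub>2 / 4\<close>.  The
  signed combinations of measures agree on all sets, hence they give the same integrals.
\<close>

theorem complex_measure_of_difference:
  assumes \<nu>1: "finite_measure \<nu>1" "sets \<nu>1 = sets (borel_square a b)"
    and \<nu>2: "finite_measure \<nu>2" "sets \<nu>2 = sets (borel_square a b)"
  shows "\<exists>\<mu>. complex_measure (borel_square a b) \<mu> \<and> (\<forall>i j. complex_moment a b \<mu> i j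
     = complex_of_real (((\<integral>p. fst p ^ i * snd p ^ j \<partial>\<nu>1) - (\<integral>p. fst p ^ i * snd p ^ j \<partial>\<nu>2)) / 4))"
proof -
  let ?N = "borel_square a b"
  define \<mu> where "\<mu> S = (if S \<in> sets ?N then complex_of_real ((measure \<nu>1 S - measure \<nu>2 S) / 4) else 0)" for S
  have \<mu>: "complex_measure ?N \<mu>"
    unfolding complex_measure_def
  proof (intro conjI allI impI)
    show "\<mu> S = 0" if "S \<notin> sets ?N" for S using that by (simp add: \<mu>_def)
    fix F :: "nat \<Rightarrow> (real \<times> real) set" assume F: "range F \<subseteq> sets ?N" "disjoint_family F"
    have "(\<lambda>n. measure \<nu>1 (F n)) sums measure \<nu>1 (\<Union>n. F n)" "(\<lambda>n. measure \<nu>2 (F n)) sums measure \<nu>2 (\<Union>n. F n)"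
      using F \<nu>1 \<nu>2 by (auto intro!: finite_measure.finite_measure_UNION)
    then have "(\<lambda>n. complex_of_real ((measure \<nu>1 (F n) - measure \<nu>2 (F n)) / 4)) sums
       complex_of_real ((measure \<nu>1 (\<Union>n. F n) - measure \<nu>2 (\<Union>n. F n)) / 4)"
      by (intro sums_of_real sums_divide sums_diff)
    moreover have "F n \<in> sets ?N" "(\<Union>n. F n) \<in> sets ?N" for n using F(1) by auto
    ultimately show "(\<lambda>n. \<mu> (F n)) sums \<mu> (\<Union>n. F n)" by (simp add: \<mu>_def)
  qed
  interpret m: complex_measure_square a b \<mu> by unfold_locales (rule \<mu>)
  let ?p = "upper_variation ?N (\<lambda>S. Re (\<mu> S))" and ?n = "upper_variation ?N (\<lambda>S. - Re (\<mu> S))"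
  have "complex_moment a b \<mu> i j
     = complex_of_real (((\<integral>p. fst p ^ i * snd p ^ j \<partial>\<nu>1) - (\<integral>p. fst p ^ i * snd p ^ j \<partial>\<nu>2)) / 4)" for i j
  proof -
    let ?g = "\<lambda>p :: real \<times> real. fst p ^ i * snd p ^ j"
    define n where "n k = (if k = 0 then ?p else if k = 1 then ?n else if k = 2 then \<nu>1 else \<nu>2)" for k :: nat
    define r where "r k = (if k = 0 then 1 else if k = 1 then -1 else if k = 2 then -1/4 else 1/4 :: real)" for k :: nat
    have sum4: "(\<Sum>k\<in>{0, 1, 2, 3::nat}. h k) = h 0 + h 1 + h 2 + h 3" for h :: "nat \<Rightarrow> real" by simp
    have "compact (?g ` ({a..b} \<times> {a..b}))"
      by (intro compact_continuous_image compact_Times compact_Icc continuous_intros)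
    from compact_imp_bounded[OF this] obtain C where C0: "\<forall>z\<in>?g ` ({a..b} \<times> {a..b}). norm z \<le> C"
      unfolding bounded_iff by blast
    have C: "\<bar>?g p\<bar> \<le> C" if "p \<in> {a..b} \<times> {a..b}" for p
      using bspec[OF C0 imageI[OF that]] unfolding real_norm_def .
    have sp: "space ?N = {a..b} \<times> {a..b}" by (simp add: borel_square_def space_restrict_space)
    have "(\<Sum>k\<in>{0, 1, 2, 3}. r k * (\<integral>p. ?g p \<partial>n k)) = 0"
    proof (rule integral_combination_zero[where M = ?N and B = C])
      show "finite_measure (n k)" for k
        using \<nu>1 \<nu>2 m.re.finite_upper m.re_neg.finite_upper by (simp add: n_def)
      show "sets (n k) = sets ?N" for k using \<nu>1 \<nu>2 by (simp add: n_def)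
      show "(\<Sum>k\<in>{0, 1, 2, 3}. r k * measure (n k) S) = 0" if S: "S \<in> sets ?N" for S
        using Jordan_decomposition[OF m.re.signed_measure_axioms S] S
        unfolding sum4 by (simp add: n_def r_def \<mu>_def field_simps)
      show "?g \<in> borel_measurable ?N"
        unfolding borel_square_def
        by (intro measurable_restrict_space1 borel_measurable_continuous_onI continuous_intros)
      show "\<bar>?g p\<bar> \<le> C" if "p \<in> space ?N" for p using C that unfolding sp .
    qed simp
    then have "(\<integral>p. ?g p \<partial>?p) - (\<integral>p. ?g p \<partial>?n) = ((\<integral>p. ?g p \<partial>\<nu>1) - (\<integral>p. ?g p \<partial>\<nu>2)) / 4"
      unfolding sum4 by (simp add: n_def r_def field_simps)
    moreover have "(\<lambda>S. Im (\<mu> S)) = (\<lambda>S. - Im (\<mu> S))" by (simp add: \<mu>_def fun_eq_iff)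
    ultimately show ?thesis
      unfolding complex_moment_def m.complex_integral_of_real by (simp add: complex_eq_iff)
  qed
  then show ?thesis using \<mu> by blast
qed

section \<open>Partial derivatives of polynomials\<close>

lemma partial_x_poly2:
  "partial_x (poly2 n c) x y = (\<Sum>k\<in>poly_degrees n. (c (fst k) (snd k) * of_nat (fst k)) *
     complex_of_real (x ^ (fst k - 1) * y ^ snd k))"
proof -
  have "poly2 n c t y = (\<Sum>k\<in>poly_degrees n. (c (fst k) (snd k) * complex_of_real (y ^ snd k)) * complex_of_real (t ^ fst k))" for t
    by (simp add: poly2_def poly_degrees_def case_prod_unfold ac_simps)
  moreover have "((\<lambda>t. \<Sum>k\<in>poly_degrees n. (c (fst k) (snd k) * complex_of_real (y ^ snd k)) * complex_of_real (t ^ fst k))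
     has_vector_derivative (\<Sum>k\<in>poly_degrees n. (c (fst k) (snd k) * complex_of_real (y ^ snd k)) *
       complex_of_real (real (fst k) * x ^ (fst k - Suc 0)))) (at x)"
    by (intro has_vector_derivative_sum has_vector_derivative_mult_right has_vector_derivative_of_real DERIV_pow)
  ultimately show ?thesis
    unfolding partial_x_def by (simp add: vector_derivative_at ac_simps)
qed

lemma partial_y_poly2:
  "partial_y (poly2 n c) x y = (\<Sum>k\<in>poly_degrees n. (c (fst k) (snd k) * of_nat (snd k)) *
     complex_of_real (x ^ fst k * y ^ (snd k - 1)))"
proof -
  have "poly2 n c x = (\<lambda>t. \<Sum>k\<in>poly_degrees n. (c (fst k) (snd k) * complex_of_real (x ^ fst k)) * complex_of_real (t ^ snd k))"
    by (simp add: poly2_def poly_degrees_def case_prod_unfold ac_simps fun_eq_iff)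
  moreover have "((\<lambda>t. \<Sum>k\<in>poly_degrees n. (c (fst k) (snd k) * complex_of_real (x ^ fst k)) * complex_of_real (t ^ snd k))
     has_vector_derivative (\<Sum>k\<in>poly_degrees n. (c (fst k) (snd k) * complex_of_real (x ^ fst k)) *
       complex_of_real (real (snd k) * y ^ (snd k - Suc 0)))) (at y)"
    by (intro has_vector_derivative_sum has_vector_derivative_mult_right has_vector_derivative_of_real DERIV_pow)
  ultimately show ?thesis
    unfolding partial_y_def by (simp add: vector_derivative_at ac_simps)
qed

lemma (in complex_measure_square) complex_integral_curl:
  "complex_integral (borel_square a b) \<mu> (\<lambda>(x, y). partial_x (poly2 m d) x y - partial_y (poly2 n c) x y)
   = (\<Sum>k\<in>poly_degrees m. d (fst k) (snd k) * of_nat (fst k) * complex_moment a b \<mu> (fst k - 1) (snd k))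
   - (\<Sum>k\<in>poly_degrees n. c (fst k) (snd k) * of_nat (snd k) * complex_moment a b \<mu> (fst k) (snd k - 1))"
proof -
  let ?f = "\<lambda>p. \<Sum>k\<in>poly_degrees m. (d (fst k) (snd k) * of_nat (fst k)) * complex_of_real (fst p ^ (fst k - 1) * snd p ^ snd k)"
  let ?g = "\<lambda>p. \<Sum>k\<in>poly_degrees n. (- (c (fst k) (snd k) * of_nat (snd k))) * complex_of_real (fst p ^ fst k * snd p ^ (snd k - 1))"
  have eq: "(\<lambda>(x, y). partial_x (poly2 m d) x y - partial_y (poly2 n c) x y) = (\<lambda>p. ?f p + ?g p)"
    by (simp add: partial_x_poly2 partial_y_poly2 case_prod_unfold fun_eq_iff sum_negf)
  have "continuous_on UNIV ?f" "continuous_on UNIV ?g" by (intro continuous_intros)+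
  then show ?thesis
    unfolding eq by (simp only: complex_integral_add complex_integral_monomials[OF finite_poly_degrees])
      (simp add: sum_negf)
qed

section \<open>The trace formula\<close>

lemma scalar_op_scaleR: "scalar_op (complex_of_real r * c) = r *\<^sub>R scalar_op c"
  by (rule blinfun_eqI) (simp add: scalar_op.rep_eq blinfun.scaleR_left scaleC_of_real flip: scaleC_scaleC)

lemma scalar_op_divide: "scalar_op (c / of_nat n) = (1 / real n) *\<^sub>R scalar_op c"
  using scalar_op_scaleR[of "1 / real n" c] by simp

lemma scalar_op_minus: "scalar_op (- c) = - scalar_op c"
  using scalar_op_scaleR[of "-1" c] by simp

context commuting_pairs
begin

lemma integral_left:
  assumes "spectrum_in A a b" "spectrum_in A' a b"
  shows "has_op_integral a b A A' (\<lambda>x. op_poly2_left n c x C)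
    (\<Sum>k\<in>poly_degrees n. (1 / real (Suc (fst k))) *\<^sub>R ((scalar_op (c (fst k) (snd k)) o\<^sub>L op_pow C (snd k)) o\<^sub>L
       (op_pow A' (Suc (fst k)) - op_pow A (Suc (fst k)))))"
  by (rule has_op_integral_polynomial[OF ab assms finite_poly_degrees]) (rule op_poly2_left_eq)

lemma integral_right:
  assumes "spectrum_in A a b" "spectrum_in A' a b"
  shows "has_op_integral a b A A' (\<lambda>y. op_poly2_right n c C y)
    (\<Sum>k\<in>poly_degrees n. (1 / real (Suc (snd k))) *\<^sub>R ((scalar_op (c (fst k) (snd k)) o\<^sub>L op_pow C (fst k)) o\<^sub>L
       (op_pow A' (Suc (snd k)) - op_pow A (Suc (snd k)))))"
  by (rule has_op_integral_polynomial[OF ab assms finite_poly_degrees]) (rule op_poly2_right_eq)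

lemma integral_left_diff:
  assumes "spectrum_in A a b" "spectrum_in A' a b"
  shows "has_op_integral a b A A' (\<lambda>x. op_poly2_left n c x C - op_poly2_left n c x C')
    (\<Sum>k\<in>poly_degrees n. (1 / real (Suc (fst k))) *\<^sub>R ((scalar_op (c (fst k) (snd k)) o\<^sub>L (op_pow C (snd k) - op_pow C' (snd k))) o\<^sub>L
       (op_pow A' (Suc (fst k)) - op_pow A (Suc (fst k)))))"
  by (rule has_op_integral_polynomial[OF ab assms finite_poly_degrees])
     (simp add: op_poly2_left_eq sum_subtractf[symmetric] scaleR_diff_right[symmetric] blinfun_comp.diff_right)

lemma integral_right_diff:
  assumes "spectrum_in A a b" "spectrum_in A' a b"
  shows "has_op_integral a b A A' (\<lambda>y. op_poly2_right n c C y - op_poly2_right n c C' y)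
    (\<Sum>k\<in>poly_degrees n. (1 / real (Suc (snd k))) *\<^sub>R ((scalar_op (c (fst k) (snd k)) o\<^sub>L (op_pow C (fst k) - op_pow C' (fst k))) o\<^sub>L
       (op_pow A' (Suc (snd k)) - op_pow A (Suc (snd k)))))"
  by (rule has_op_integral_polynomial[OF ab assms finite_poly_degrees])
     (simp add: op_poly2_right_eq sum_subtractf[symmetric] scaleR_diff_right[symmetric] blinfun_comp.diff_right)

text \<open>
  The operator under the trace, in closed form.  A term \<open>c x\<^sup>i y\<^sup>j\<close> of the first polynomial contributes
  \<open>- c Q\<^sub>j P\<^sub>i\<^sub>+\<^sub>1 / (i + 1)\<close>, and a term \<open>d x\<^sup>r y\<^sup>s\<close> of the second one contributes \<open>d P\<^sub>r Q\<^sub>s\<^sub>+\<^sub>1 / (s + 1)\<close>.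
\<close>

definition stokes_op :: "nat \<Rightarrow> (nat \<Rightarrow> nat \<Rightarrow> complex) \<Rightarrow> nat \<Rightarrow> (nat \<Rightarrow> nat \<Rightarrow> complex) \<Rightarrow> 'a bop" where
  "stokes_op n c m d =
     (\<Sum>k\<in>poly_degrees n. scalar_op (- c (fst k) (snd k) / of_nat (Suc (fst k))) o\<^sub>L (Q (snd k) o\<^sub>L P (Suc (fst k)))) +
     (\<Sum>k\<in>poly_degrees m. scalar_op (d (fst k) (snd k) / of_nat (Suc (snd k))) o\<^sub>L (P (fst k) o\<^sub>L Q (Suc (snd k))))"

lemmas bilinear_simps = blinfun_comp.diff_left blinfun_comp.diff_right blinfun_comp.minus_left blinfun_comp.minus_right
  blinfun_comp.scaleR_left blinfun_comp.scaleR_right scaleR_diff_right blinfun_compose_assoc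

text \<open>
  Interchanging the limits of integration changes the sign, so the first and third integral combine to a difference of
  powers in the coefficient, and so do the second and fourth.
\<close>

lemma sum_of_four_integrals:
  "op_integral a b H10 H1 (\<lambda>x. op_poly2_left n c x H20) + op_integral a b H20 H2 (\<lambda>y. op_poly2_right m d H1 y)
   + op_integral a b H1 H10 (\<lambda>x. op_poly2_left n c x H2) + op_integral a b H2 H20 (\<lambda>y. op_poly2_right m d H10 y)
   = stokes_op n c m d"
proof -
  note I = has_op_integral_unique[OF integral_left[OF H(3,1)], of n c H20]
    has_op_integral_unique[OF integral_right[OF H(4,2)], of m d H1]
    has_op_integral_unique[OF integral_left[OF H(1,3)], of n c H2]
    has_op_integral_unique[OF integral_right[OF H(2,4)], of m d H10]
  have "(r *\<^sub>R ((S o\<^sub>L U) o\<^sub>L (X - Y))) + (r *\<^sub>R ((S o\<^sub>L U') o\<^sub>L (Y - X))) = (- r *\<^sub>R S) o\<^sub>L ((U' - U) o\<^sub>L (X - Y))"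
    for r and S U U' X Y :: "'a bop"
    by (simp add: bilinear_simps)
  then have 1: "(1 / real (Suc i)) *\<^sub>R ((scalar_op e o\<^sub>L op_pow H20 j) o\<^sub>L (op_pow H1 (Suc i) - op_pow H10 (Suc i)))
      + (1 / real (Suc i)) *\<^sub>R ((scalar_op e o\<^sub>L op_pow H2 j) o\<^sub>L (op_pow H10 (Suc i) - op_pow H1 (Suc i)))
      = scalar_op (- e / of_nat (Suc i)) o\<^sub>L (Q j o\<^sub>L P (Suc i))" for e i j
    unfolding scalar_op_divide scalar_op_minus P_def Q_def by simp
  have "(r *\<^sub>R ((S o\<^sub>L U) o\<^sub>L (X - Y))) + (r *\<^sub>R ((S o\<^sub>L U') o\<^sub>L (Y - X))) = (r *\<^sub>R S) o\<^sub>L ((U - U') o\<^sub>L (X - Y))"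
    for r and S U U' X Y :: "'a bop"
    by (simp add: bilinear_simps)
  then have 2: "(1 / real (Suc s)) *\<^sub>R ((scalar_op e o\<^sub>L op_pow H1 r) o\<^sub>L (op_pow H2 (Suc s) - op_pow H20 (Suc s)))
      + (1 / real (Suc s)) *\<^sub>R ((scalar_op e o\<^sub>L op_pow H10 r) o\<^sub>L (op_pow H20 (Suc s) - op_pow H2 (Suc s)))
      = scalar_op (e / of_nat (Suc s)) o\<^sub>L (P r o\<^sub>L Q (Suc s))" for e r s
    unfolding scalar_op_divide P_def Q_def by blast
  have rearrange: "A + B + C + D = (A + C) + (B + D)" for A B C D :: "'a bop" by (simp add: algebra_simps)
  show ?thesis
    unfolding I rearrange sum.distrib[symmetric] 1 2 stokes_op_def ..
qed

lemma sum_of_two_integrals: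
  "op_integral a b H10 H1 (\<lambda>x. op_poly2_left n c x H20 - op_poly2_left n c x H2)
   + op_integral a b H20 H2 (\<lambda>y. op_poly2_right m d H1 y - op_poly2_right m d H10 y) = stokes_op n c m d"
proof -
  note I = has_op_integral_unique[OF integral_left_diff[OF H(3,1)], of n c H20 H2]
    has_op_integral_unique[OF integral_right_diff[OF H(4,2)], of m d H1 H10]
  have "r *\<^sub>R ((S o\<^sub>L (U - U')) o\<^sub>L X) = (- r *\<^sub>R S) o\<^sub>L ((U' - U) o\<^sub>L X)" for r and S U U' X :: "'a bop"
    by (simp add: bilinear_simps)
  then have 1: "(1 / real (Suc i)) *\<^sub>R ((scalar_op e o\<^sub>L (op_pow H20 j - op_pow H2 j)) o\<^sub>L (op_pow H1 (Suc i) - op_pow H10 (Suc i)))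
      = scalar_op (- e / of_nat (Suc i)) o\<^sub>L (Q j o\<^sub>L P (Suc i))" for e i j
    unfolding scalar_op_divide scalar_op_minus P_def Q_def by simp
  have 2: "(1 / real (Suc s)) *\<^sub>R ((scalar_op e o\<^sub>L (op_pow H1 r - op_pow H10 r)) o\<^sub>L (op_pow H2 (Suc s) - op_pow H20 (Suc s)))
      = scalar_op (e / of_nat (Suc s)) o\<^sub>L (P r o\<^sub>L Q (Suc s))" for e r s
    unfolding scalar_op_divide P_def Q_def blinfun_compose_assoc blinfun_comp.scaleR_left ..
  show ?thesis unfolding I 1 2 stokes_op_def ..
qed

text \<open>
  A single sum over the disjoint union of the index sets, in the form required by the results on sums of products.
\<close>

lemma stokes_op_products:
  "stokes_op n c m d = (\<Sum>k\<in>poly_degrees n <+> poly_degrees m.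
     scalar_op (case_sum (\<lambda>k. - c (fst k) (snd k) / of_nat (Suc (fst k))) (\<lambda>k. d (fst k) (snd k) / of_nat (Suc (snd k))) k) o\<^sub>L
     (case_sum (\<lambda>k. Q (snd k)) (\<lambda>k. P (fst k)) k o\<^sub>L case_sum (\<lambda>k. P (Suc (fst k))) (\<lambda>k. Q (Suc (snd k))) k))"
  by (simp only: sum.Plus[OF finite_poly_degrees finite_poly_degrees] stokes_op_def o_def sum.case)

lemma trace_class_stokes_op: "trace_class (stokes_op n c m d)"
  unfolding stokes_op_products blinfun_compose_assoc[symmetric]
  by (rule trace_class_sum_products[OF B])
     (auto simp: finite_poly_degrees intro!: HS_compose_left clinear_scalar_op P_HS Q_HS)

lemma trace_stokes_op:
  assumes "B = (SOME B. is_onb B)"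
  shows "op_trace (stokes_op n c m d) =
     (\<Sum>k\<in>poly_degrees n. - c (fst k) (snd k) / of_nat (Suc (fst k)) * of_real (trace_PQ (Suc (fst k)) (snd k))) +
     (\<Sum>k\<in>poly_degrees m. d (fst k) (snd k) / of_nat (Suc (snd k)) * of_real (trace_PQ (fst k) (Suc (snd k))))"
  unfolding stokes_op_products
  by (subst op_trace_sum_products[OF assms])
     (auto simp: finite_poly_degrees sum.Plus o_def hs_QP hs_PQ P_HS Q_HS P_selfadjoint Q_selfadjoint)

text \<open>
  Differentiation of \<open>x\<^sup>r\<close> brings out the factor \<open>r\<close>, and the moment formula for \<open>Tr (P\<^sub>r Q\<^sub>s\<^sub>+\<^sub>1)\<close> the factor \<open>r (s + 1)\<close>; so the two
  sides agree term by term.  When an exponent is zero the term vanishes on both sides, with the truncated exponent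
  \<open>0 - 1\<close> multiplied by zero.
\<close>

theorem stokes_formula:
  assumes B_def: "B = (SOME B. is_onb B)"
  shows "\<exists>!\<mu>. complex_measure (borel_square a b) \<mu> \<and>
    (\<forall>n c m d. op_trace (stokes_op n c m d) = complex_integral (borel_square a b) \<mu>
          (\<lambda>(x, y). partial_x (poly2 m d) x y - partial_y (poly2 n c) x y))"
proof -
  obtain \<nu>1 \<nu>2 where \<nu>: "finite_measure \<nu>1" "sets \<nu>1 = sets (borel_square a b)"
     "finite_measure \<nu>2" "sets \<nu>2 = sets (borel_square a b)"
    and tr: "\<And>i j. trace_PQ (Suc i) (Suc j) = real (Suc i) * real (Suc j) *
        ((\<integral>p. fst p ^ i * snd p ^ j \<partial>\<nu>1) - (\<integral>p. fst p ^ i * snd p ^ j \<partial>\<nu>2)) / 4"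
    using trace_moment_measures by blast
  obtain \<mu> where \<mu>: "complex_measure (borel_square a b) \<mu>"
    and mom: "\<And>i j. complex_moment a b \<mu> i j
     = complex_of_real (((\<integral>p. fst p ^ i * snd p ^ j \<partial>\<nu>1) - (\<integral>p. fst p ^ i * snd p ^ j \<partial>\<nu>2)) / 4)"
    using complex_measure_of_difference[OF \<nu>] by blast
  interpret m: complex_measure_square a b \<mu> by unfold_locales (rule \<mu>)
  have tr': "complex_of_real (trace_PQ (Suc i) (Suc j)) = of_nat (Suc i) * of_nat (Suc j) * complex_moment a b \<mu> i j" for i j
    unfolding tr mom by simp
  have tr1: "- e / of_nat (Suc i) * complex_of_real (trace_PQ (Suc i) j) = - (e * of_nat j * complex_moment a b \<mu> i (j - 1))" for e i j
  proof (cases j)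
    case (Suc l)
    show ?thesis unfolding Suc tr' by (simp add: field_simps del: of_nat_Suc)
  qed (simp add: trace_PQ_0)
  have tr2: "e / of_nat (Suc s) * complex_of_real (trace_PQ r (Suc s)) = e * of_nat r * complex_moment a b \<mu> (r - 1) s" for e r s
  proof (cases r)
    case (Suc l)
    show ?thesis unfolding Suc tr' by (simp add: field_simps del: of_nat_Suc)
  qed (simp add: trace_PQ_0)
  have ex: "op_trace (stokes_op n c m d) = complex_integral (borel_square a b) \<mu>
          (\<lambda>(x, y). partial_x (poly2 m d) x y - partial_y (poly2 n c) x y)" for n c m d
    unfolding m.complex_integral_curl trace_stokes_op[OF B_def] tr1 tr2 by (simp add: sum_negf)
  show ?thesis
  proof (intro ex1I[of _ \<mu>] conjI allI \<mu> ex)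
    fix \<mu>' assume \<mu>': "complex_measure (borel_square a b) \<mu>' \<and>
      (\<forall>n c m d. op_trace (stokes_op n c m d) = complex_integral (borel_square a b) \<mu>'
          (\<lambda>(x, y). partial_x (poly2 m d) x y - partial_y (poly2 n c) x y))"
    interpret m': complex_measure_square a b \<mu>' by unfold_locales (use \<mu>' in blast)
    have "complex_moment a b \<mu>' i j = complex_moment a b \<mu> i j" for i j
    proof -
      \<comment> \<open>The polynomial \<open>x\<^sup>i\<^sup>+\<^sup>1 y\<^sup>j / (i + 1)\<close> has the partial derivative \<open>x\<^sup>i y\<^sup>j\<close>, so the formula
          determines every moment.\<close>
      define d :: "nat \<Rightarrow> nat \<Rightarrow> complex" where "d r s = (if r = Suc i \<and> s = j then 1 / of_nat (Suc i) else 0)" for r s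
      have curl: "complex_integral (borel_square a b) \<tau> (\<lambda>(x, y). partial_x (poly2 (Suc (i + j)) d) x y - partial_y (poly2 0 (\<lambda>_ _. 0)) x y)
         = complex_moment a b \<tau> i j" if \<tau>: "complex_measure (borel_square a b) \<tau>" for \<tau>
      proof -
        interpret t: complex_measure_square a b \<tau> by unfold_locales (rule \<tau>)
        have "(\<Sum>k\<in>poly_degrees (Suc (i + j)). d (fst k) (snd k) * of_nat (fst k) * complex_moment a b \<tau> (fst k - 1) (snd k))
          = (\<Sum>k\<in>poly_degrees (Suc (i + j)). if k = (Suc i, j) then complex_moment a b \<tau> i j else 0)"
          by (intro sum.cong refl) (auto simp: d_def prod_eq_iff simp del: of_nat_Suc)
        also have "\<dots> = complex_moment a b \<tau> i j"
          by (simp add: finite_poly_degrees) (simp add: poly_degrees_def)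
        finally show ?thesis unfolding t.complex_integral_curl by simp
      qed
      show ?thesis using curl[OF \<mu>] curl[of \<mu>'] \<mu>' ex by metis
    qed
    then show "\<mu>' = \<mu>" using complex_measure_eqI[OF _ \<mu>] \<mu>' by blast
  qed
qed

end

text \<open>
  The basis chosen in the definition of the trace is an orthonormal basis because, by the Hilbert-Schmidt hypothesis, there
  is one.
\<close>

theorem theorem4p1:
  fixes H1 H2 H10 H20 :: "'a::chilbert_space \<Rightarrow>\<^sub>L 'a" and a b :: real
  assumes separable: "\<exists>D :: 'a set. countable D \<and> closure D = UNIV"
    and selfadjoint: "selfadjoint_op H10" "selfadjoint_op H20" "selfadjoint_op H1" "selfadjoint_op H2"
    and commuting: "H10 o\<^sub>L H20 = H20 o\<^sub>L H10" "H1 o\<^sub>L H2 = H2 o\<^sub>L H1"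
    and hilbert_schmidt: "hilbert_schmidt (H1 - H10)" "hilbert_schmidt (H2 - H20)"
    and interval: "a \<le> b"
    and spectra: "op_spectrum H1 \<union> op_spectrum H10 \<union> (op_spectrum H2 \<union> op_spectrum H20)
                    \<subseteq> complex_of_real ` {a..b}"
  shows "\<exists>!\<mu>. complex_measure (borel_square a b) \<mu> \<and>
    (\<forall>(n::nat) (c::nat \<Rightarrow> nat \<Rightarrow> complex) (m::nat) (d::nat \<Rightarrow> nat \<Rightarrow> complex).
      let p1 = op_poly2_left n c; p2 = op_poly2_right m d;
          S = op_integral a b H10 H1 (\<lambda>x. p1 x H20) + op_integral a b H20 H2 (\<lambda>y. p2 H1 y)
            + op_integral a b H1 H10 (\<lambda>x. p1 x H2) + op_integral a b H2 H20 (\<lambda>y. p2 H10 y);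
          D = op_integral a b H10 H1 (\<lambda>x. p1 x H20 - p1 x H2)
            + op_integral a b H20 H2 (\<lambda>y. p2 H1 y - p2 H10 y)
      in
        op_integrable a b H10 H1 (\<lambda>x. p1 x H20) \<and> op_integrable a b H20 H2 (\<lambda>y. p2 H1 y) \<and>
        op_integrable a b H1 H10 (\<lambda>x. p1 x H2) \<and> op_integrable a b H2 H20 (\<lambda>y. p2 H10 y) \<and>
        op_integrable a b H10 H1 (\<lambda>x. p1 x H20 - p1 x H2) \<and>
        op_integrable a b H20 H2 (\<lambda>y. p2 H1 y - p2 H10 y) \<and>
        trace_class S \<and> trace_class D \<and>
        op_trace S = op_trace D \<and>
        op_trace D = complex_integral (borel_square a b) \<mu>
          (\<lambda>(x, y). partial_x (poly2 m d) x y - partial_y (poly2 n c) x y))"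
proof -
  define B where "B = (SOME B :: 'a set. is_onb B)"
  obtain C :: "'a set" where "is_onb C" using hilbert_schmidt(1) unfolding hilbert_schmidt_def by blast
  then have B: "is_onb B" unfolding B_def by (rule someI)
  interpret commuting_pairs H1 H2 H10 H20 a b B
  proof
    show "H1 - H10 \<in> HS B" "H2 - H20 \<in> HS B"
      by (intro hilbert_schmidt_HS B hilbert_schmidt selfadjoint_op_diff selfadjoint)+
    show "spectrum_in H1 a b" "spectrum_in H2 a b" "spectrum_in H10 a b" "spectrum_in H20 a b"
      using spectra selfadjoint by (simp_all add: spectrum_in_def)
  qed (fact interval B commuting)+
  have integrable: "op_integrable a b H10 H1 (\<lambda>x. op_poly2_left n c x H20)"
    "op_integrable a b H20 H2 (\<lambda>y. op_poly2_right m d H1 y)"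
    "op_integrable a b H1 H10 (\<lambda>x. op_poly2_left n c x H2)"
    "op_integrable a b H2 H20 (\<lambda>y. op_poly2_right m d H10 y)"
    "op_integrable a b H10 H1 (\<lambda>x. op_poly2_left n c x H20 - op_poly2_left n c x H2)"
    "op_integrable a b H20 H2 (\<lambda>y. op_poly2_right m d H1 y - op_poly2_right m d H10 y)" for n c m d
    unfolding op_integrable_def
    by (blast intro: integral_left integral_right integral_left_diff integral_right_diff H)+
  show ?thesis
    unfolding Let_def sum_of_four_integrals sum_of_two_integrals
    using stokes_formula[OF B_def] by (simp add: integrable trace_class_stokes_op)
qed

end
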